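(* For each $n\ge2$ let $a^{(n)}=(a^{(n)}(i,j))_{1\le i,j\le n}$ be a real matrix with $\sum_{j=1}^n a^{(n)}(i,j)=0$ for every $i$, let $s^{(n)}(a)>0$ be a real number, let $\pi^{(n)}$ be a uniform random permutation of $\{1,\dots,n\}$, and define $$Y_n(t):=\frac1{s^{(n)}(a)}\sum_{i=1}^{\lfloor nt\rfloor}a^{(n)}(i,\pi^{(n)}(i)),\qquad 0\le t\le1,$$ $$\Lambda^{(n)}(a):=\frac1{n\,(s^{(n)}(a))^3}\sum_{i,j=1}^n|a^{(n)}(i,j)|^3,$$ $$f_n(t):=\frac1{n(s^{(n)}(a))^2}\sum_{i=1}^{\lfloor nt\rfloor}\sum_{l=1}^n(a^{(n)}(i,l))^2,\qquad g_n(t,u):=\frac1{(n\,s^{(n)}(a))^2}\sum_{i=1}^{\lfloor nt\rfloor}\sum_{j=1}^{\lfloor nu\rfloor}\sum_{l=1}^na^{(n)}(i,l)a^{(n)}(j,l)$$ for $0\le t,u\le1$. Suppose that, as $n\to\infty$, $f_n\to f$ pointwise on $[0,1]$ and $g_n\to g$ pointwise on $[0,1]^2$, with $f$ continuous, and that $\Lambda^{(n)}(a)\log^2n\to0$. Then there exists a zero mean continuous Gaussian process $Z$ on $[0,1]$ with covariance function $$\operatorname{Cov}(Z(t),Z(u))=\sigma(t,u):=f(t\wedge u)-g(t,u),\qquad t,u\in[0,1],$$ and $Y_n\to Z$ in distribution in $D[0,1]$.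
   Context: $D[0,1]$ is the space of càdlàg real functions on $[0,1]$ with the Skorohod topology; $t\wedge u=\min(t,u)$. *)

theory Defs
  imports "HOL-Probability.Probability" "HOL-Combinatorics.Permutations"
begin

section \<open>The Skorohod space on the unit interval\<close>

text \<open>
  A function on the unit interval is represented by a function on the reals that is
  \<^const>\<open>undefined\<close> elsewhere (\<^const>\<open>extensional\<close>), so that equality on
  the interval is equality.
\<close>

definition cadlag_space :: "(real \<Rightarrow> real) set" where
  "cadlag_space = {x. x \<in> extensional {0..1}
     \<and> (\<forall>t\<in>{0..<1}. (x \<longlongrightarrow> x t) (at_right t))
     \<and> (\<forall>t\<in>{0<..1}. \<exists>l. (x \<longlongrightarrow> l) (at_left t))}"

definition time_changes :: "(real \<Rightarrow> real) set" where
  "time_changes = {\<kappa>. strict_mono_on {0..1} \<kappa> \<and> continuous_on {0..1} \<kappa>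
     \<and> \<kappa> ` {0..1} = {0..1}}"

definition skorohod_close :: "real \<Rightarrow> (real \<Rightarrow> real) \<Rightarrow> (real \<Rightarrow> real) \<Rightarrow> bool" where
  "skorohod_close e x y \<longleftrightarrow> 0 < e \<and>
     (\<exists>\<kappa>\<in>time_changes. \<forall>t\<in>{0..1}. \<bar>\<kappa> t - t\<bar> \<le> e \<and> \<bar>x t - y (\<kappa> t)\<bar> \<le> e)"

text \<open>
  The value 0 outside the space is only there because the locale \<^locale>\<open>Metric_space\<close>
  demands nonnegativity and symmetry for all arguments.
\<close>

definition skorohod_dist :: "(real \<Rightarrow> real) \<Rightarrow> (real \<Rightarrow> real) \<Rightarrow> real" where
  "skorohod_dist x y =
     (if x \<in> cadlag_space \<and> y \<in> cadlag_space then Inf {e. skorohod_close e x y} else 0)"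

lemma time_changes_id: "(\<lambda>t. t) \<in> time_changes"
  by (auto simp: time_changes_def strict_mono_on_def)

lemma time_changes_comp:
  assumes "f \<in> time_changes" "h \<in> time_changes"
  shows "(\<lambda>t. h (f t)) \<in> time_changes"
proof -
  have f: "strict_mono_on {0..1} f" "continuous_on {0..1} f" "f ` {0..1} = {0..1}"
    and h: "strict_mono_on {0..1} h" "continuous_on {0..1} h" "h ` {0..1} = {0..1}"
    using assms by (auto simp: time_changes_def)
  have "strict_mono_on {0..1} (\<lambda>t. h (f t))"
    by (rule strict_mono_onI) (use f(3) in \<open>auto intro!: strict_mono_onD[OF h(1)] strict_mono_onD[OF f(1)]\<close>)
  moreover have "continuous_on {0..1} (\<lambda>t. h (f t))"
    by (rule continuous_on_compose2[OF h(2) f(2)]) (use f(3) in auto)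
  moreover have "(\<lambda>t. h (f t)) ` {0..1} = {0..1}"
    using f(3) h(3) by (metis image_image)
  ultimately show ?thesis by (simp add: time_changes_def)
qed

lemma time_changes_inv:
  assumes "f \<in> time_changes"
  obtains h where "h \<in> time_changes" "\<And>t. t \<in> {0..1} \<Longrightarrow> h t \<in> {0..1} \<and> f (h t) = t"
proof -
  have f: "strict_mono_on {0..1} f" "continuous_on {0..1} f" "f ` {0..1} = {0..1}"
    using assms by (auto simp: time_changes_def)
  have inj: "inj_on f {0..1}" using f(1) by (rule strict_mono_on_imp_inj_on)
  define h where "h = inv_into {0..1} f"
  have hf: "h (f t) = t" if "t \<in> {0..1}" for t
    using that inj by (simp add: h_def)
  have fh: "h t \<in> {0..1} \<and> f (h t) = t" if "t \<in> {0..1}" for t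
    using that f(3) unfolding h_def by (metis f_inv_into_f inv_into_into)
  have "continuous_on (f ` {0..1}) h"
    by (rule continuous_on_inv[OF f(2)]) (auto simp: hf)
  moreover have "h ` {0..1} = {0..1}"
    using inv_into_image_cancel[OF inj, of "{0..1}"] f(3) by (simp add: h_def)
  moreover have "strict_mono_on {0..1} h"
  proof (rule strict_mono_onI)
    fix r s :: real assume rs: "r \<in> {0..1}" "s \<in> {0..1}" "r < s"
    show "h r < h s"
    proof (rule ccontr)
      assume "\<not> h r < h s"
      then have "h s \<le> h r" by simp
      then have "f (h s) \<le> f (h r)"
        using fh[OF rs(1)] fh[OF rs(2)] strict_mono_onD[OF f(1), of "h s" "h r"]
        unfolding le_less by metis
      then show False using fh[OF rs(1)] fh[OF rs(2)] rs(3) by simp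
    qed
  qed
  ultimately have "h \<in> time_changes" using f(3) by (simp add: time_changes_def)
  then show ?thesis using fh that by blast
qed

lemma time_changes_range: "f \<in> time_changes \<Longrightarrow> t \<in> {0..1} \<Longrightarrow> f t \<in> {0..1}"
  by (auto simp: time_changes_def)

lemma time_changes_1:
  assumes f: "f \<in> time_changes"
  shows "f 1 = 1"
proof -
  have mono: "strict_mono_on {0..1} f" and "1 \<in> f ` {0..1}"
    using f by (simp_all add: time_changes_def)
  then obtain u where u: "u \<in> {0..1}" "f u = 1" by (metis imageE)
  have "u = 1"
  proof (rule ccontr)
    assume "u \<noteq> 1"
    then have "f u < f 1" using u(1) by (intro strict_mono_onD[OF mono]) auto
    then show False using u(2) time_changes_range[OF f, of 1] by simp
  qed
  then show ?thesis using u(2) by simp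
qed

lemma cadlag_bounded:
  assumes x: "x \<in> cadlag_space"
  shows "\<exists>B. \<forall>t\<in>{0..1}. \<bar>x t\<bar> \<le> B"
proof -
  have loc: "\<exists>B d. 0 < d \<and> (\<forall>u\<in>{0..1}. \<bar>u - t\<bar> < d \<longrightarrow> \<bar>x u\<bar> \<le> B)" if t: "t \<in> {0..1}" for t
  proof -
    have R: "\<exists>B d. 0 < d \<and> (\<forall>u\<in>{0..1}. t < u \<and> u < t + d \<longrightarrow> \<bar>x u\<bar> \<le> B)"
    proof (cases "t < 1")
      case True
      then have "(x \<longlongrightarrow> x t) (at_right t)" using x t by (auto simp: cadlag_space_def)
      then have "eventually (\<lambda>u. dist (x u) (x t) < 1) (at_right t)" by (rule tendstoD) simp
      then obtain b where b: "t < b" "\<And>u. t < u \<Longrightarrow> u < b \<Longrightarrow> dist (x u) (x t) < 1"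
        unfolding eventually_at_right_field by blast
      have "\<bar>x u\<bar> \<le> \<bar>x t\<bar> + 1" if "t < u" "u < t + (b - t)" for u
        using b(2)[of u] that by (auto simp: dist_real_def)
      then show ?thesis using b(1) by (intro exI[of _ "\<bar>x t\<bar> + 1"] exI[of _ "b - t"]) auto
    qed (use t in \<open>auto intro!: exI[of _ 1]\<close>)
    have L: "\<exists>B d. 0 < d \<and> (\<forall>u\<in>{0..1}. t - d < u \<and> u < t \<longrightarrow> \<bar>x u\<bar> \<le> B)"
    proof (cases "0 < t")
      case True
      then obtain l where "(x \<longlongrightarrow> l) (at_left t)"
        using x t unfolding cadlag_space_def by force
      then have "eventually (\<lambda>u. dist (x u) l < 1) (at_left t)" by (rule tendstoD) simp
      then obtain b where b: "b < t" "\<And>u. b < u \<Longrightarrow> u < t \<Longrightarrow> dist (x u) l < 1"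
        unfolding eventually_at_left_field by blast
      have "\<bar>x u\<bar> \<le> \<bar>l\<bar> + 1" if "t - (t - b) < u" "u < t" for u
        using b(2)[of u] that by (auto simp: dist_real_def)
      then show ?thesis using b(1) by (intro exI[of _ "\<bar>l\<bar> + 1"] exI[of _ "t - b"]) auto
    qed (use t in \<open>auto intro!: exI[of _ 1]\<close>)
    obtain B1 d1 where 1: "0 < d1" "\<And>u. u \<in> {0..1} \<Longrightarrow> t < u \<Longrightarrow> u < t + d1 \<Longrightarrow> \<bar>x u\<bar> \<le> B1"
      using R by blast
    obtain B2 d2 where 2: "0 < d2" "\<And>u. u \<in> {0..1} \<Longrightarrow> t - d2 < u \<Longrightarrow> u < t \<Longrightarrow> \<bar>x u\<bar> \<le> B2"
      using L by blast
    have "\<bar>x u\<bar> \<le> max \<bar>x t\<bar> (max B1 B2)" if "u \<in> {0..1}" "\<bar>u - t\<bar> < min d1 d2" for u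
      using 1(2)[of u] 2(2)[of u] that by (cases u t rule: linorder_cases) (auto simp: le_max_iff_disj)
    then show ?thesis
      using 1(1) 2(1) by (intro exI[of _ "max \<bar>x t\<bar> (max B1 B2)"] exI[of _ "min d1 d2"]) auto
  qed
  then obtain B d where Bd: "\<And>t. t \<in> {0..1} \<Longrightarrow> 0 < d t \<and> (\<forall>u\<in>{0..1}. \<bar>u - t\<bar> < d t \<longrightarrow> \<bar>x u\<bar> \<le> B t)"
    by metis
  have "compact {0..1::real}" by simp
  then obtain C where C: "C \<subseteq> {0..1}" "finite C" "{0..1} \<subseteq> (\<Union>t\<in>C. ball t (d t))"
    by (rule compactE_image[where C = "{0..1}" and f = "\<lambda>t. ball t (d t)"]) (use Bd in auto)
  have "\<bar>x u\<bar> \<le> (\<Sum>t\<in>C. \<bar>B t\<bar>)" if u: "u \<in> {0..1}" for u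
  proof -
    obtain t where t: "t \<in> C" "\<bar>u - t\<bar> < d t" using C(3) u by (force simp: dist_real_def)
    have "\<bar>x u\<bar> \<le> \<bar>B t\<bar>" using Bd[of t] t u C(1) by force
    also have "\<dots> \<le> (\<Sum>t\<in>C. \<bar>B t\<bar>)" using t C(2) by (intro member_le_sum) auto
    finally show ?thesis .
  qed
  then show ?thesis by blast
qed

lemma skorohod_close_exists:
  assumes "x \<in> cadlag_space" "y \<in> cadlag_space"
  shows "\<exists>e. skorohod_close e x y"
proof -
  obtain A B where A: "\<forall>t\<in>{0..1}. \<bar>x t\<bar> \<le> A" and B: "\<forall>t\<in>{0..1}. \<bar>y t\<bar> \<le> B"
    using assms cadlag_bounded by blast
  have "0 \<le> A" "0 \<le> B" using A B by force+
  moreover have "\<bar>x t - y t\<bar> \<le> A + B + 1" if "t \<in> {0..1}" for t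
    using A[rule_format, OF that] B[rule_format, OF that] by linarith
  ultimately have "skorohod_close (A + B + 1) x y"
    unfolding skorohod_close_def by (auto intro!: bexI[OF _ time_changes_id])
  then show ?thesis ..
qed

lemma skorohod_close_sym: "skorohod_close e x y \<Longrightarrow> skorohod_close e y x"
proof -
  assume "skorohod_close e x y"
  then obtain f where e: "0 < e" and f: "f \<in> time_changes"
    "\<And>t. t \<in> {0..1} \<Longrightarrow> \<bar>f t - t\<bar> \<le> e \<and> \<bar>x t - y (f t)\<bar> \<le> e"
    by (auto simp: skorohod_close_def)
  obtain h where h: "h \<in> time_changes" "\<And>t. t \<in> {0..1} \<Longrightarrow> h t \<in> {0..1} \<and> f (h t) = t"
    using time_changes_inv[OF f(1)] by blast
  have "\<bar>h t - t\<bar> \<le> e \<and> \<bar>y t - x (h t)\<bar> \<le> e" if "t \<in> {0..1}" for t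
    using f(2)[of "h t"] h(2)[OF that] by (simp add: abs_minus_commute)
  then show ?thesis using e h(1) unfolding skorohod_close_def by blast
qed

lemma skorohod_close_trans:
  assumes "skorohod_close e x y" "skorohod_close e' y z"
  shows "skorohod_close (e + e') x z"
proof -
  obtain f where e: "0 < e" and f: "f \<in> time_changes"
    "\<And>t. t \<in> {0..1} \<Longrightarrow> \<bar>f t - t\<bar> \<le> e \<and> \<bar>x t - y (f t)\<bar> \<le> e"
    using assms(1) by (auto simp: skorohod_close_def)
  obtain h where e': "0 < e'" and h: "h \<in> time_changes"
    "\<And>t. t \<in> {0..1} \<Longrightarrow> \<bar>h t - t\<bar> \<le> e' \<and> \<bar>y t - z (h t)\<bar> \<le> e'"
    using assms(2) by (auto simp: skorohod_close_def)
  have "\<bar>h (f t) - t\<bar> \<le> e + e' \<and> \<bar>x t - z (h (f t))\<bar> \<le> e + e'" if "t \<in> {0..1}" for t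
    using f(2)[OF that] h(2)[OF time_changes_range[OF f(1) that]] by linarith
  then show ?thesis
    using e e' time_changes_comp[OF f(1) h(1)] unfolding skorohod_close_def
    by (intro conjI bexI[of _ "\<lambda>t. h (f t)"]) auto
qed

lemma skorohod_close_all_imp_eq:
  assumes x: "x \<in> cadlag_space" and y: "y \<in> cadlag_space"
    and close: "\<And>e. 0 < e \<Longrightarrow> \<exists>e'<e. skorohod_close e' x y"
  shows "x = y"
proof (rule extensionalityI[of _ "{0..1}"])
  show "x \<in> extensional {0..1}" "y \<in> extensional {0..1}" using x y by (auto simp: cadlag_space_def)
  fix t :: real assume t: "t \<in> {0..1}"
  have "\<bar>x t - y t\<bar> \<le> e" if e: "0 < e" for e
  proof (cases "t = 1")
    case True
    obtain e' f where f: "e' < e" "f \<in> time_changes" "\<bar>x 1 - y (f 1)\<bar> \<le> e'"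
      using close[OF e] by (force simp: skorohod_close_def)
    then show ?thesis using True time_changes_1[OF f(2)] by simp
  next
    case False
    then have t1: "t < 1" using t by simp
    have lim: "(x \<longlongrightarrow> x t) (at_right t)" "(y \<longlongrightarrow> y t) (at_right t)"
      using x y t t1 by (auto simp: cadlag_space_def)
    have "0 < e / 3" using e by simp
    then have "eventually (\<lambda>u. dist (x u) (x t) < e / 3 \<and> dist (y u) (y t) < e / 3) (at_right t)"
      using eventually_conj[OF tendstoD[OF lim(1)] tendstoD[OF lim(2)]] by blast
    then obtain b0 where b0: "t < b0" "\<And>u. t < u \<Longrightarrow> u < b0 \<Longrightarrow> dist (x u) (x t) < e / 3 \<and> dist (y u) (y t) < e / 3"
      unfolding eventually_at_right_field by blast
    define b where "b = min b0 1"
    have b: "t < b" "b \<le> 1" "b \<le> b0" using b0(1) t1 by (auto simp: b_def)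
    define u where "u = (t + b) / 2"
    have u: "t < u" "u < b" "u \<in> {0..1}" using b t by (auto simp: u_def)
    have "0 < min (e / 3) ((b - t) / 2)" using e b by simp
    then obtain e' f where f: "e' < min (e / 3) ((b - t) / 2)" "f \<in> time_changes"
      "\<bar>f u - u\<bar> \<le> e'" "\<bar>x u - y (f u)\<bar> \<le> e'"
      using close u(3) unfolding skorohod_close_def by meson
    have "u - t = (b - t) / 2" "b - u = (b - t) / 2" by (simp_all add: u_def field_simps)
    then have "t < f u" "f u < b0" using f(1,3) b(3) by auto
    then have "\<bar>y (f u) - y t\<bar> < e / 3" "\<bar>x u - x t\<bar> < e / 3" "e' < e / 3"
      using b0(2)[of u] b0(2)[of "f u"] u b(3) f(1) by (auto simp: dist_real_def)
    then show ?thesis using f(4) by argo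
  qed
  then have "\<bar>x t - y t\<bar> \<le> 0" by (rule field_le_epsilon) simp
  then show "x t = y t" by simp
qed

interpretation Skorohod: Metric_space cadlag_space skorohod_dist
proof
  have bdd: "bdd_below {e. skorohod_close e x y}" for x y
    by (rule bdd_belowI[of _ 0]) (auto simp: skorohod_close_def)
  have less: "\<exists>e<r. skorohod_close e x y"
    if "x \<in> cadlag_space" "y \<in> cadlag_space" "skorohod_dist x y < r" for x y r
  proof -
    have "{e. skorohod_close e x y} \<noteq> {}" using skorohod_close_exists[OF that(1,2)] by simp
    moreover have "Inf {e. skorohod_close e x y} < r" using that by (simp add: skorohod_dist_def)
    ultimately have "\<exists>e\<in>{e. skorohod_close e x y}. e < r" by (rule cInf_lessD)
    then show ?thesis by blast
  qed
  have le: "skorohod_dist x y \<le> e"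
    if "x \<in> cadlag_space" "y \<in> cadlag_space" "skorohod_close e x y" for x y e
    using that cInf_lower[OF _ bdd, of e x y] by (simp add: skorohod_dist_def)
  show nonneg: "0 \<le> skorohod_dist x y" for x y
  proof (cases "x \<in> cadlag_space \<and> y \<in> cadlag_space")
    case True
    then have "{e. skorohod_close e x y} \<noteq> {}" using skorohod_close_exists[of x y] by simp
    then have "0 \<le> Inf {e. skorohod_close e x y}"
      by (rule cInf_greatest) (simp add: skorohod_close_def)
    then show ?thesis by (simp add: skorohod_dist_def)
  qed (auto simp: skorohod_dist_def)
  show "skorohod_dist x y = skorohod_dist y x" for x y
  proof -
    have "skorohod_close e x y \<longleftrightarrow> skorohod_close e y x" for e
      using skorohod_close_sym by blast
    then show ?thesis unfolding skorohod_dist_def by simp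
  qed
  show "skorohod_dist x y = 0 \<longleftrightarrow> x = y" if xy: "x \<in> cadlag_space" "y \<in> cadlag_space" for x y
  proof
    assume "skorohod_dist x y = 0"
    then show "x = y" using skorohod_close_all_imp_eq[OF xy] less[OF xy] by simp
  next
    assume "x = y"
    then have "skorohod_dist x y \<le> e" if "0 < e" for e
      using that by (intro le[OF xy]) (auto simp: skorohod_close_def intro!: bexI[OF _ time_changes_id])
    then have "skorohod_dist x y \<le> 0"
      using field_le_epsilon[of "skorohod_dist x y" 0] by simp
    then show "skorohod_dist x y = 0" using nonneg[of x y] by simp
  qed
  show "skorohod_dist x z \<le> skorohod_dist x y + skorohod_dist y z"
    if xyz: "x \<in> cadlag_space" "y \<in> cadlag_space" "z \<in> cadlag_space" for x y z
  proof (rule field_le_epsilon)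
    fix r :: real assume "0 < r"
    then obtain e e' where e: "e < skorohod_dist x y + r / 2" "skorohod_close e x y"
      and e': "e' < skorohod_dist y z + r / 2" "skorohod_close e' y z"
      using less[OF xyz(1,2), of "skorohod_dist x y + r / 2"]
        less[OF xyz(2,3), of "skorohod_dist y z + r / 2"] by auto
    have "skorohod_dist x z \<le> e + e'"
      by (rule le[OF xyz(1,3) skorohod_close_trans[OF e(2) e'(2)]])
    with e(1) e'(1) show "skorohod_dist x z \<le> skorohod_dist x y + skorohod_dist y z + r"
      by simp
  qed
qed

definition skorohod_topology :: "(real \<Rightarrow> real) topology" where
  "skorohod_topology = Skorohod.mtopology"


section \<open>Convergence in distribution and Gaussian processes\<close>

definition borel_sets_of :: "'a topology \<Rightarrow> 'a measure" where
  "borel_sets_of T = sigma (topspace T) {U. openin T U}"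

text \<open>
  The random elements \<^term>\<open>X n\<close> may live on different probability spaces
  \<^term>\<open>P n\<close>. As usual for limits, finitely many \<^term>\<open>n\<close> do not matter.
\<close>

definition converges_in_distribution ::
  "'a topology \<Rightarrow> (nat \<Rightarrow> 'w measure) \<Rightarrow> (nat \<Rightarrow> 'w \<Rightarrow> 'a) \<Rightarrow> 'v measure \<Rightarrow> ('v \<Rightarrow> 'a) \<Rightarrow> bool"
where
  "converges_in_distribution T P X Q Z \<longleftrightarrow>
     (\<forall>\<^sub>F n in sequentially. prob_space (P n) \<and> X n \<in> measurable (P n) (borel_sets_of T)) \<and>
     prob_space Q \<and> Z \<in> measurable Q (borel_sets_of T) \<and>
     (\<forall>h. continuous_map T euclideanreal h \<longrightarrow> bounded (h ` topspace T) \<longrightarrow>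
        (\<lambda>n. \<integral>\<omega>. h (X n \<omega>) \<partial>P n) \<longlonglongrightarrow> (\<integral>\<omega>. h (Z \<omega>) \<partial>Q))"

definition covariance :: "'w measure \<Rightarrow> ('w \<Rightarrow> real) \<Rightarrow> ('w \<Rightarrow> real) \<Rightarrow> real" where
  "covariance M X Y =
     (\<integral>\<omega>. (X \<omega> - (\<integral>\<omega>. X \<omega> \<partial>M)) * (Y \<omega> - (\<integral>\<omega>. Y \<omega> \<partial>M)) \<partial>M)"

text \<open>Almost surely constant variables count as (degenerate) Gaussian.\<close>

definition gaussian_variable :: "'w measure \<Rightarrow> ('w \<Rightarrow> real) \<Rightarrow> bool" where
  "gaussian_variable M X \<longleftrightarrow> X \<in> borel_measurable M \<and>
     ((\<exists>\<mu> \<tau>. 0 < \<tau> \<and> distributed M lborel X (\<lambda>x. ennreal (normal_density \<mu> \<tau> x))) \<or>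
      (\<exists>\<mu>. AE \<omega> in M. X \<omega> = \<mu>))"

definition gaussian_process :: "'w measure \<Rightarrow> 't set \<Rightarrow> ('t \<Rightarrow> 'w \<Rightarrow> real) \<Rightarrow> bool" where
  "gaussian_process M T Z \<longleftrightarrow> prob_space M \<and>
     (\<forall>F c. finite F \<longrightarrow> F \<subseteq> T \<longrightarrow> gaussian_variable M (\<lambda>\<omega>. \<Sum>t\<in>F. c t * Z t \<omega>))"


section \<open>Combinatorial partial sums\<close>

definition uniform_random_permutation :: "'w measure \<Rightarrow> nat \<Rightarrow> ('w \<Rightarrow> nat \<Rightarrow> nat) \<Rightarrow> bool" where
  "uniform_random_permutation P n \<pi> \<longleftrightarrow>
     prob_space P \<and>
     \<pi> \<in> measurable P (count_space {p. p permutes {1..n}}) \<and>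
     distr P (count_space {p. p permutes {1..n}}) \<pi>
       = uniform_count_measure {p. p permutes {1..n}}"

text \<open>
  In the following definitions \<^term>\<open>a\<close> is an \<^term>\<open>n\<close> by \<^term>\<open>n\<close>
  matrix; only its entries with indices between 1 and \<^term>\<open>n\<close> are used.
\<close>

definition comb_process ::
  "nat \<Rightarrow> (nat \<Rightarrow> nat \<Rightarrow> real) \<Rightarrow> real \<Rightarrow> (nat \<Rightarrow> nat) \<Rightarrow> real \<Rightarrow> real"
where
  "comb_process n a s p t = 1 / s * (\<Sum>i = 1..nat \<lfloor>real n * t\<rfloor>. a i (p i))"

definition lyapunov_ratio :: "nat \<Rightarrow> (nat \<Rightarrow> nat \<Rightarrow> real) \<Rightarrow> real \<Rightarrow> real" where
  "lyapunov_ratio n a s =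
     1 / (real n * s ^ 3) * (\<Sum>i = 1..n. \<Sum>j = 1..n. \<bar>a i j\<bar> ^ 3)"

definition f_fun :: "nat \<Rightarrow> (nat \<Rightarrow> nat \<Rightarrow> real) \<Rightarrow> real \<Rightarrow> real \<Rightarrow> real" where
  "f_fun n a s t =
     1 / (real n * s\<^sup>2) * (\<Sum>i = 1..nat \<lfloor>real n * t\<rfloor>. \<Sum>l = 1..n. (a i l)\<^sup>2)"

definition g_fun :: "nat \<Rightarrow> (nat \<Rightarrow> nat \<Rightarrow> real) \<Rightarrow> real \<Rightarrow> real \<Rightarrow> real \<Rightarrow> real" where
  "g_fun n a s t u =
     1 / (real n * s)\<^sup>2 *
     (\<Sum>i = 1..nat \<lfloor>real n * t\<rfloor>. \<Sum>j = 1..nat \<lfloor>real n * u\<rfloor>. \<Sum>l = 1..n. a i l * a j l)"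

end

theory Submission
  imports Defs
begin

text \<open>
  Finite-dimensional limits: replacing the value of a permutation at \<open>i\<close> by an independent uniform
  value through a transposition preserves the uniform law. For a doubly centred matrix this turns
  \<open>E (W exp (i t W))\<close> into \<open>i t v E (exp (i t W))\<close> up to third absolute moments, a differential
  equation for the characteristic function of \<open>W\<close>.

  Tightness: for disjoint blocks \<open>A\<close>, \<open>B\<close> of rows the same resampling bounds \<open>E (X\<^sub>A\<^sup>2 X\<^sub>B\<^sup>2)\<close> by a constant
  times the product of the block energies, so Billingsley's maximal inequality controls the oscillation
  over a grid cell by \<open>(f(t') - f(t))\<^sup>2\<close> plus the fourth moment of the limiting increment. Summed over the
  cells this vanishes with the mesh because \<open>f\<close> is continuous.

  The limit is built on the rationals from white noise by a Cholesky factorisation of the covariance. It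
  inherits the oscillation bounds, hence is uniformly continuous almost surely and extends to the unit
  interval. Convergence for Skorohod-Lipschitz functions follows by comparison with step functions on a
  grid, and for bounded continuous functions by approximation from below by Lipschitz envelopes.
\<close>

section \<open>Uniform permutations and resampling\<close>

text \<open>The Lyapunov condition controls third absolute moments only. The fourth moment of a
  partial sum contains the mean of \<open>a i (p i) ^ 4\<close> over the rows, which these do not
  bound. Two devices avoid it. Product moments are taken over disjoint blocks of rows, where no
  fourth power of a single entry occurs and block energies suffice. Increments over whole grid cells
  enter only through \<open>min 1 (x ^ 4)\<close>; this is bounded and continuous, so its mean
  passes to the Gaussian limit, where the fourth moment is three times the squared variance.

  The subtracted term \<open>g\<close> comes from the columns, which need not be centred:
  subtracting column means leaves every sum along a permutation unchanged but lowers the variance by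
  the mean square of the column means.

  Closeness in the Skorohod metric is always obtained from uniform closeness, with the identity as
  time change; the continuity of the limit paths makes this possible. Lower bounds for all bounded
  continuous functionals give the limit because they apply to both \<open>h\<close> and
  \<open>- h\<close>.\<close>

definition perm_mean :: "'a set \<Rightarrow> (('a \<Rightarrow> 'a) \<Rightarrow> 'b::real_vector) \<Rightarrow> 'b" where
  "perm_mean S F = (\<Sum>p | p permutes S. F p) /\<^sub>R fact (card S)"

lemma perm_mean_cong:
  "(\<And>p. p permutes S \<Longrightarrow> F p = G p) \<Longrightarrow> perm_mean S F = perm_mean S G"
  unfolding perm_mean_def by (intro arg_cong2[where f=scaleR] sum.cong) auto

lemma perm_mean_const:
  assumes "finite S"
  shows "perm_mean S (\<lambda>p. c) = c"
  by (simp add: perm_mean_def card_permutations[OF refl assms] scaleR_conv_of_real sum_constant_scaleR)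

lemma perm_mean_add: "perm_mean S (\<lambda>p. F p + G p) = perm_mean S F + perm_mean S G"
  by (simp add: perm_mean_def sum.distrib scaleR_add_right)

lemma perm_mean_diff: "perm_mean S (\<lambda>p. F p - G p) = perm_mean S F - perm_mean S G"
  by (simp add: perm_mean_def sum_subtractf scaleR_diff_right)

lemma perm_mean_sum: "perm_mean S (\<lambda>p. \<Sum>i\<in>I. F i p) = (\<Sum>i\<in>I. perm_mean S (F i))"
  unfolding perm_mean_def by (subst sum.swap) (simp add: scaleR_sum_right)

lemma perm_mean_scaleR: "perm_mean S (\<lambda>p. c *\<^sub>R F p) = c *\<^sub>R perm_mean S F"
  by (simp add: perm_mean_def scaleR_sum_right mult.commute)

lemma perm_mean_mult: "perm_mean S (\<lambda>p. c * F p :: 'b::real_algebra) = c * perm_mean S F"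
  by (simp add: perm_mean_def sum_distrib_left)

lemma perm_mean_minus: "perm_mean S (\<lambda>p. - F p) = - perm_mean S F"
  by (simp add: perm_mean_def sum_negf)

lemma perm_mean_mono:
  fixes F G :: "('a \<Rightarrow> 'a) \<Rightarrow> real"
  shows "(\<And>p. p permutes S \<Longrightarrow> F p \<le> G p) \<Longrightarrow> perm_mean S F \<le> perm_mean S G"
  unfolding perm_mean_def by (auto intro!: mult_left_mono sum_mono)

lemma norm_perm_mean_le:
  fixes F :: "('a \<Rightarrow> 'a) \<Rightarrow> 'b::real_normed_vector"
  shows "norm (perm_mean S F) \<le> perm_mean S (\<lambda>p. norm (F p))"
  unfolding perm_mean_def by (auto intro!: mult_left_mono norm_sum)

lemma norm_perm_mean_le':
  fixes F :: "('a \<Rightarrow> 'a) \<Rightarrow> 'b::real_normed_vector"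
  assumes "\<And>p. p permutes S \<Longrightarrow> norm (F p) \<le> G p"
  shows "norm (perm_mean S F) \<le> perm_mean S G"
  using norm_perm_mean_le[of S F] perm_mean_mono[of S "\<lambda>p. norm (F p)" G] assms by force

lemma abs_perm_mean_le:
  fixes F :: "('a \<Rightarrow> 'a) \<Rightarrow> real"
  assumes "\<And>p. p permutes S \<Longrightarrow> \<bar>F p\<bar> \<le> G p"
  shows "\<bar>perm_mean S F\<bar> \<le> perm_mean S G"
  using norm_perm_mean_le'[of S F G] assms by simp

section \<open>Resampling one value of a permutation by a transposition\<close>

definition resample :: "('a \<Rightarrow> 'a) \<Rightarrow> 'a \<Rightarrow> 'a \<Rightarrow> 'a \<Rightarrow> 'a" where
  "resample p i l = Transposition.transpose (p i) l \<circ> p"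

lemma resample_at [simp]: "resample p i l i = l"
  by (simp add: resample_def)

lemma resample_hit: "p j = l \<Longrightarrow> resample p i l j = p i"
  by (simp add: resample_def)

lemma resample_other: "p j \<noteq> p i \<Longrightarrow> p j \<noteq> l \<Longrightarrow> resample p i l j = p j"
  by (simp add: resample_def transpose_def)

lemma resample_back: "resample (resample p i l) i (p i) = p"
  by (simp add: resample_def fun_eq_iff transpose_commute)

lemma resample_permutes:
  assumes "p permutes S" "i \<in> S" "l \<in> S"
  shows "resample p i l permutes S"
  unfolding resample_def using assms
  by (intro permutes_compose permutes_swap_id) (auto simp: permutes_in_image)

text \<open>Resampling while remembering the overwritten value \<open>p i\<close> is an involution
  on the pairs \<open>(p, l)\<close> with \<open>l\<close> outside the image of \<open>H\<close>. So
  every permutation is hit equally often, once for each value that \<open>H\<close> leaves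
  free.\<close>

lemma sum_resample:
  fixes G :: "('a \<Rightarrow> 'a) \<Rightarrow> 'b::real_vector"
  assumes S: "finite S" and i: "i \<in> S" and H: "H \<subseteq> S" "i \<notin> H"
  shows "(\<Sum>p | p permutes S. \<Sum>l \<in> S - p ` H. G (resample p i l))
       = real (card S - card H) *\<^sub>R (\<Sum>p | p permutes S. G p)"
proof -
  let ?P = "{p. p permutes S}"
  have fin: "finite ?P" using S by (rule finite_permutations)
  \<comment> \<open>Neither \<open>p i\<close> nor \<open>l\<close> is a value taken on
    \<open>H\<close>, so the transposition moves no value on \<open>H\<close>, and the set of
    admissible \<open>l\<close> is the same before and after resampling.\<close>
  have same: "resample p i l ` H = p ` H" if "p permutes S" "l \<in> S - p ` H" for p l
  proof (rule image_cong[OF refl])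
    fix h assume h: "h \<in> H"
    have "p h \<noteq> p i" using permutes_inj[OF that(1)] h H(2) by (auto dest: injD)
    then show "resample p i l h = p h" using h that(2) by (intro resample_other) auto
  qed
  have ph: "p i \<notin> p ` H" if "p permutes S" for p
    using permutes_inj[OF that] H(2) by (auto dest: injD)
  have ph': "p i \<notin> resample p i l ` H" if "p permutes S" "l \<in> S - p ` H" for p l
    using same[OF that] ph[OF that(1)] by simp
  have "(\<Sum>p\<in>?P. \<Sum>l \<in> S - p ` H. G (resample p i l))
      = (\<Sum>(p,l)\<in>Sigma ?P (\<lambda>p. S - p ` H). G (resample p i l))"
    using fin S by (intro sum.Sigma) auto
  also have "\<dots> = (\<Sum>(p,l)\<in>Sigma ?P (\<lambda>p. S - p ` H). G p)"
    by (rule sum.reindex_bij_witness[where i = "\<lambda>(p,l). (resample p i l, p i)"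
          and j = "\<lambda>(p,l). (resample p i l, p i)"])
       (use ph' in \<open>auto simp: resample_back resample_permutes i permutes_in_image\<close>)
  also have "\<dots> = (\<Sum>p\<in>?P. \<Sum>l \<in> S - p ` H. G p)"
    using fin S by (intro sum.Sigma[symmetric]) auto
  also have "\<dots> = (\<Sum>p\<in>?P. real (card S - card H) *\<^sub>R G p)"
  proof (rule sum.cong[OF refl])
    fix p assume p: "p \<in> ?P"
    have "card (S - p ` H) = card S - card (p ` H)"
      using H(1) p S by (intro card_Diff_subset) (auto simp: permutes_in_image finite_subset)
    also have "card (p ` H) = card H"
      using p by (intro card_image) (auto intro: permutes_inj_on)
    finally show "(\<Sum>l \<in> S - p ` H. G p) = real (card S - card H) *\<^sub>R G p"
      by (simp add: sum_constant_scaleR)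
  qed
  finally show ?thesis by (simp add: scaleR_sum_right)
qed

lemma perm_mean_resample_avoiding:
  fixes G :: "('a \<Rightarrow> 'a) \<Rightarrow> 'b::real_vector"
  assumes "finite S" "i \<in> S" "H \<subseteq> S" "i \<notin> H"
  shows "perm_mean S (\<lambda>p. \<Sum>l \<in> S - p ` H. G (resample p i l))
       = real (card S - card H) *\<^sub>R perm_mean S G"
  unfolding perm_mean_def sum_resample[OF assms] by (simp add: mult.commute)

lemma perm_mean_resample:
  fixes G :: "('a \<Rightarrow> 'a) \<Rightarrow> 'b::real_vector"
  assumes "finite S" "i \<in> S"
  shows "perm_mean S (\<lambda>p. \<Sum>l \<in> S. G (resample p i l)) = real (card S) *\<^sub>R perm_mean S G"
  using perm_mean_resample_avoiding[OF assms, of "{}" G] by simp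

lemma perm_mean_at:
  fixes y :: "'a \<Rightarrow> real"
  assumes "finite S" "i \<in> S"
  shows "real (card S) * perm_mean S (\<lambda>p. y (p i)) = (\<Sum>l\<in>S. y l)"
  using perm_mean_resample[OF assms, of "\<lambda>p. y (p i)"] by (simp add: perm_mean_const assms)

lemma sum_minus_image:
  fixes x :: "'a \<Rightarrow> real"
  assumes S: "finite S" and H: "H \<subseteq> S" and p: "p permutes S"
  shows "(\<Sum>l\<in>S - p ` H. x l) = (\<Sum>l\<in>S. x l) - (\<Sum>h\<in>H. x (p h))"
proof -
  have "(\<Sum>l\<in>S - p ` H. x l) = (\<Sum>l\<in>S. x l) - (\<Sum>l\<in>p ` H. x l)"
    using S H p by (intro sum_diff) (auto simp: permutes_in_image)
  also have "(\<Sum>l\<in>p ` H. x l) = (\<Sum>h\<in>H. x (p h))"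
    using permutes_inj_on[OF p] by (simp add: sum.reindex)
  finally show ?thesis .
qed

text \<open>Conditionally on the values on \<^term>\<open>H\<close>, the value at \<^term>\<open>i\<close> is uniform on the rest.\<close>

lemma perm_mean_conditional:
  fixes x :: "'a \<Rightarrow> real"
  assumes S: "finite S" and i: "i \<in> S" and H: "H \<subseteq> S" "i \<notin> H"
    and K: "\<And>p q. (\<And>h. h \<in> H \<Longrightarrow> p h = q h) \<Longrightarrow> K p = K q"
  shows "real (card S - card H) * perm_mean S (\<lambda>p. x (p i) * K p)
       = perm_mean S (\<lambda>p. ((\<Sum>l\<in>S. x l) - (\<Sum>h\<in>H. x (p h))) * K p)"
proof -
  have "real (card S - card H) * perm_mean S (\<lambda>p. x (p i) * K p)
      = perm_mean S (\<lambda>p. \<Sum>l \<in> S - p ` H. x l * K (resample p i l))"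
    using perm_mean_resample_avoiding[OF S i H, of "\<lambda>p. x (p i) * K p"] by simp
  also have "\<dots> = perm_mean S (\<lambda>p. ((\<Sum>l\<in>S. x l) - (\<Sum>h\<in>H. x (p h))) * K p)"
  proof (rule perm_mean_cong)
    fix p assume p: "p permutes S"
    have "K (resample p i l) = K p" if "l \<in> S - p ` H" for l
    proof (rule K)
      fix h assume h: "h \<in> H"
      then have "p h \<noteq> p i" using permutes_inj[OF p] H(2) by (auto dest: injD)
      then show "resample p i l h = p h" using h that by (intro resample_other) auto
    qed
    then have "(\<Sum>l \<in> S - p ` H. x l * K (resample p i l)) = (\<Sum>l \<in> S - p ` H. x l) * K p"
      by (simp add: sum_distrib_right)
    also have "(\<Sum>l \<in> S - p ` H. x l) = (\<Sum>l\<in>S. x l) - (\<Sum>h\<in>H. x (p h))"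
      by (rule sum_minus_image[OF S H(1) p])
    finally show "(\<Sum>l \<in> S - p ` H. x l * K (resample p i l)) = ((\<Sum>l\<in>S. x l) - (\<Sum>h\<in>H. x (p h))) * K p" .
  qed
  finally show ?thesis .
qed

section \<open>Mixed moments of centred functions at distinct positions\<close>

lemma perm_mean_two_zero_sum:
  fixes x y :: "'a \<Rightarrow> real"
  assumes S: "finite S" "i \<in> S" "j \<in> S" "i \<noteq> j" and x: "sum x S = 0"
  shows "real (card S) * real (card S - 1) * perm_mean S (\<lambda>p. x (p i) * y (p j)) = - (\<Sum>l\<in>S. x l * y l)"
proof -
  have "real (card S - 1) * perm_mean S (\<lambda>p. x (p i) * y (p j)) = - perm_mean S (\<lambda>p. x (p j) * y (p j))"
    using perm_mean_conditional[of S i "{j}" "\<lambda>p. y (p j)" x] S x by (simp add: perm_mean_minus)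
  then show ?thesis
    using perm_mean_at[of S j "\<lambda>l. x l * y l"] S by (simp add: mult.assoc)
qed

lemma perm_mean_two_abs:
  fixes x y :: "'a \<Rightarrow> real"
  assumes S: "finite S" "i \<in> S" "j \<in> S" "i \<noteq> j"
  shows "real (card S) * real (card S - 1) * \<bar>perm_mean S (\<lambda>p. x (p i) * y (p j))\<bar>
    \<le> (\<Sum>l\<in>S. \<bar>x l\<bar>) * (\<Sum>l\<in>S. \<bar>y l\<bar>)"
proof -
  have "real (card S - 1) * perm_mean S (\<lambda>p. \<bar>x (p i)\<bar> * \<bar>y (p j)\<bar>)
      = perm_mean S (\<lambda>p. ((\<Sum>l\<in>S. \<bar>x l\<bar>) - \<bar>x (p j)\<bar>) * \<bar>y (p j)\<bar>)"
    using perm_mean_conditional[of S i "{j}" "\<lambda>p. \<bar>y (p j)\<bar>" "\<lambda>l. \<bar>x l\<bar>"] S by simp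
  also have "\<dots> \<le> perm_mean S (\<lambda>p. (\<Sum>l\<in>S. \<bar>x l\<bar>) * \<bar>y (p j)\<bar>)"
    by (intro perm_mean_mono mult_right_mono) auto
  also have "\<dots> = (\<Sum>l\<in>S. \<bar>x l\<bar>) * perm_mean S (\<lambda>p. \<bar>y (p j)\<bar>)"
    by (rule perm_mean_mult)
  finally have *: "real (card S - 1) * perm_mean S (\<lambda>p. \<bar>x (p i)\<bar> * \<bar>y (p j)\<bar>) \<le> \<dots>" .
  have "\<bar>perm_mean S (\<lambda>p. x (p i) * y (p j))\<bar> \<le> perm_mean S (\<lambda>p. \<bar>x (p i)\<bar> * \<bar>y (p j)\<bar>)"
    by (rule abs_perm_mean_le) (simp add: abs_mult)
  then have "real (card S) * real (card S - 1) * \<bar>perm_mean S (\<lambda>p. x (p i) * y (p j))\<bar>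
      \<le> real (card S) * (real (card S - 1) * perm_mean S (\<lambda>p. \<bar>x (p i)\<bar> * \<bar>y (p j)\<bar>))"
    by (simp add: mult.assoc mult_left_mono)
  also have "\<dots> \<le> real (card S) * ((\<Sum>l\<in>S. \<bar>x l\<bar>) * perm_mean S (\<lambda>p. \<bar>y (p j)\<bar>))"
    using * by (rule mult_left_mono) simp
  also have "\<dots> = (\<Sum>l\<in>S. \<bar>x l\<bar>) * (\<Sum>l\<in>S. \<bar>y l\<bar>)"
    using perm_mean_at[of S j "\<lambda>l. \<bar>y l\<bar>"] S by (simp add: mult.left_commute)
  finally show ?thesis .
qed

text \<open>Eliminating the centred factor \<open>x (p i)\<close> moves \<open>x\<close> onto
  \<open>p j\<close> or onto \<open>p k\<close>. In the first case absolute values are taken at the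
  two remaining positions. In the second \<open>y\<close> still stands alone and is centred, so a
  further elimination leaves a single sum.\<close>

lemma perm_mean_three_abs:
  fixes x y z :: "'a \<Rightarrow> real"
  assumes S: "finite S" "i \<in> S" "j \<in> S" "k \<in> S" "distinct [i, j, k]"
    and x: "sum x S = 0" and y: "sum y S = 0"
  shows "real (card S) * real (card S - 1) * real (card S - 2) *
      \<bar>perm_mean S (\<lambda>p. x (p i) * y (p j) * z (p k))\<bar>
    \<le> (\<Sum>l\<in>S. \<bar>x l * y l\<bar>) * (\<Sum>l\<in>S. \<bar>z l\<bar>) + (\<Sum>l\<in>S. \<bar>x l * y l * z l\<bar>)"
proof -
  let ?c = "real (card S) * real (card S - 1)"
  have c2: "card S - card {j, k} = card S - 2" using S by simp
  have "real (card S - 2) * perm_mean S (\<lambda>p. x (p i) * (y (p j) * z (p k)))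
      = perm_mean S (\<lambda>p. (sum x S - (\<Sum>h\<in>{j,k}. x (p h))) * (y (p j) * z (p k)))"
    unfolding c2[symmetric] by (rule perm_mean_conditional) (use S in auto)
  also have "\<dots> = - perm_mean S (\<lambda>p. (x (p j) * y (p j)) * z (p k)) - perm_mean S (\<lambda>p. y (p j) * (x (p k) * z (p k)))"
    unfolding perm_mean_minus[symmetric] perm_mean_diff[symmetric]
    by (rule perm_mean_cong) (use S x in \<open>simp add: algebra_simps\<close>)
  finally have 1: "?c * real (card S - 2) * perm_mean S (\<lambda>p. x (p i) * (y (p j) * z (p k)))
     = - (?c * perm_mean S (\<lambda>p. (x (p j) * y (p j)) * z (p k)))
       - ?c * perm_mean S (\<lambda>p. y (p j) * (x (p k) * z (p k)))"
    by (simp only: mult.assoc) (simp add: algebra_simps)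
  have 2: "?c * \<bar>perm_mean S (\<lambda>p. (x (p j) * y (p j)) * z (p k))\<bar> \<le> (\<Sum>l\<in>S. \<bar>x l * y l\<bar>) * (\<Sum>l\<in>S. \<bar>z l\<bar>)"
    using perm_mean_two_abs[of S j k "\<lambda>l. x l * y l" z] S by simp
  have 3: "?c * perm_mean S (\<lambda>p. y (p j) * (x (p k) * z (p k))) = - (\<Sum>l\<in>S. y l * (x l * z l))"
    using perm_mean_two_zero_sum[of S j k y "\<lambda>l. x l * z l"] S y by simp
  have 4: "\<bar>\<Sum>l\<in>S. y l * (x l * z l)\<bar> \<le> (\<Sum>l\<in>S. \<bar>x l * y l * z l\<bar>)"
    by (rule order_trans[OF sum_abs]) (simp add: abs_mult mult_ac)
  have "?c * real (card S - 2) * \<bar>perm_mean S (\<lambda>p. x (p i) * y (p j) * z (p k))\<bar>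
      = \<bar>?c * real (card S - 2) * perm_mean S (\<lambda>p. x (p i) * (y (p j) * z (p k)))\<bar>"
    by (simp add: abs_mult mult.assoc)
  also have "\<dots> \<le> ?c * \<bar>perm_mean S (\<lambda>p. (x (p j) * y (p j)) * z (p k))\<bar>
      + \<bar>\<Sum>l\<in>S. y l * (x l * z l)\<bar>"
  proof -
    have "\<bar>?c * perm_mean S (\<lambda>p. (x (p j) * y (p j)) * z (p k))\<bar> = ?c * \<bar>perm_mean S (\<lambda>p. (x (p j) * y (p j)) * z (p k))\<bar>"
      by (simp add: abs_mult)
    then show ?thesis unfolding 1 3 by linarith
  qed
  finally show ?thesis using 2 4 by linarith
qed

text \<open>Eliminating \<open>x (p i)\<close> merges \<open>x\<close> with one of the other three
  factors and leaves two centred factors alone, which is what the three-point bound asks for. The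
  three mergings produce the three pairings known from Wick's formula.\<close>

lemma perm_mean_four_abs:
  fixes x y z w :: "'a \<Rightarrow> real"
  assumes S: "finite S" "i \<in> S" "j \<in> S" "k \<in> S" "m \<in> S" "distinct [i, j, k, m]"
    and x: "sum x S = 0" and y: "sum y S = 0" and z: "sum z S = 0" and w: "sum w S = 0"
  shows "real (card S) * real (card S - 1) * real (card S - 2) * real (card S - 3) *
      \<bar>perm_mean S (\<lambda>p. x (p i) * y (p j) * z (p k) * w (p m))\<bar>
    \<le> (\<Sum>l\<in>S. \<bar>x l * y l\<bar>) * (\<Sum>l\<in>S. \<bar>z l * w l\<bar>) + (\<Sum>l\<in>S. \<bar>x l * z l\<bar>) * (\<Sum>l\<in>S. \<bar>y l * w l\<bar>)
      + (\<Sum>l\<in>S. \<bar>x l * w l\<bar>) * (\<Sum>l\<in>S. \<bar>y l * z l\<bar>) + 3 * (\<Sum>l\<in>S. \<bar>x l * y l * z l * w l\<bar>)"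
proof -
  let ?c = "real (card S) * real (card S - 1) * real (card S - 2)"
  have c2: "card S - card {j, k, m} = card S - 3" using S by simp
  let ?E1 = "perm_mean S (\<lambda>p. z (p k) * w (p m) * (x (p j) * y (p j)))"
  let ?E2 = "perm_mean S (\<lambda>p. y (p j) * w (p m) * (x (p k) * z (p k)))"
  let ?E3 = "perm_mean S (\<lambda>p. y (p j) * z (p k) * (x (p m) * w (p m)))"
  have "real (card S - 3) * perm_mean S (\<lambda>p. x (p i) * (y (p j) * z (p k) * w (p m)))
      = perm_mean S (\<lambda>p. (sum x S - (\<Sum>h\<in>{j,k,m}. x (p h))) * (y (p j) * z (p k) * w (p m)))"
    unfolding c2[symmetric] by (rule perm_mean_conditional) (use S in auto)
  also have "\<dots> = - ?E1 - ?E2 - ?E3"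
    unfolding perm_mean_minus[symmetric] perm_mean_diff[symmetric]
    by (rule perm_mean_cong) (use S x in \<open>simp add: algebra_simps\<close>)
  finally have 1: "?c * real (card S - 3) * perm_mean S (\<lambda>p. x (p i) * (y (p j) * z (p k) * w (p m)))
     = - (?c * ?E1) - ?c * ?E2 - ?c * ?E3"
    by (simp only: mult.assoc) (simp add: algebra_simps)
  have E1: "?c * \<bar>?E1\<bar> \<le> (\<Sum>l\<in>S. \<bar>z l * w l\<bar>) * (\<Sum>l\<in>S. \<bar>x l * y l\<bar>) + (\<Sum>l\<in>S. \<bar>z l * w l * (x l * y l)\<bar>)"
    using perm_mean_three_abs[of S k m j z w "\<lambda>l. x l * y l"] S z w by auto
  have E2: "?c * \<bar>?E2\<bar> \<le> (\<Sum>l\<in>S. \<bar>y l * w l\<bar>) * (\<Sum>l\<in>S. \<bar>x l * z l\<bar>) + (\<Sum>l\<in>S. \<bar>y l * w l * (x l * z l)\<bar>)"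
    using perm_mean_three_abs[of S j m k y w "\<lambda>l. x l * z l"] S y w by auto
  have E3: "?c * \<bar>?E3\<bar> \<le> (\<Sum>l\<in>S. \<bar>y l * z l\<bar>) * (\<Sum>l\<in>S. \<bar>x l * w l\<bar>) + (\<Sum>l\<in>S. \<bar>y l * z l * (x l * w l)\<bar>)"
    using perm_mean_three_abs[of S j k m y z "\<lambda>l. x l * w l"] S y z by auto
  have "?c * real (card S - 3) * \<bar>perm_mean S (\<lambda>p. x (p i) * y (p j) * z (p k) * w (p m))\<bar>
      = \<bar>?c * real (card S - 3) * perm_mean S (\<lambda>p. x (p i) * (y (p j) * z (p k) * w (p m)))\<bar>"
    by (simp add: abs_mult mult.assoc)
  also have "\<dots> \<le> ?c * \<bar>?E1\<bar> + ?c * \<bar>?E2\<bar> + ?c * \<bar>?E3\<bar>"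
  proof -
    have "\<bar>X\<bar> \<le> c * \<bar>a\<bar> + c * \<bar>b\<bar> + c * \<bar>d\<bar>"
      if "X = - (c * a) - c * b - c * d" "0 \<le> c" for X a b c d :: real
      using abs_mult[of c a] abs_mult[of c b] abs_mult[of c d] that by linarith
    from this[OF 1] show ?thesis by simp
  qed
  finally show ?thesis using E1 E2 E3 by (simp add: abs_mult mult_ac)
qed

section \<open>Second and fourth moments of sums over blocks of rows\<close>

lemma sum_square_le_card:
  fixes x :: "'a \<Rightarrow> real"
  assumes "A \<subseteq> S" "finite S"
  shows "(\<Sum>i\<in>A. x i)\<^sup>2 \<le> real (card S) * (\<Sum>i\<in>A. (x i)\<^sup>2)"
proof -
  have "(\<Sum>i\<in>A. x i)\<^sup>2 \<le> real (card A) * (\<Sum>i\<in>A. (x i)\<^sup>2)"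
    using Cauchy_Schwarz_ineq_sum[of "\<lambda>_. 1" x A] by simp
  also have "\<dots> \<le> real (card S) * (\<Sum>i\<in>A. (x i)\<^sup>2)"
    using assms by (intro mult_right_mono of_nat_mono card_mono sum_nonneg) auto
  finally show ?thesis .
qed

lemma sum_square_mult_sum:
  fixes x z :: "'a \<Rightarrow> real"
  shows "(\<Sum>i\<in>A. x i)\<^sup>2 * (\<Sum>j\<in>B. z j) = (\<Sum>i\<in>A. \<Sum>i'\<in>A. \<Sum>j\<in>B. x i * x i' * z j)"
proof -
  have x: "(\<Sum>i\<in>A. x i)\<^sup>2 = (\<Sum>i\<in>A. \<Sum>i'\<in>A. x i * x i')"
    by (simp add: power2_eq_square sum_product)
  have "(\<Sum>i\<in>A. x i)\<^sup>2 * W = (\<Sum>i\<in>A. \<Sum>i'\<in>A. x i * x i' * W)" for W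
    unfolding x by (simp only: sum_distrib_right)
  from this[of "\<Sum>j\<in>B. z j"] show ?thesis by (simp only: sum_distrib_left)
qed

lemma sum_square_mult_sum_square:
  fixes x y :: "'a \<Rightarrow> real"
  shows "(\<Sum>i\<in>A. x i)\<^sup>2 * (\<Sum>j\<in>B. y j)\<^sup>2
    = (\<Sum>i\<in>A. \<Sum>i'\<in>A. \<Sum>j\<in>B. \<Sum>j'\<in>B. x i * x i' * y j * y j')"
proof -
  have y: "(\<Sum>j\<in>B. y j)\<^sup>2 = (\<Sum>j\<in>B. \<Sum>j'\<in>B. y j * y j')"
    by (simp add: power2_eq_square sum_product)
  show ?thesis unfolding y sum_square_mult_sum
    by (intro sum.cong refl) (simp add: sum_distrib_left mult.assoc)
qed

locale zero_row_sums =
  fixes S :: "'a set" and a :: "'a \<Rightarrow> 'a \<Rightarrow> real"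
  assumes fin: "finite S"
    and rows: "\<And>i. i \<in> S \<Longrightarrow> (\<Sum>l\<in>S. a i l) = 0"
begin

definition energy :: "'a set \<Rightarrow> real" where
  "energy A = (\<Sum>i\<in>A. \<Sum>l\<in>S. (a i l)\<^sup>2)"

definition corr :: "'a \<Rightarrow> 'a \<Rightarrow> real" where
  "corr i j = (\<Sum>l\<in>S. \<bar>a i l * a j l\<bar>)"

definition corr4 :: "'a \<Rightarrow> 'a \<Rightarrow> 'a \<Rightarrow> 'a \<Rightarrow> real" where
  "corr4 i i' j j' = (\<Sum>l\<in>S. \<bar>a i l * a i' l * a j l * a j' l\<bar>)"

lemma energy_nonneg: "0 \<le> energy A"
  by (auto simp: energy_def intro!: sum_nonneg)

lemma corr_nonneg: "0 \<le> corr i j"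
  by (auto simp: corr_def intro!: sum_nonneg)

lemma corr4_nonneg: "0 \<le> corr4 i i' j j'"
  by (auto simp: corr4_def intro!: sum_nonneg)

lemma energy_swap: "energy A = (\<Sum>l\<in>S. \<Sum>i\<in>A. (a i l)\<^sup>2)"
  unfolding energy_def by (rule sum.swap)

lemma corr_self: "corr i i = (\<Sum>l\<in>S. (a i l)\<^sup>2)"
  by (simp add: corr_def power2_eq_square abs_mult)

lemma sum_corr: "(\<Sum>i\<in>A. \<Sum>j\<in>B. corr i j) = (\<Sum>l\<in>S. (\<Sum>i\<in>A. \<bar>a i l\<bar>) * (\<Sum>j\<in>B. \<bar>a j l\<bar>))"
proof -
  have "(\<Sum>i\<in>A. \<Sum>j\<in>B. corr i j) = (\<Sum>i\<in>A. \<Sum>l\<in>S. \<Sum>j\<in>B. \<bar>a i l\<bar> * \<bar>a j l\<bar>)"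
    unfolding corr_def abs_mult by (intro sum.cong refl sum.swap)
  also have "\<dots> = (\<Sum>l\<in>S. \<Sum>i\<in>A. \<Sum>j\<in>B. \<bar>a i l\<bar> * \<bar>a j l\<bar>)" by (rule sum.swap)
  finally show ?thesis by (simp add: sum_product)
qed

lemma col_square_le:
  assumes "A \<subseteq> S"
  shows "(\<Sum>i\<in>A. \<bar>a i l\<bar>)\<^sup>2 \<le> real (card S) * (\<Sum>i\<in>A. (a i l)\<^sup>2)"
  using sum_square_le_card[OF assms fin, of "\<lambda>i. \<bar>a i l\<bar>"] by simp

lemma sum_col_square_le:
  assumes "A \<subseteq> S"
  shows "(\<Sum>l\<in>S. (\<Sum>i\<in>A. \<bar>a i l\<bar>)\<^sup>2) \<le> real (card S) * energy A"
proof -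
  have "(\<Sum>l\<in>S. (\<Sum>i\<in>A. \<bar>a i l\<bar>)\<^sup>2) \<le> (\<Sum>l\<in>S. real (card S) * (\<Sum>i\<in>A. (a i l)\<^sup>2))"
    by (intro sum_mono col_square_le assms)
  then show ?thesis by (simp add: energy_swap sum_distrib_left)
qed

lemma sum_corr_self_le:
  assumes "A \<subseteq> S"
  shows "(\<Sum>i\<in>A. \<Sum>i'\<in>A. corr i i') \<le> real (card S) * energy A"
  using sum_col_square_le[OF assms] by (simp add: sum_corr power2_eq_square)

text \<open>Cauchy-Schwarz over the columns. The square is bounded because both crossed pairings in
  the fourth moment sum to exactly this square.\<close>

lemma sum_corr_cross_le:
  assumes A: "A \<subseteq> S" and B: "B \<subseteq> S"
  shows "(\<Sum>i\<in>A. \<Sum>j\<in>B. corr i j)\<^sup>2 \<le> (real (card S))\<^sup>2 * (energy A * energy B)"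
proof -
  have "(\<Sum>i\<in>A. \<Sum>j\<in>B. corr i j)\<^sup>2
      \<le> (\<Sum>l\<in>S. (\<Sum>i\<in>A. \<bar>a i l\<bar>)\<^sup>2) * (\<Sum>l\<in>S. (\<Sum>j\<in>B. \<bar>a j l\<bar>)\<^sup>2)"
    unfolding sum_corr by (rule Cauchy_Schwarz_ineq_sum)
  also have "\<dots> \<le> (real (card S) * energy A) * (real (card S) * energy B)"
    using sum_col_square_le[OF A] sum_col_square_le[OF B] energy_nonneg
    by (intro mult_mono) (auto intro!: sum_nonneg)
  finally show ?thesis by (simp add: power2_eq_square mult_ac)
qed

lemma sum_corr4:
  "(\<Sum>i\<in>A. \<Sum>i'\<in>A. \<Sum>j\<in>B. \<Sum>j'\<in>B. corr4 i i' j j')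
    = (\<Sum>l\<in>S. (\<Sum>i\<in>A. \<bar>a i l\<bar>)\<^sup>2 * (\<Sum>j\<in>B. \<bar>a j l\<bar>)\<^sup>2)"
proof -
  have "(\<Sum>l\<in>S. (\<Sum>i\<in>A. \<bar>a i l\<bar>)\<^sup>2 * (\<Sum>j\<in>B. \<bar>a j l\<bar>)\<^sup>2)
      = (\<Sum>l\<in>S. \<Sum>i\<in>A. \<Sum>i'\<in>A. \<Sum>j\<in>B. \<Sum>j'\<in>B. \<bar>a i l * a i' l * a j l * a j' l\<bar>)"
    by (simp add: sum_square_mult_sum_square abs_mult)
  also have "\<dots> = (\<Sum>i\<in>A. \<Sum>i'\<in>A. \<Sum>j\<in>B. \<Sum>j'\<in>B. \<Sum>l\<in>S. \<bar>a i l * a i' l * a j l * a j' l\<bar>)"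
    by (simp only: sum.swap[of _ _ S])
  finally show ?thesis by (simp add: corr4_def)
qed

text \<open>In each column Cauchy-Schwarz costs a factor \<open>card S\<close> per block; the
  remaining sum of products of nonnegative column energies is at most the product of their
  sums.\<close>

lemma sum_corr4_le:
  assumes A: "A \<subseteq> S" and B: "B \<subseteq> S"
  shows "(\<Sum>i\<in>A. \<Sum>i'\<in>A. \<Sum>j\<in>B. \<Sum>j'\<in>B. corr4 i i' j j') \<le> (real (card S))\<^sup>2 * (energy A * energy B)"
proof -
  let ?q = "\<lambda>A l. \<Sum>i\<in>A. (a i l)\<^sup>2"
  have q: "0 \<le> ?q A l" for A l by (auto intro: sum_nonneg)
  have "(\<Sum>l\<in>S. (\<Sum>i\<in>A. \<bar>a i l\<bar>)\<^sup>2 * (\<Sum>j\<in>B. \<bar>a j l\<bar>)\<^sup>2)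
      \<le> (\<Sum>l\<in>S. (real (card S) * ?q A l) * (real (card S) * ?q B l))"
    using col_square_le[OF A] col_square_le[OF B] q by (intro sum_mono mult_mono) auto
  also have "\<dots> = (real (card S))\<^sup>2 * (\<Sum>l\<in>S. ?q A l * ?q B l)"
    by (simp add: sum_distrib_left power2_eq_square mult_ac)
  also have "(\<Sum>l\<in>S. ?q A l * ?q B l) \<le> (\<Sum>l\<in>S. ?q A l * (\<Sum>m\<in>S. ?q B m))"
    using fin q by (intro sum_mono mult_left_mono member_le_sum) auto
  also have "\<dots> = energy A * energy B"
    by (simp add: energy_swap sum_distrib_right)
  finally show ?thesis unfolding sum_corr4 by (simp add: mult_left_mono)
qed

text \<open>The block \<open>B\<close> enters through squares only, so just the block
  \<open>A\<close> costs a factor \<open>card S\<close>.\<close>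

lemma sum_corr3_le:
  assumes A: "A \<subseteq> S" and B: "B \<subseteq> S"
  shows "(\<Sum>i\<in>A. \<Sum>i'\<in>A. \<Sum>j\<in>B. corr4 i i' j j) \<le> real (card S) * (energy A * energy B)"
proof -
  let ?q = "\<lambda>A l. \<Sum>i\<in>A. (a i l)\<^sup>2"
  have q: "0 \<le> ?q A l" for A l by (auto intro: sum_nonneg)
  have "(\<Sum>l\<in>S. (\<Sum>i\<in>A. \<bar>a i l\<bar>)\<^sup>2 * ?q B l)
      = (\<Sum>l\<in>S. \<Sum>i\<in>A. \<Sum>i'\<in>A. \<Sum>j\<in>B. \<bar>a i l * a i' l * a j l * a j l\<bar>)"
    unfolding sum_square_mult_sum by (simp add: abs_mult power2_eq_square mult.assoc)
  also have "\<dots> = (\<Sum>i\<in>A. \<Sum>i'\<in>A. \<Sum>j\<in>B. \<Sum>l\<in>S. \<bar>a i l * a i' l * a j l * a j l\<bar>)"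
    by (simp only: sum.swap[of _ _ S])
  finally have "(\<Sum>i\<in>A. \<Sum>i'\<in>A. \<Sum>j\<in>B. corr4 i i' j j) = (\<Sum>l\<in>S. (\<Sum>i\<in>A. \<bar>a i l\<bar>)\<^sup>2 * ?q B l)"
    by (simp add: corr4_def)
  also have "\<dots> \<le> (\<Sum>l\<in>S. (real (card S) * ?q A l) * ?q B l)"
    using col_square_le[OF A] q by (intro sum_mono mult_right_mono) auto
  also have "\<dots> = real (card S) * (\<Sum>l\<in>S. ?q A l * ?q B l)"
    by (simp only: sum_distrib_left[of "real (card S)" _ S] mult.assoc)
  also have "(\<Sum>l\<in>S. ?q A l * ?q B l) \<le> (\<Sum>l\<in>S. ?q A l * (\<Sum>m\<in>S. ?q B m))"
    using fin q by (intro sum_mono mult_left_mono member_le_sum) auto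
  also have "\<dots> = energy A * energy B"
    by (simp add: energy_swap sum_distrib_right)
  finally show ?thesis by (simp add: mult_left_mono)
qed

text \<open>The diagonal gives the energy. Off the diagonal centring gains a factor
  \<open>1 / (n - 1)\<close>, at most \<open>2 / n\<close>, while the correlations sum to at most
  \<open>n\<close> times the energy: \<open>3 = 1 + 2\<close>.\<close>

lemma second_moment_le:
  assumes A: "A \<subseteq> S" and n: "2 \<le> card S"
  shows "real (card S) * perm_mean S (\<lambda>p. (\<Sum>i\<in>A. a i (p i))\<^sup>2) \<le> 3 * energy A"
proof -
  let ?n = "real (card S)"
  have n': "real (card S - 1) = ?n - 1" "?n \<ge> 2" using n by auto
  let ?E = "\<lambda>i j. perm_mean S (\<lambda>p. a i (p i) * a j (p j))"
  have E: "?n * ?E i j \<le> (if i = j then corr i i else 0) + 2 / ?n * corr i j" if ij: "i \<in> A" "j \<in> A" for i j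
  proof (cases "i = j")
    case True
    then show ?thesis using perm_mean_at[of S i "\<lambda>l. a i l * a i l"] A ij fin corr_nonneg[of i i]
      by (auto simp: corr_self power2_eq_square)
  next
    case False
    have "?n * (?n - 1) * ?E i j = - (\<Sum>l\<in>S. a i l * a j l)"
      using perm_mean_two_zero_sum[of S i j "a i" "a j"] rows fin A ij False n' by auto
    also have "\<dots> \<le> corr i j"
      unfolding corr_def sum_negf[symmetric] by (rule sum_mono) (simp add: abs_le_D2)
    finally have 1: "?n * (?n - 1) * ?E i j \<le> corr i j" .
    have "?n * ?E i j \<le> corr i j / (?n - 1)"
      using 1 n' by (simp add: field_simps)
    also have "\<dots> \<le> corr i j / (?n / 2)"
      using n' corr_nonneg by (intro divide_left_mono) auto
    finally show ?thesis using False by (simp add: mult.commute)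
  qed
  have "(\<Sum>i\<in>A. a i (p i))\<^sup>2 = (\<Sum>i\<in>A. \<Sum>j\<in>A. a i (p i) * a j (p j))" for p
    by (simp add: power2_eq_square sum_product)
  then have "?n * perm_mean S (\<lambda>p. (\<Sum>i\<in>A. a i (p i))\<^sup>2) = (\<Sum>i\<in>A. \<Sum>j\<in>A. ?n * ?E i j)"
    by (simp add: perm_mean_sum sum_distrib_left)
  also have "\<dots> \<le> (\<Sum>i\<in>A. \<Sum>j\<in>A. (if i = j then corr i i else 0) + 2 / ?n * corr i j)"
    by (intro sum_mono E)
  also have "\<dots> = energy A + 2 / ?n * (\<Sum>i\<in>A. \<Sum>j\<in>A. corr i j)"
    using finite_subset[OF A fin] by (simp add: sum.distrib sum_distrib_left energy_def corr_self)
  also have "\<dots> \<le> energy A + 2 / ?n * (?n * energy A)"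
    using sum_corr_self_le[OF A] n' by (intro add_left_mono mult_left_mono) auto
  also have "\<dots> = 3 * energy A" using n' by simp
  finally show ?thesis .
qed

text \<open>Since the blocks are disjoint, rows can coincide only within \<open>A\<close> or within
  \<open>B\<close>. With none, one or two coincidences the denominators are of order
  \<open>n^4\<close>, \<open>n^3\<close>, \<open>n^2\<close> and the numerators of order
  \<open>n^2\<close>, \<open>n\<close>, \<open>1\<close>, so all cases have the same order. The
  constant is \<open>64 + 16/3 + 16/3 + 4/3 = 76\<close>.\<close>

lemma fourth_moment_le:
  assumes A: "A \<subseteq> S" and B: "B \<subseteq> S" and AB: "A \<inter> B = {}" and n: "4 \<le> card S"
  shows "(real (card S))\<^sup>2 * perm_mean S (\<lambda>p. (\<Sum>i\<in>A. a i (p i))\<^sup>2 * (\<Sum>j\<in>B. a j (p j))\<^sup>2)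
    \<le> 76 * (energy A * energy B)"
proof -
  define n where "n = real (card S)"
  have n4: "n \<ge> 4" and n1: "real (card S - Suc 0) = n - 1" and n2: "real (card S - 2) = n - 2"
    and n3: "real (card S - 3) = n - 3" using \<open>4 \<le> card S\<close> by (auto simp: n_def)
  \<comment> \<open>For \<open>n \<ge> 4\<close> the numbers \<open>n - 1\<close>,
    \<open>n - 2\<close>, \<open>n - 3\<close> are at least \<open>3/4\<close>, \<open>1/2\<close>,
    \<open>1/4\<close> of \<open>n\<close>; the constants are the products of these
    fractions.\<close>
  have p2: "3 / 4 * n\<^sup>2 \<le> n * (n - 1)" using mult_left_mono[of "3 / 4 * n" "n - 1" n] n4 by (simp add: power2_eq_square)
  have p3: "3 / 8 * n ^ 3 \<le> n * (n - 1) * (n - 2)"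
  proof -
    have "(3 / 4 * n\<^sup>2) * (1 / 2 * n) \<le> n * (n - 1) * (n - 2)"
      by (rule mult_mono[OF p2]) (use n4 in auto)
    then show ?thesis by (simp add: power2_eq_square power3_eq_cube)
  qed
  have p4: "3 / 32 * n ^ 4 \<le> n * (n - 1) * (n - 2) * (n - 3)"
  proof -
    have "(3 / 8 * n ^ 3) * (1 / 4 * n) \<le> n * (n - 1) * (n - 2) * (n - 3)"
      by (rule mult_mono[OF p3]) (use n4 in auto)
    then show ?thesis by (simp add: power4_eq_xxxx power3_eq_cube)
  qed
  have bound: "x \<le> y / c" if "d * \<bar>x\<bar> \<le> y" "c \<le> d" "0 < c" for x y c d :: real
  proof -
    have "c * x \<le> c * \<bar>x\<bar>" using that by simp
    also have "\<dots> \<le> d * \<bar>x\<bar>" using that by (intro mult_right_mono) auto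
    finally show ?thesis using that by (simp add: field_simps)
  qed
  let ?E = "\<lambda>i i' j j'. perm_mean S (\<lambda>p. a i (p i) * a i' (p i') * a j (p j) * a j' (p j'))"
  define T4 where "T4 i i' j j' = corr i i' * corr j j' + corr i j * corr i' j' + corr i j' * corr i' j
      + 3 * corr4 i i' j j'" for i i' j j'
  define T3 where "T3 i i' j = corr i i' * corr j j + corr4 i i' j j" for i i' j
  have T4: "0 \<le> T4 i i' j j'" and T3: "0 \<le> T3 i i' j" for i i' j j'
    by (auto simp: T4_def T3_def corr_nonneg corr4_nonneg)
  \<comment> \<open>One sum of nonnegative terms bounds all four patterns of coincidence, so that
    the conditional terms can afterwards be summed separately.\<close>
  have E: "?E i i' j j' \<le> T4 i i' j j' / (3 / 32 * n ^ 4)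
      + (if j = j' then T3 i i' j / (3 / 8 * n ^ 3) else 0)
      + (if i = i' then T3 j j' i / (3 / 8 * n ^ 3) else 0)
      + (if i = i' then if j = j' then corr i i * corr j j / (3 / 4 * n\<^sup>2) else 0 else 0)"
    (is "_ \<le> ?a + ?b + ?c + ?d")
    if mem: "i \<in> A" "i' \<in> A" "j \<in> B" "j' \<in> B" for i i' j j'
  proof -
    have ne: "i \<noteq> j" "i \<noteq> j'" "i' \<noteq> j" "i' \<noteq> j'" using AB mem by auto
    have inS: "i \<in> S" "i' \<in> S" "j \<in> S" "j' \<in> S" using A B mem by auto
    have pos: "0 \<le> ?a" "0 \<le> ?b" "0 \<le> ?c" "0 \<le> ?d"
      using T4 T3 n4 corr_nonneg by auto
    consider "i \<noteq> i'" "j \<noteq> j'" | "i \<noteq> i'" "j = j'" | "i = i'" "j \<noteq> j'" | "i = i'" "j = j'" by blast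
    then show ?thesis
    proof cases
      case 1
      have "?E i i' j j' \<le> T4 i i' j j' / (3 / 32 * n ^ 4)"
        using perm_mean_four_abs[of S i i' j j' "a i" "a i'" "a j" "a j'"] fin inS ne 1 rows p4 n4
        by (intro bound[where d = "n * (n - 1) * (n - 2) * (n - 3)"])
           (auto simp: T4_def corr_def corr4_def n_def[symmetric] n1 n2 n3)
      then show ?thesis using pos by linarith
    next
      case 2
      have "?E i i' j j' \<le> T3 i i' j / (3 / 8 * n ^ 3)"
        using perm_mean_three_abs[of S i i' j "a i" "a i'" "\<lambda>l. a j l * a j l"] fin inS ne 2 rows p3 n4
        by (intro bound[where d = "n * (n - 1) * (n - 2)"])
           (auto simp: T3_def corr_def corr4_def n_def[symmetric] n1 n2 mult.assoc)
      then show ?thesis using pos 2 by simp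
    next
      case 3
      have "?E i i' j j' \<le> T3 j j' i / (3 / 8 * n ^ 3)"
        using perm_mean_three_abs[of S j j' i "a j" "a j'" "\<lambda>l. a i l * a i l"] fin inS ne 3 rows p3 n4
        by (intro bound[where d = "n * (n - 1) * (n - 2)"])
           (auto simp: T3_def corr_def corr4_def n_def[symmetric] n1 n2 mult_ac)
      then show ?thesis using pos 3 by simp
    next
      case 4
      have "?E i i' j j' \<le> corr i i * corr j j / (3 / 4 * n\<^sup>2)"
        using perm_mean_two_abs[of S i j "\<lambda>l. a i l * a i l" "\<lambda>l. a j l * a j l"] fin inS ne 4 rows p2 n4
        by (intro bound[where d = "n * (n - 1)"])
           (auto simp: corr_def n_def[symmetric] n1 mult_ac)
      then show ?thesis using pos 4 by simp
    qed
  qed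
  have fA: "finite A" and fB: "finite B" using A B fin by (auto intro: finite_subset)
  let ?V = "energy A * energy B"
  have sE: "(\<Sum>i\<in>C. corr i i) = energy C" for C by (simp add: energy_def corr_self)
  \<comment> \<open>Each of the three pairings contributes 1 and the term with \<open>corr4\<close>
    contributes 3.\<close>
  have s4: "(\<Sum>i\<in>A. \<Sum>i'\<in>A. \<Sum>j\<in>B. \<Sum>j'\<in>B. T4 i i' j j') \<le> 6 * (n\<^sup>2 * ?V)"
  proof -
    have "(\<Sum>i\<in>A. \<Sum>i'\<in>A. corr i i') * (\<Sum>j\<in>B. \<Sum>j'\<in>B. corr j j') \<le> (n * energy A) * (n * energy B)"
      using sum_corr_self_le[OF A] sum_corr_self_le[OF B] n4 energy_nonneg corr_nonneg
      by (intro mult_mono) (auto simp: n_def[symmetric] intro!: sum_nonneg)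
    moreover have "(\<Sum>i\<in>A. \<Sum>i'\<in>A. corr i i') * (\<Sum>j\<in>B. \<Sum>j'\<in>B. corr j j')
        = (\<Sum>i\<in>A. \<Sum>i'\<in>A. \<Sum>j\<in>B. \<Sum>j'\<in>B. corr i i' * corr j j')"
    proof -
      have *: "(\<Sum>i\<in>A. \<Sum>i'\<in>A. corr i i') * W = (\<Sum>i\<in>A. \<Sum>i'\<in>A. corr i i' * W)" for W
        by (simp only: sum_distrib_right)
      show ?thesis by (subst *) (simp only: sum_distrib_left)
    qed
    moreover have sq: "(\<Sum>i\<in>A. \<Sum>j\<in>B. corr i j)\<^sup>2 = (\<Sum>i\<in>A. \<Sum>i'\<in>A. \<Sum>j\<in>B. \<Sum>j'\<in>B. corr i j * corr i' j')"
      by (simp only: power2_eq_square sum_product)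
    moreover have "(\<Sum>i\<in>A. \<Sum>j\<in>B. corr i j)\<^sup>2 = (\<Sum>i\<in>A. \<Sum>i'\<in>A. \<Sum>j\<in>B. \<Sum>j'\<in>B. corr i j' * corr i' j)"
      unfolding sq by (rule sum.cong[OF refl], rule sum.cong[OF refl], rule sum.swap)
    moreover have "(n * energy A) * (n * energy B) = n * n * (energy A * energy B)"
      by simp
    ultimately show ?thesis
      using sum_corr_cross_le[OF A B] sum_corr4_le[OF A B]
      by (simp add: T4_def sum.distrib sum_distrib_left[symmetric] n_def[symmetric] power2_eq_square)
  qed
  have s3: "(\<Sum>i\<in>C. \<Sum>i'\<in>C. \<Sum>j\<in>D. T3 i i' j) \<le> 2 * (n * (energy C * energy D))"
    if C: "C \<subseteq> S" and D: "D \<subseteq> S" for C D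
  proof -
    have "(\<Sum>i\<in>C. \<Sum>i'\<in>C. corr i i') * (\<Sum>j\<in>D. corr j j) \<le> (n * energy C) * energy D"
      using sum_corr_self_le[OF C] energy_nonneg unfolding sE
      by (intro mult_right_mono) (auto simp: n_def[symmetric])
    moreover have "(\<Sum>i\<in>C. \<Sum>i'\<in>C. corr i i') * (\<Sum>j\<in>D. corr j j) = (\<Sum>i\<in>C. \<Sum>i'\<in>C. \<Sum>j\<in>D. corr i i' * corr j j)"
    proof -
      have *: "(\<Sum>i\<in>C. \<Sum>i'\<in>C. corr i i') * W = (\<Sum>i\<in>C. \<Sum>i'\<in>C. corr i i' * W)" for W
        by (simp only: sum_distrib_right)
      show ?thesis by (subst *) (simp only: sum_distrib_left)
    qed
    ultimately show ?thesis
      using sum_corr3_le[OF C D] by (simp add: T3_def sum.distrib n_def[symmetric])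
  qed
  have "perm_mean S (\<lambda>p. (\<Sum>i\<in>A. a i (p i))\<^sup>2 * (\<Sum>j\<in>B. a j (p j))\<^sup>2)
      = (\<Sum>i\<in>A. \<Sum>i'\<in>A. \<Sum>j\<in>B. \<Sum>j'\<in>B. ?E i i' j j')"
    unfolding sum_square_mult_sum_square perm_mean_sum ..
  also have "\<dots> \<le> (\<Sum>i\<in>A. \<Sum>i'\<in>A. \<Sum>j\<in>B. \<Sum>j'\<in>B. T4 i i' j j' / (3 / 32 * n ^ 4)
      + (if j = j' then T3 i i' j / (3 / 8 * n ^ 3) else 0)
      + (if i = i' then T3 j j' i / (3 / 8 * n ^ 3) else 0)
      + (if i = i' then if j = j' then corr i i * corr j j / (3 / 4 * n\<^sup>2) else 0 else 0))"
    by (intro sum_mono E)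
  also have "\<dots> = (\<Sum>i\<in>A. \<Sum>i'\<in>A. \<Sum>j\<in>B. \<Sum>j'\<in>B. T4 i i' j j') / (3 / 32 * n ^ 4)
      + (\<Sum>i\<in>A. \<Sum>i'\<in>A. \<Sum>j\<in>B. T3 i i' j) / (3 / 8 * n ^ 3)
      + (\<Sum>j\<in>B. \<Sum>j'\<in>B. \<Sum>i\<in>A. T3 j j' i) / (3 / 8 * n ^ 3)
      + (\<Sum>i\<in>A. \<Sum>j\<in>B. corr i i * corr j j) / (3 / 4 * n\<^sup>2)"
  proof -
    have *: "(\<Sum>y\<in>B. \<Sum>z\<in>B. if i = i' then F y z else 0) = (if i = i' then \<Sum>y\<in>B. \<Sum>z\<in>B. F y z else 0)"
      for i i' :: 'a and F :: "'a \<Rightarrow> 'a \<Rightarrow> real" by simp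
    have **: "(\<Sum>i\<in>A. \<Sum>j\<in>B. \<Sum>j'\<in>B. T3 j j' i / (3 / 8 * n ^ 3))
        = (\<Sum>j\<in>B. \<Sum>j'\<in>B. \<Sum>i\<in>A. T3 j j' i / (3 / 8 * n ^ 3))"
      by (simp only: sum.swap[of _ A B])
    show ?thesis unfolding sum.distrib sum_divide_distrib **[symmetric] *
      by (simp add: fA fB)
  qed
  also have "\<dots> \<le> 6 * (n\<^sup>2 * ?V) / (3 / 32 * n ^ 4) + 2 * (n * ?V) / (3 / 8 * n ^ 3)
      + 2 * (n * (energy B * energy A)) / (3 / 8 * n ^ 3) + ?V / (3 / 4 * n\<^sup>2)"
  proof -
    have "(\<Sum>i\<in>A. \<Sum>j\<in>B. corr i i * corr j j) = ?V"
      by (simp add: sum_product[symmetric] sE)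
    then show ?thesis using s4 s3[OF A B] s3[OF B A] n4
      by (intro add_mono divide_right_mono) auto
  qed
  also have "\<dots> = 76 * ?V / n\<^sup>2"
    using n4 by (simp add: field_simps power2_eq_square power3_eq_cube power4_eq_xxxx)
  finally show ?thesis using n4 by (simp add: n_def field_simps)
qed

end

section \<open>A maximal inequality\<close>

text \<open>Billingsley's two-sided fluctuation. The minimum of the increments on both sides of
  \<open>j\<close> is controlled by product moments over adjacent blocks, whereas one increment
  alone would need a genuine fourth moment.\<close>

definition split_max :: "(nat \<Rightarrow> real) \<Rightarrow> nat \<Rightarrow> nat \<Rightarrow> real" where
  "split_max S i k = Max ((\<lambda>j. min \<bar>S j - S i\<bar> \<bar>S k - S j\<bar>) ` {i..k})"

lemma split_max_ge: "j \<in> {i..k} \<Longrightarrow> min \<bar>S j - S i\<bar> \<bar>S k - S j\<bar> \<le> split_max S i k"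
  by (auto simp: split_max_def intro!: Max_ge)

lemma split_max_le:
  "i \<le> k \<Longrightarrow> (\<And>j. j \<in> {i..k} \<Longrightarrow> min \<bar>S j - S i\<bar> \<bar>S k - S j\<bar> \<le> b) \<Longrightarrow> split_max S i k \<le> b"
  by (auto simp: split_max_def intro!: Max.boundedI)

lemma split_max_nonneg: "i \<le> k \<Longrightarrow> 0 \<le> split_max S i k"
  using split_max_ge[of i i k S] by simp

lemma abs_diff_le_split_max:
  assumes "j \<in> {i..k}"
  shows "\<bar>S j - S i\<bar> \<le> split_max S i k + \<bar>S k - S i\<bar>"
  using split_max_ge[OF assms, of S] split_max_nonneg[of i k S] assms by (auto simp: min_def split: if_splits)

text \<open>The right increment grows from \<open>y\<close> to \<open>y + w\<close>. If
  \<open>x\<close> is the small one, nothing changes; if \<open>y\<close> is small, then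
  \<open>x\<close> is close to \<open>x + y\<close> and \<open>y + w\<close> is close to
  \<open>w\<close>.\<close>

lemma min_abs_shift:
  fixes x y w M :: real
  assumes "min \<bar>x\<bar> \<bar>y\<bar> \<le> M"
  shows "min \<bar>x\<bar> \<bar>y + w\<bar> \<le> M + min \<bar>x + y\<bar> \<bar>w\<bar>"
proof (cases "\<bar>x\<bar> \<le> M")
  case True
  then show ?thesis by (simp add: min_le_iff_disj add_increasing2)
next
  case False
  then have "\<bar>y\<bar> \<le> M" using assms by (simp add: min_le_iff_disj)
  then have "\<bar>x\<bar> \<le> M + \<bar>x + y\<bar>" "\<bar>y + w\<bar> \<le> M + \<bar>w\<bar>" by linarith+
  then show ?thesis by (simp add: min_def)
qed

text \<open>The left block ends at \<open>h - 1\<close>, so the step from \<open>h - 1\<close> to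
  \<open>h\<close> lies in neither block. The added minima pay for replacing an endpoint of a block
  by an endpoint of the whole range.\<close>

lemma split_max_split:
  assumes h: "i < h" "h \<le> k"
  shows "split_max S i k \<le> max
      (split_max S i (h - 1) + min \<bar>S (h - 1) - S i\<bar> \<bar>S k - S (h - 1)\<bar>)
      (split_max S h k + min \<bar>S h - S i\<bar> \<bar>S k - S h\<bar>)"
proof (rule split_max_le)
  show "i \<le> k" using h by simp
  fix j assume j: "j \<in> {i..k}"
  show "min \<bar>S j - S i\<bar> \<bar>S k - S j\<bar> \<le> max
      (split_max S i (h - 1) + min \<bar>S (h - 1) - S i\<bar> \<bar>S k - S (h - 1)\<bar>)
      (split_max S h k + min \<bar>S h - S i\<bar> \<bar>S k - S h\<bar>)"
  proof (cases "j < h")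
    case True
    then have "j \<in> {i..h - 1}" using j by auto
    from split_max_ge[OF this, of S] show ?thesis
      using min_abs_shift[of "S j - S i" "S (h - 1) - S j" "split_max S i (h - 1)" "S k - S (h - 1)"]
      by (simp add: le_max_iff_disj)
  next
    case False
    then have "j \<in> {h..k}" using j by auto
    from split_max_ge[OF this, of S] show ?thesis
      using min_abs_shift[of "S k - S j" "S j - S h" "split_max S h k" "S h - S i"]
      by (simp add: le_max_iff_disj min.commute)
  qed
qed

text \<open>The induction that uses this needs a coefficient of \<open>x ^ 4\<close> below 2,
  whatever the price in \<open>y\<close>. The thresholds \<open>y \<le> x / 6\<close> and
  \<open>x < 6 * y\<close> give the coefficients \<open>(7/6)^4\<close> and
  \<open>7^4 = 2401\<close>.\<close>

lemma add_power4_le: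
  fixes x y :: real
  assumes "0 \<le> x" "0 \<le> y"
  shows "(x + y) ^ 4 \<le> (7 / 6) ^ 4 * x ^ 4 + 2401 * y ^ 4"
proof (cases "y \<le> x / 6")
  case True
  then have "(x + y) ^ 4 \<le> (7 / 6 * x) ^ 4" using assms by (intro power_mono) auto
  also have "\<dots> = (7 / 6) ^ 4 * x ^ 4" by (rule power_mult_distrib)
  finally show ?thesis using assms by (simp add: add_increasing2)
next
  case False
  then have "(x + y) ^ 4 \<le> (7 * y) ^ 4" using assms by (intro power_mono) auto
  also have "\<dots> = 2401 * y ^ 4" by (simp add: power_mult_distrib)
  finally show ?thesis using assms by (simp add: add_increasing)
qed

text \<open>Billingsley's maximal inequality: the index range is cut where \<^term>\<open>U\<close> has grown by one
  half, and the fourth power of the mean increment absorbs the loss because \<open>2 * (7/6)^4 / 4 < 1\<close>.\<close>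

lemma sum_split_max_power4_le:
  fixes S :: "'p \<Rightarrow> nat \<Rightarrow> real" and U :: "nat \<Rightarrow> real"
  assumes U: "\<And>i j. i \<le> j \<Longrightarrow> j \<le> N \<Longrightarrow> U i \<le> U j" and C: "0 \<le> C"
    and mom: "\<And>i j k. i \<le> j \<Longrightarrow> j \<le> k \<Longrightarrow> k \<le> N \<Longrightarrow>
      (\<Sum>p\<in>P. (S p j - S p i)\<^sup>2 * (S p k - S p j)\<^sup>2) \<le> C * (U k - U i)\<^sup>2"
  shows "i \<le> k \<Longrightarrow> k \<le> N \<Longrightarrow> (\<Sum>p\<in>P. split_max (S p) i k ^ 4) \<le> 70000 * C * (U k - U i)\<^sup>2"
proof (induction "k - i" arbitrary: i k rule: less_induct)
  case less
  show ?case
  proof (cases "i = k")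
    case True
    then show ?thesis by (simp add: split_max_def)
  next
    case False
    then have ik: "i < k" using less.prems by simp
    define D where "D p j = min \<bar>S p j - S p i\<bar> \<bar>S p k - S p j\<bar>" for p j
    define V where "V = U k - U i"
    have V0: "0 \<le> V" using U less.prems by (auto simp: V_def)
    have D0: "0 \<le> D p j" for p j by (simp add: D_def)
    have D4: "(\<Sum>p\<in>P. D p j ^ 4) \<le> C * V\<^sup>2" if "i \<le> j" "j \<le> k" for j
    proof -
      have "D p j ^ 4 \<le> (S p j - S p i)\<^sup>2 * (S p k - S p j)\<^sup>2" for p
      proof -
        have "D p j ^ 4 = (D p j)\<^sup>2 * (D p j)\<^sup>2" by (simp add: power4_eq_xxxx power2_eq_square)
        also have "\<dots> \<le> \<bar>S p j - S p i\<bar>\<^sup>2 * \<bar>S p k - S p j\<bar>\<^sup>2"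
          using D0 by (intro mult_mono power_mono) (auto simp: D_def)
        finally show ?thesis by simp
      qed
      then have "(\<Sum>p\<in>P. D p j ^ 4) \<le> (\<Sum>p\<in>P. (S p j - S p i)\<^sup>2 * (S p k - S p j)\<^sup>2)"
        by (intro sum_mono)
      also have "\<dots> \<le> C * V\<^sup>2" unfolding V_def using mom that less.prems by simp
      finally show ?thesis .
    qed
    \<comment> \<open>Before \<open>h\<close> the growth of \<open>U\<close> is at most one half,
      and from \<open>h\<close> on at most one half is left. Even a single large jump of
      \<open>U\<close> is harmless, because the step into \<open>h\<close> belongs to neither
      block.\<close>
    define h where "h = (LEAST h. i < h \<and> U h - U i \<ge> V / 2)"
    have "i < k \<and> U k - U i \<ge> V / 2" using ik V0 by (simp add: V_def)
    then have h: "i < h" "U h - U i \<ge> V / 2" and hk: "h \<le> k"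
      unfolding h_def by (auto intro: LeastI2 Least_le)
    have h1: "U (h - 1) - U i \<le> V / 2"
    proof (cases "i < h - 1")
      case True
      then have "\<not> (U (h - 1) - U i \<ge> V / 2)"
        using not_less_Least[of "h - 1" "\<lambda>h. i < h \<and> U h - U i \<ge> V / 2"] h(1)
        unfolding h_def[symmetric] by auto
      then show ?thesis by simp
    next
      case False
      then have "h - 1 = i" using h(1) by simp
      then show ?thesis using V0 by simp
    qed
    have sq: "(U b - U a)\<^sup>2 \<le> V\<^sup>2 / 4" if "U b - U a \<le> V / 2" "a \<le> b" "b \<le> k" for a b
    proof -
      have "0 \<le> U b - U a" using U that less.prems by simp
      then have "(U b - U a)\<^sup>2 \<le> (V / 2)\<^sup>2" using that by (intro power_mono) auto
      then show ?thesis by (simp add: power_divide)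
    qed
    let ?M1 = "\<lambda>p. split_max (S p) i (h - 1)" and ?M2 = "\<lambda>p. split_max (S p) h k"
    have "(\<Sum>p\<in>P. ?M1 p ^ 4) \<le> 70000 * C * (U (h - 1) - U i)\<^sup>2"
      using h hk less.prems by (intro less.hyps) auto
    also have "\<dots> \<le> 70000 * C * (V\<^sup>2 / 4)"
      using C h hk h1 by (intro mult_left_mono sq) auto
    finally have M1: "(\<Sum>p\<in>P. ?M1 p ^ 4) \<le> 70000 * C * (V\<^sup>2 / 4)" .
    have "(\<Sum>p\<in>P. ?M2 p ^ 4) \<le> 70000 * C * (U k - U h)\<^sup>2"
      using h hk less.prems by (intro less.hyps) auto
    also have "\<dots> \<le> 70000 * C * (V\<^sup>2 / 4)"
      using C h hk by (intro mult_left_mono sq) (auto simp: V_def)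
    finally have M2: "(\<Sum>p\<in>P. ?M2 p ^ 4) \<le> 70000 * C * (V\<^sup>2 / 4)" .
    have pt: "split_max (S p) i k ^ 4 \<le> ((7 / 6) ^ 4 * ?M1 p ^ 4 + 2401 * D p (h - 1) ^ 4)
        + ((7 / 6) ^ 4 * ?M2 p ^ 4 + 2401 * D p h ^ 4)" for p
    proof -
      have m: "0 \<le> ?M1 p" "0 \<le> ?M2 p" using split_max_nonneg h hk by auto
      have "split_max (S p) i k \<le> max (?M1 p + D p (h - 1)) (?M2 p + D p h)"
        unfolding D_def by (rule split_max_split[OF h(1) hk])
      then have "split_max (S p) i k ^ 4 \<le> (max (?M1 p + D p (h - 1)) (?M2 p + D p h)) ^ 4"
        using ik by (intro power_mono split_max_nonneg) auto
      also have "\<dots> \<le> (?M1 p + D p (h - 1)) ^ 4 + (?M2 p + D p h) ^ 4"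
        by (auto simp: max_def)
      also have "\<dots> \<le> ((7 / 6) ^ 4 * ?M1 p ^ 4 + 2401 * D p (h - 1) ^ 4)
        + ((7 / 6) ^ 4 * ?M2 p ^ 4 + 2401 * D p h ^ 4)"
        by (intro add_mono add_power4_le m D0)
      finally show ?thesis .
    qed
    have "(\<Sum>p\<in>P. split_max (S p) i k ^ 4) \<le> (\<Sum>p\<in>P. ((7 / 6) ^ 4 * ?M1 p ^ 4 + 2401 * D p (h - 1) ^ 4)
        + ((7 / 6) ^ 4 * ?M2 p ^ 4 + 2401 * D p h ^ 4))"
      by (intro sum_mono pt)
    also have "\<dots> = (7 / 6) ^ 4 * (\<Sum>p\<in>P. ?M1 p ^ 4) + 2401 * (\<Sum>p\<in>P. D p (h - 1) ^ 4)
        + ((7 / 6) ^ 4 * (\<Sum>p\<in>P. ?M2 p ^ 4) + 2401 * (\<Sum>p\<in>P. D p h ^ 4))"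
      by (simp add: sum.distrib sum_distrib_left)
    also have "\<dots> \<le> (7 / 6) ^ 4 * (70000 * C * (V\<^sup>2 / 4)) + 2401 * (C * V\<^sup>2)
        + ((7 / 6) ^ 4 * (70000 * C * (V\<^sup>2 / 4)) + 2401 * (C * V\<^sup>2))"
      using h hk by (intro add_mono mult_left_mono M1 M2 D4) auto
    \<comment> \<open>A constant \<open>K\<close> closes the induction if
      \<open>2 * (K * (7/6)^4 / 4 + 2401) \<le> K\<close>, that is, from about 65167 on.\<close>
    also have "\<dots> \<le> 70000 * C * V\<^sup>2"
    proof -
      have "0 \<le> C * V\<^sup>2" using C by simp
      then have "(2 * (2401 / 1296 * (70000 / 4) + 2401)) * (C * V\<^sup>2) \<le> 70000 * (C * V\<^sup>2)"
        by (intro mult_right_mono) auto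
      moreover have e: "((7 / 6) ^ 4 :: real) = 2401 / 1296" by (simp add: power4_eq_xxxx)
      ultimately show ?thesis unfolding e by simp
    qed
    finally show ?thesis unfolding V_def .
  qed
qed

section \<open>The characteristic function of a combinatorial sum\<close>

lemma mult_square_le_cubes:
  fixes x y :: real
  assumes "0 \<le> x" "0 \<le> y"
  shows "x * y\<^sup>2 \<le> x ^ 3 + y ^ 3"
proof (cases "x \<le> y")
  case True
  then have "x * y\<^sup>2 \<le> y * y\<^sup>2" by (intro mult_right_mono) auto
  then show ?thesis using assms by (simp add: power3_eq_cube power2_eq_square add_increasing)
next
  case False
  then have "x * y\<^sup>2 \<le> x * x\<^sup>2" using assms by (intro mult_left_mono power_mono) auto
  then show ?thesis using assms by (simp add: power3_eq_cube power2_eq_square add_increasing2)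
qed

lemma prod3_le_cubes:
  fixes x y z :: real
  assumes "0 \<le> x" "0 \<le> y" "0 \<le> z"
  shows "x * y * z \<le> x ^ 3 + y ^ 3 + z ^ 3"
proof -
  define m where "m = max x (max y z)"
  have "x * y * z \<le> m * m * m" using assms by (intro mult_mono) (auto simp: m_def)
  also have "\<dots> = m ^ 3" by (simp add: power3_eq_cube)
  also have "\<dots> \<le> x ^ 3 + y ^ 3 + z ^ 3" using assms by (auto simp: m_def max_def)
  finally show ?thesis .
qed

lemma sum4_square_le:
  fixes a b c d :: real
  shows "(a + b - c - d)\<^sup>2 \<le> 4 * (a\<^sup>2 + b\<^sup>2 + c\<^sup>2 + d\<^sup>2)"
proof -
  have "4 * (a\<^sup>2 + b\<^sup>2 + c\<^sup>2 + d\<^sup>2) - (a + b - c - d)\<^sup>2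
      = (a - b)\<^sup>2 + (a + c)\<^sup>2 + (a + d)\<^sup>2 + (b + c)\<^sup>2 + (b + d)\<^sup>2 + (c - d)\<^sup>2"
    by (simp add: power2_eq_square algebra_simps)
  moreover have "\<dots> \<ge> 0" by simp
  ultimately show ?thesis by linarith
qed

text \<open>The coefficient 20 collects the cubes of \<open>x\<close>: 8 from its own square and 4
  from each of the other three.\<close>

lemma weighted_square_le_cubes:
  fixes x y z w d :: real
  assumes "0 \<le> x" "0 \<le> y" "0 \<le> z" "0 \<le> w" and d: "d \<le> 4 * (x\<^sup>2 + y\<^sup>2 + z\<^sup>2 + w\<^sup>2)"
  shows "x * d \<le> 20 * x ^ 3 + 4 * y ^ 3 + 4 * z ^ 3 + 4 * w ^ 3"
proof -
  have "x * d \<le> x * (4 * (x\<^sup>2 + y\<^sup>2 + z\<^sup>2 + w\<^sup>2))"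
    using d assms(1) by (rule mult_left_mono)
  also have "\<dots> = 4 * (x * x\<^sup>2) + 4 * (x * y\<^sup>2) + 4 * (x * z\<^sup>2) + 4 * (x * w\<^sup>2)"
    by (simp add: distrib_left)
  finally have "x * d \<le> 4 * (x * x\<^sup>2) + 4 * (x * y\<^sup>2) + 4 * (x * z\<^sup>2) + 4 * (x * w\<^sup>2)" .
  then show ?thesis
    using mult_square_le_cubes[of x x] mult_square_le_cubes[of x y] mult_square_le_cubes[of x z]
      mult_square_le_cubes[of x w] assms by linarith
qed

lemma prod3_sum_le_cubes:
  fixes u v x y z w d :: real
  assumes "0 \<le> u" "0 \<le> v" "0 \<le> x" "0 \<le> y" "0 \<le> z" "0 \<le> w" and d: "d \<le> x + y + z + w"
  shows "u * v * d \<le> 4 * u ^ 3 + 4 * v ^ 3 + (x ^ 3 + y ^ 3 + z ^ 3 + w ^ 3)"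
proof -
  have "u * v * d \<le> u * v * (x + y + z + w)"
    using d assms(1,2) by (intro mult_left_mono) auto
  also have "\<dots> = u * v * x + u * v * y + u * v * z + u * v * w"
    by (simp add: distrib_left)
  finally show ?thesis
    using prod3_le_cubes[of u v x] prod3_le_cubes[of u v y] prod3_le_cubes[of u v z]
      prod3_le_cubes[of u v w] assms by linarith
qed

section \<open>Stein's method for a doubly centred matrix\<close>

locale centred_matrix =
  fixes S :: "'a set" and b :: "'a \<Rightarrow> 'a \<Rightarrow> real"
  assumes fin: "finite S" and ne: "S \<noteq> {}"
    and rows: "\<And>i. i \<in> S \<Longrightarrow> (\<Sum>l\<in>S. b i l) = 0"
    and cols: "\<And>l. l \<in> S \<Longrightarrow> (\<Sum>i\<in>S. b i l) = 0"
begin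

definition n :: real where "n = real (card S)"
definition W :: "('a \<Rightarrow> 'a) \<Rightarrow> real" where "W p = (\<Sum>i\<in>S. b i (p i))"
definition V :: real where "V = (\<Sum>i\<in>S. \<Sum>l\<in>S. (b i l)\<^sup>2)"
definition T :: real where "T = (\<Sum>i\<in>S. \<Sum>l\<in>S. \<bar>b i l\<bar> ^ 3)"
definition D2 :: "('a \<Rightarrow> 'a) \<Rightarrow> real" where "D2 p = (\<Sum>i\<in>S. (b i (p i))\<^sup>2)"
definition D3 :: "('a \<Rightarrow> 'a) \<Rightarrow> real" where "D3 p = (\<Sum>i\<in>S. \<bar>b i (p i)\<bar> ^ 3)"
text \<open>The change of \<open>W\<close> when the value at \<open>i\<close> becomes
  \<open>l\<close>: row \<open>inv p l\<close> gives up column \<open>l\<close> and receives column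
  \<open>p i\<close>. For \<open>l = p i\<close> the four terms cancel.\<close>

definition \<Delta> :: "('a \<Rightarrow> 'a) \<Rightarrow> 'a \<Rightarrow> 'a \<Rightarrow> real" where
  "\<Delta> p i l = b i l + b (inv p l) (p i) - b i (p i) - b (inv p l) l"

lemma n_pos: "n \<ge> 1"
  using fin ne by (simp add: n_def Suc_le_eq card_gt_0_iff)

lemma T_nonneg: "0 \<le> T" by (auto simp: T_def intro!: sum_nonneg)
lemma V_nonneg: "0 \<le> V" by (auto simp: V_def intro!: sum_nonneg)

lemma W_resample:
  assumes p: "p permutes S" and il: "i \<in> S" "l \<in> S"
  shows "W (resample p i l) = W p + \<Delta> p i l"
proof -
  define k where "k = inv p l"
  have k: "k \<in> S" "p k = l" using p il permutes_in_image[OF permutes_inv[OF p]]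
    by (auto simp: k_def permutes_inverses)
  have "W (resample p i l) - W p = (\<Sum>j\<in>S. b j (resample p i l j) - b j (p j))"
    by (simp add: W_def sum_subtractf)
  also have "\<dots> = (\<Sum>j\<in>{i, k}. b j (resample p i l j) - b j (p j))"
  proof (rule sum.mono_neutral_right[OF fin])
    show "\<forall>j\<in>S - {i, k}. b j (resample p i l j) - b j (p j) = 0"
    proof
      fix j assume j: "j \<in> S - {i, k}"
      then have "p j \<noteq> p i" "p j \<noteq> l" using k(2) permutes_inj[OF p] by (auto dest: injD)
      then show "b j (resample p i l j) - b j (p j) = 0" by (simp add: resample_other)
    qed
  qed (use il k in auto)
  also have "\<dots> = \<Delta> p i l"
  proof (cases "i = k")
    case True
    then show ?thesis using k by (simp add: \<Delta>_def k_def[symmetric])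
  next
    case False
    then show ?thesis using k(2) by (simp add: \<Delta>_def k_def[symmetric] resample_hit)
  qed
  finally show ?thesis by simp
qed

lemma sum_inv: "p permutes S \<Longrightarrow> (\<Sum>l\<in>S. g (inv p l) l) = (\<Sum>k\<in>S. g k (p k))" for g :: "'a \<Rightarrow> 'a \<Rightarrow> real"
  by (rule sum.reindex_bij_witness[where i = p and j = "inv p"])
     (auto simp: permutes_inverses permutes_in_image permutes_inv)

lemma sum_perm: "p permutes S \<Longrightarrow> (\<Sum>i\<in>S. g (p i)) = (\<Sum>l\<in>S. g l)" for g :: "'a \<Rightarrow> real"
  using sum.permute[of p S g] by simp

lemma sum_inv': "p permutes S \<Longrightarrow> (\<Sum>l\<in>S. g (inv p l)) = (\<Sum>k\<in>S. g k)" for g :: "'a \<Rightarrow> real"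
  using sum_inv[of p "\<lambda>k _. g k"] by simp

lemma sum_cubes:
  assumes p: "p permutes S"
  shows "(\<Sum>i\<in>S. \<Sum>l\<in>S. \<bar>b (inv p l) (p i)\<bar> ^ 3) = T"
    "(\<Sum>i\<in>S. \<Sum>l\<in>S. \<bar>b i (p i)\<bar> ^ 3) = n * D3 p"
    "(\<Sum>i\<in>S. \<Sum>l\<in>S. \<bar>b (inv p l) l\<bar> ^ 3) = n * D3 p"
proof -
  have "(\<Sum>i\<in>S. \<Sum>l\<in>S. \<bar>b (inv p l) (p i)\<bar> ^ 3) = (\<Sum>i\<in>S. \<Sum>k\<in>S. \<bar>b k (p i)\<bar> ^ 3)"
    by (intro sum.cong refl sum_inv'[OF p])
  also have "\<dots> = (\<Sum>m\<in>S. \<Sum>k\<in>S. \<bar>b k m\<bar> ^ 3)" by (rule sum_perm[OF p])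
  also have "\<dots> = T" unfolding T_def by (rule sum.swap)
  finally show "(\<Sum>i\<in>S. \<Sum>l\<in>S. \<bar>b (inv p l) (p i)\<bar> ^ 3) = T" .
  show "(\<Sum>i\<in>S. \<Sum>l\<in>S. \<bar>b i (p i)\<bar> ^ 3) = n * D3 p" by (simp add: n_def D3_def sum_distrib_left)
  show "(\<Sum>i\<in>S. \<Sum>l\<in>S. \<bar>b (inv p l) l\<bar> ^ 3) = n * D3 p"
    using sum_inv[OF p, of "\<lambda>k l. \<bar>b k l\<bar> ^ 3"] by (simp add: n_def D3_def)
qed

text \<open>The entries of the new permutation run over the whole matrix and sum to
  \<open>T\<close>, giving \<open>24 = 20 + 4\<close>; the entries of the old one sum to
  \<open>n * D3 p\<close>, giving \<open>8 = 4 + 4\<close>.\<close>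

lemma sum_weighted_square_le:
  assumes p: "p permutes S"
  shows "(\<Sum>i\<in>S. \<Sum>l\<in>S. \<bar>b i l\<bar> * (\<Delta> p i l)\<^sup>2) \<le> 24 * T + 8 * (n * D3 p)"
proof -
  have "\<bar>b i l\<bar> * (\<Delta> p i l)\<^sup>2 \<le> 20 * \<bar>b i l\<bar> ^ 3 + 4 * \<bar>b (inv p l) (p i)\<bar> ^ 3
      + 4 * \<bar>b i (p i)\<bar> ^ 3 + 4 * \<bar>b (inv p l) l\<bar> ^ 3" for i l
    using sum4_square_le[of "b i l" "b (inv p l) (p i)" "b i (p i)" "b (inv p l) l"]
    by (intro weighted_square_le_cubes) (auto simp: \<Delta>_def)
  then have "(\<Sum>i\<in>S. \<Sum>l\<in>S. \<bar>b i l\<bar> * (\<Delta> p i l)\<^sup>2) \<le> (\<Sum>i\<in>S. \<Sum>l\<in>S. 20 * \<bar>b i l\<bar> ^ 3 + 4 * \<bar>b (inv p l) (p i)\<bar> ^ 3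
      + 4 * \<bar>b i (p i)\<bar> ^ 3 + 4 * \<bar>b (inv p l) l\<bar> ^ 3)"
    by (intro sum_mono)
  also have "\<dots> = 20 * T + 4 * T + 4 * (n * D3 p) + 4 * (n * D3 p)"
    by (simp only: sum.distrib sum_distrib_left[symmetric] sum_cubes[OF p] T_def[symmetric])
  finally show ?thesis by simp
qed

text \<open>Every term is split into cubes of single entries, and an index that an entry does not
  contain gives a factor \<open>n\<close>. The constant 10 is \<open>4 + 4 + 1 + 1\<close>.\<close>

lemma sum_cross_le:
  assumes p: "p permutes S"
  shows "(\<Sum>i\<in>S. \<Sum>k\<in>S. \<Sum>l\<in>S. \<bar>b i (p k)\<bar> * \<bar>b k l\<bar> * \<bar>\<Delta> p i l\<bar>) \<le> 10 * (n * T) + 2 * (n * (n * D3 p))"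
proof -
  let ?y = "\<lambda>i l. \<bar>b i l\<bar> ^ 3 + \<bar>b (inv p l) (p i)\<bar> ^ 3 + \<bar>b i (p i)\<bar> ^ 3 + \<bar>b (inv p l) l\<bar> ^ 3"
  have pt: "\<bar>b i (p k)\<bar> * \<bar>b k l\<bar> * \<bar>\<Delta> p i l\<bar> \<le> 4 * \<bar>b i (p k)\<bar> ^ 3 + 4 * \<bar>b k l\<bar> ^ 3 + ?y i l" for i k l
    by (intro prod3_sum_le_cubes) (auto simp: \<Delta>_def)
  have c: "(\<Sum>l\<in>S. x) = n * x" for x by (simp add: n_def)
  have "(\<Sum>i\<in>S. \<Sum>k\<in>S. \<Sum>l\<in>S. \<bar>b i (p k)\<bar> * \<bar>b k l\<bar> * \<bar>\<Delta> p i l\<bar>)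
      \<le> (\<Sum>i\<in>S. \<Sum>k\<in>S. \<Sum>l\<in>S. 4 * \<bar>b i (p k)\<bar> ^ 3 + 4 * \<bar>b k l\<bar> ^ 3 + ?y i l)"
    by (intro sum_mono pt)
  also have "\<dots> = 4 * (n * (\<Sum>i\<in>S. \<Sum>k\<in>S. \<bar>b i (p k)\<bar> ^ 3)) + 4 * (n * T) + n * (\<Sum>i\<in>S. \<Sum>l\<in>S. ?y i l)"
    by (simp only: sum.distrib c sum_distrib_left[symmetric] T_def distrib_left)
  also have "(\<Sum>i\<in>S. \<Sum>k\<in>S. \<bar>b i (p k)\<bar> ^ 3) = T"
    unfolding T_def by (intro sum.cong refl sum_perm[OF p])
  also have "(\<Sum>i\<in>S. \<Sum>l\<in>S. ?y i l) = T + T + n * D3 p + n * D3 p"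
    by (simp only: sum.distrib sum_cubes[OF p] T_def[symmetric])
  finally show ?thesis by (simp add: distrib_left)
qed

lemma mean_D3: "n * perm_mean S D3 = T"
  unfolding D3_def perm_mean_sum sum_distrib_left T_def n_def
  by (intro sum.cong refl perm_mean_at[OF fin, of _ "\<lambda>l. \<bar>b _ l\<bar> ^ 3"])

lemma mean_D2: "n * perm_mean S D2 = V"
  unfolding D2_def perm_mean_sum sum_distrib_left V_def n_def
  by (intro sum.cong refl perm_mean_at[OF fin, of _ "\<lambda>l. (b _ l)\<^sup>2"])

text \<open>The products with the two old entries vanish, one by the row sums and the other by the
  column sums; this is where double centring is used. Besides the variance there remains an
  interaction between pairs of rows.\<close>

lemma sum_b_Delta:
  assumes p: "p permutes S"
  shows "(\<Sum>i\<in>S. \<Sum>l\<in>S. b i l * \<Delta> p i l) = V + (\<Sum>i\<in>S. \<Sum>k\<in>S. b i (p k) * b k (p i))"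
proof -
  have 1: "(\<Sum>i\<in>S. \<Sum>l\<in>S. b i l * b (inv p l) (p i)) = (\<Sum>i\<in>S. \<Sum>k\<in>S. b i (p k) * b k (p i))"
  proof (rule sum.cong[OF refl])
    fix i show "(\<Sum>l\<in>S. b i l * b (inv p l) (p i)) = (\<Sum>k\<in>S. b i (p k) * b k (p i))"
      using sum_inv[OF p, of "\<lambda>k l. b i l * b k (p i)"] .
  qed
  have 2: "(\<Sum>i\<in>S. \<Sum>l\<in>S. b i l * b i (p i)) = 0"
    using rows by (simp add: sum_distrib_right[symmetric])
  have "(\<Sum>i\<in>S. \<Sum>l\<in>S. b i l * b (inv p l) l) = (\<Sum>l\<in>S. \<Sum>i\<in>S. b i l * b (inv p l) l)" by (rule sum.swap)
  also have "\<dots> = 0" using cols by (simp add: sum_distrib_right[symmetric])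
  finally have 3: "(\<Sum>i\<in>S. \<Sum>l\<in>S. b i l * b (inv p l) l) = 0" .
  show ?thesis
    by (simp add: \<Delta>_def algebra_simps sum.distrib sum_subtractf 1 2 3 V_def power2_eq_square)
qed

abbreviation e :: "real \<Rightarrow> real \<Rightarrow> complex" where "e t x \<equiv> iexp (t * x)"

lemma norm_e: "norm (e t x) = 1" by (simp add: norm_exp_i_times)

lemma norm_e_diff: "norm (e t (x + y) - e t x) \<le> \<bar>t\<bar> * \<bar>y\<bar>"
proof -
  have "e t (x + y) - e t x = e t x * (iexp (t * y) - 1)"
    by (simp add: algebra_simps exp_add)
  then have "norm (e t (x + y) - e t x) = norm (iexp (t * y) - 1)"
    by (simp add: norm_mult norm_e)
  also have "\<dots> \<le> \<bar>t * y\<bar>" using iexp_approx1[of "t * y" 0] by simp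
  finally show ?thesis by (simp add: abs_mult)
qed

lemma norm_e_diff2: "norm (e t (x + y) - e t x - \<i> * t * y * e t x) \<le> t\<^sup>2 * y\<^sup>2 / 2"
proof -
  have "e t (x + y) - e t x - \<i> * t * y * e t x = e t x * (iexp (t * y) - (1 + \<i> * (t * y)))"
    by (simp add: algebra_simps exp_add)
  then have "norm (e t (x + y) - e t x - \<i> * t * y * e t x) = norm (iexp (t * y) - (1 + \<i> * (t * y)))"
    by (simp add: norm_mult norm_e)
  also have "\<dots> \<le> \<bar>t * y\<bar>\<^sup>2 / 2" using iexp_approx1[of "t * y" 1] by (simp add: power2_eq_square)
  finally show ?thesis by (simp add: power_mult_distrib)
qed

text \<open>Resampling \<open>p i\<close> turns \<open>b k (p i)\<close> into \<open>b k l\<close>,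
  whose sum over \<open>l\<close> is zero. What survives is the change of the exponential, of third
  order in the entries, and the coincidences, which are of second order but gain a factor
  \<open>1 / n\<close>.\<close>

lemma norm_perm_mean_interaction_le:
  "norm (perm_mean S (\<lambda>p. (\<Sum>i\<in>S. \<Sum>k\<in>S. b i (p k) * b k (p i)) * e t (W p)))
    \<le> 3 * V / n + 12 * \<bar>t\<bar> * T"
proof -
  define G where "G i k p = complex_of_real (b i (p k) * b k (p i)) * e t (W p)" for i k p
  \<comment> \<open>The three parts pay for the diagonal \<open>i = k\<close>, for the change of the
    exponential under resampling, and for the exceptional value \<open>l = p k\<close>.\<close>
  define H where "H i k p = (if i = k then n * (b i (p i))\<^sup>2 else 0)
      + \<bar>t\<bar> * (\<Sum>l\<in>S. \<bar>b i (p k)\<bar> * \<bar>b k l\<bar> * \<bar>\<Delta> p i l\<bar>)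
      + \<bar>b k (p k)\<bar> * (\<bar>b i (p i)\<bar> + \<bar>b i (p k)\<bar>)" for i k p
  have G: "norm (n *\<^sub>R perm_mean S (G i k)) \<le> perm_mean S (H i k)" if ik: "i \<in> S" "k \<in> S" for i k
  proof (cases "i = k")
    case True
    have "norm (n *\<^sub>R perm_mean S (G i k)) = norm (perm_mean S (\<lambda>p. n *\<^sub>R G i k p))"
      by (simp only: perm_mean_scaleR)
    also have "\<dots> \<le> perm_mean S (H i k)"
    proof (rule norm_perm_mean_le')
      fix p
      have "norm (n *\<^sub>R G i k p) = n * (b i (p i))\<^sup>2"
        using n_pos by (simp add: G_def True norm_mult norm_e power2_eq_square abs_mult)
      also have "\<dots> \<le> H i k p"
        using True by (simp add: H_def sum_nonneg)
      finally show "norm (n *\<^sub>R G i k p) \<le> H i k p" .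
    qed
    finally show ?thesis .
  next
    case False
    \<comment> \<open>The subtracted term is frozen at the old permutation; summed over
      \<open>l\<close> it is a multiple of a row sum and so costs nothing.\<close>
    define R where "R p l = complex_of_real (b i (resample p i l k) * b k l) * e t (W (resample p i l))
        - complex_of_real (b i (p k) * b k l) * e t (W p)" for p l
    have R0: "(\<Sum>l\<in>S. complex_of_real (b i (p k) * b k l) * e t (W p)) = 0" for p
    proof -
      have "(\<Sum>l\<in>S. complex_of_real (b i (p k) * b k l) * e t (W p))
          = complex_of_real (b i (p k) * (\<Sum>l\<in>S. b k l)) * e t (W p)"
        by (simp only: sum_distrib_left of_real_sum sum_distrib_right)
      then show ?thesis using rows ik by simp
    qed
    have "n *\<^sub>R perm_mean S (G i k) = perm_mean S (\<lambda>p. \<Sum>l\<in>S. G i k (resample p i l))"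
      unfolding n_def using perm_mean_resample[OF fin ik(1), of "G i k"] by simp
    also have "\<dots> = perm_mean S (\<lambda>p. \<Sum>l\<in>S. R p l)"
      by (simp only: R_def sum_subtractf R0 G_def resample_at diff_0_right)
    finally have "norm (n *\<^sub>R perm_mean S (G i k)) = norm (perm_mean S (\<lambda>p. \<Sum>l\<in>S. R p l))" by simp
    also have "\<dots> \<le> perm_mean S (H i k)"
    proof (rule norm_perm_mean_le')
      fix p assume p: "p permutes S"
      have "norm (R p l) \<le> \<bar>t\<bar> * (\<bar>b i (p k)\<bar> * \<bar>b k l\<bar> * \<bar>\<Delta> p i l\<bar>)
          + (if l = p k then \<bar>b k (p k)\<bar> * (\<bar>b i (p i)\<bar> + \<bar>b i (p k)\<bar>) else 0)" if l: "l \<in> S" for l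
      proof (cases "l = p k")
        \<comment> \<open>For \<open>l = p k\<close> resampling also moves the value at
          \<open>k\<close>, which becomes \<open>p i\<close>; the first factor is then no longer
          frozen, and the two terms are bounded separately.\<close>
        case True
        have "norm (R p l) \<le> \<bar>b i (p i) * b k (p k)\<bar> + \<bar>b i (p k) * b k (p k)\<bar>"
          unfolding R_def using True
          by (intro order_trans[OF norm_triangle_ineq4] add_mono)
             (simp_all add: norm_mult norm_e resample_hit)
        also have "\<dots> \<le> \<bar>t\<bar> * (\<bar>b i (p k)\<bar> * \<bar>b k l\<bar> * \<bar>\<Delta> p i l\<bar>)
            + \<bar>b k (p k)\<bar> * (\<bar>b i (p i)\<bar> + \<bar>b i (p k)\<bar>)"
          by (simp add: abs_mult algebra_simps)
        finally show ?thesis using True by simp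
      next
        case ne: False
        have "p k \<noteq> p i" using False permutes_inj[OF p] by (auto dest: injD)
        then have "resample p i l k = p k" using ne by (intro resample_other) auto
        then have "R p l = complex_of_real (b i (p k) * b k l) * (e t (W p + \<Delta> p i l) - e t (W p))"
          unfolding R_def W_resample[OF p ik(1) l] by (simp only: right_diff_distrib)
        then have "norm (R p l) = \<bar>b i (p k) * b k l\<bar> * norm (e t (W p + \<Delta> p i l) - e t (W p))"
          by (simp only: norm_mult norm_of_real)
        also have "\<dots> \<le> \<bar>b i (p k) * b k l\<bar> * (\<bar>t\<bar> * \<bar>\<Delta> p i l\<bar>)"
          by (intro mult_left_mono norm_e_diff) auto
        finally show ?thesis using ne by (simp add: abs_mult mult_ac)
      qed
      then have "norm (\<Sum>l\<in>S. R p l) \<le> (\<Sum>l\<in>S. \<bar>t\<bar> * (\<bar>b i (p k)\<bar> * \<bar>b k l\<bar> * \<bar>\<Delta> p i l\<bar>)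
          + (if l = p k then \<bar>b k (p k)\<bar> * (\<bar>b i (p i)\<bar> + \<bar>b i (p k)\<bar>) else 0))"
        by (rule sum_norm_le)
      also have "\<dots> = \<bar>t\<bar> * (\<Sum>l\<in>S. \<bar>b i (p k)\<bar> * \<bar>b k l\<bar> * \<bar>\<Delta> p i l\<bar>)
          + \<bar>b k (p k)\<bar> * (\<bar>b i (p i)\<bar> + \<bar>b i (p k)\<bar>)"
        using permutes_in_image[OF p, of k] ik fin by (simp add: sum.distrib sum_distrib_left)
      finally show "norm (\<Sum>l\<in>S. R p l) \<le> H i k p" using False by (simp add: H_def)
    qed
    finally show ?thesis .
  qed
  have HH: "(\<Sum>i\<in>S. \<Sum>k\<in>S. H i k p) \<le> 5 / 2 * (n * D2 p) + V / 2 + \<bar>t\<bar> * (10 * (n * T) + 2 * (n * (n * D3 p)))"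
    if p: "p permutes S" for p
  proof -
    have 1: "(\<Sum>i\<in>S. \<Sum>k\<in>S. if i = k then n * (b i (p i))\<^sup>2 else 0) = n * D2 p"
      using fin by (simp add: D2_def sum_distrib_left)
    have c: "(\<Sum>l\<in>S. x) = n * x" for x by (simp add: n_def)
    have "(\<Sum>i\<in>S. \<Sum>k\<in>S. \<bar>b k (p k)\<bar> * (\<bar>b i (p i)\<bar> + \<bar>b i (p k)\<bar>))
        \<le> (\<Sum>i\<in>S. \<Sum>k\<in>S. (b k (p k))\<^sup>2 + (b i (p i))\<^sup>2 / 2 + (b i (p k))\<^sup>2 / 2)"
    proof (intro sum_mono)
      fix i k
      have "x * (y + z) \<le> x\<^sup>2 + y\<^sup>2 / 2 + z\<^sup>2 / 2" for x y z :: real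
        using sum_squares_bound[of x y] sum_squares_bound[of x z] by (simp add: distrib_left)
      from this[of "\<bar>b k (p k)\<bar>" "\<bar>b i (p i)\<bar>" "\<bar>b i (p k)\<bar>"]
      show "\<bar>b k (p k)\<bar> * (\<bar>b i (p i)\<bar> + \<bar>b i (p k)\<bar>) \<le> (b k (p k))\<^sup>2 + (b i (p i))\<^sup>2 / 2 + (b i (p k))\<^sup>2 / 2"
        by simp
    qed
    also have "\<dots> = n * D2 p + n * D2 p / 2 + (\<Sum>i\<in>S. \<Sum>k\<in>S. (b i (p k))\<^sup>2) / 2"
      by (simp only: sum.distrib c sum_distrib_left[symmetric] sum_divide_distrib[symmetric] D2_def times_divide_eq_right)
    also have "(\<Sum>i\<in>S. \<Sum>k\<in>S. (b i (p k))\<^sup>2) = V"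
      unfolding V_def by (intro sum.cong refl sum_perm[OF p])
    finally have 2: "(\<Sum>i\<in>S. \<Sum>k\<in>S. \<bar>b k (p k)\<bar> * (\<bar>b i (p i)\<bar> + \<bar>b i (p k)\<bar>)) \<le> n * D2 p + n * D2 p / 2 + V / 2" .
    have "(\<Sum>i\<in>S. \<Sum>k\<in>S. H i k p) = n * D2 p + \<bar>t\<bar> * (\<Sum>i\<in>S. \<Sum>k\<in>S. \<Sum>l\<in>S. \<bar>b i (p k)\<bar> * \<bar>b k l\<bar> * \<bar>\<Delta> p i l\<bar>)
        + (\<Sum>i\<in>S. \<Sum>k\<in>S. \<bar>b k (p k)\<bar> * (\<bar>b i (p i)\<bar> + \<bar>b i (p k)\<bar>))"
      unfolding H_def by (simp only: sum.distrib 1 sum_distrib_left[symmetric])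
    also have "\<dots> \<le> n * D2 p + \<bar>t\<bar> * (10 * (n * T) + 2 * (n * (n * D3 p))) + (n * D2 p + n * D2 p / 2 + V / 2)"
      by (rule add_mono[OF add_mono[OF order_refl mult_left_mono[OF sum_cross_le[OF p]]] 2]) simp
    finally show ?thesis by simp
  qed
  let ?Q = "perm_mean S (\<lambda>p. (\<Sum>i\<in>S. \<Sum>k\<in>S. b i (p k) * b k (p i)) * e t (W p))"
  have eq: "n *\<^sub>R ?Q = (\<Sum>i\<in>S. \<Sum>k\<in>S. n *\<^sub>R perm_mean S (G i k))"
    unfolding scaleR_sum_right[symmetric] perm_mean_sum[symmetric] G_def
    by (simp add: sum_distrib_right)
  have "n * norm ?Q = norm (n *\<^sub>R ?Q)" using n_pos by simp
  also have "\<dots> = norm (\<Sum>i\<in>S. \<Sum>k\<in>S. n *\<^sub>R perm_mean S (G i k))"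
    by (simp only: eq)
  also have "\<dots> \<le> (\<Sum>i\<in>S. \<Sum>k\<in>S. perm_mean S (H i k))"
    by (intro sum_norm_le G)
  also have "\<dots> = perm_mean S (\<lambda>p. \<Sum>i\<in>S. \<Sum>k\<in>S. H i k p)"
    by (simp only: perm_mean_sum)
  also have "\<dots> \<le> perm_mean S (\<lambda>p. 5 / 2 * (n * D2 p) + V / 2 + \<bar>t\<bar> * (10 * (n * T) + 2 * (n * (n * D3 p))))"
    by (intro perm_mean_mono HH)
  also have "\<dots> = 5 / 2 * (n * perm_mean S D2) + V / 2 + \<bar>t\<bar> * (10 * (n * T) + 2 * (n * (n * perm_mean S D3)))"
    by (simp only: perm_mean_add perm_mean_mult perm_mean_const[OF fin])
  also have "\<dots> = n * (3 * V / n + 12 * \<bar>t\<bar> * T)"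
    unfolding mean_D2 mean_D3 using n_pos by (simp add: field_simps)
  finally show ?thesis using n_pos by (subst (asm) mult_le_cancel_left_pos) auto
qed

text \<open>Each summand \<open>b i (p i)\<close> of \<open>W\<close> is resampled at its own row.
  The row sum removes the constant term of the Taylor expansion of the exponential,
  \<open>sum_b_Delta\<close> evaluates the linear term, and the quadratic remainder is paid by third
  moments. The remainder gives 16 and the interaction 12 of the constant 28.\<close>

lemma stein_identity:
  "norm (perm_mean S (\<lambda>p. W p * e t (W p)) - \<i> * t * (V / n) * perm_mean S (\<lambda>p. e t (W p)))
    \<le> 28 * t\<^sup>2 * (T / n) + 3 * \<bar>t\<bar> * (V / n) / n"
proof -
  define E where "E = perm_mean S (\<lambda>p. e t (W p))"
  define EW where "EW = perm_mean S (\<lambda>p. W p * e t (W p))"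
  define Q where "Q p = (\<Sum>i\<in>S. \<Sum>k\<in>S. b i (p k) * b k (p i))" for p
  define R where "R p i l = e t (W p + \<Delta> p i l) - e t (W p) - \<i> * t * \<Delta> p i l * e t (W p)" for p i l
  have "n *\<^sub>R EW = (\<Sum>i\<in>S. n *\<^sub>R perm_mean S (\<lambda>p. complex_of_real (b i (p i)) * e t (W p)))"
    unfolding EW_def scaleR_sum_right[symmetric] perm_mean_sum[symmetric]
    by (simp add: W_def sum_distrib_right)
  also have "\<dots> = (\<Sum>i\<in>S. perm_mean S (\<lambda>p. \<Sum>l\<in>S. complex_of_real (b i l) * (e t (W p + \<Delta> p i l) - e t (W p))))"
  proof (rule sum.cong[OF refl])
    fix i assume i: "i \<in> S"
    have "n *\<^sub>R perm_mean S (\<lambda>p. complex_of_real (b i (p i)) * e t (W p))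
       = perm_mean S (\<lambda>p. \<Sum>l\<in>S. complex_of_real (b i l) * e t (W (resample p i l)))"
      unfolding n_def using perm_mean_resample[OF fin i, of "\<lambda>p. complex_of_real (b i (p i)) * e t (W p)"] by simp
    also have "\<dots> = perm_mean S (\<lambda>p. \<Sum>l\<in>S. complex_of_real (b i l) * (e t (W p + \<Delta> p i l) - e t (W p)))"
    proof (rule perm_mean_cong)
      fix p assume p: "p permutes S"
      have "(\<Sum>l\<in>S. complex_of_real (b i l) * e t (W p)) = complex_of_real (\<Sum>l\<in>S. b i l) * e t (W p)"
        by (simp only: sum_distrib_right of_real_sum)
      then have "(\<Sum>l\<in>S. complex_of_real (b i l) * e t (W p)) = 0" using rows[OF i] by simp
      then show "(\<Sum>l\<in>S. complex_of_real (b i l) * e t (W (resample p i l)))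
          = (\<Sum>l\<in>S. complex_of_real (b i l) * (e t (W p + \<Delta> p i l) - e t (W p)))"
        using W_resample[OF p i] by (simp add: right_diff_distrib sum_subtractf)
    qed
    finally show "n *\<^sub>R perm_mean S (\<lambda>p. complex_of_real (b i (p i)) * e t (W p))
       = perm_mean S (\<lambda>p. \<Sum>l\<in>S. complex_of_real (b i l) * (e t (W p + \<Delta> p i l) - e t (W p)))" .
  qed
  also have "\<dots> = perm_mean S (\<lambda>p. \<Sum>i\<in>S. \<Sum>l\<in>S. complex_of_real (b i l) * (e t (W p + \<Delta> p i l) - e t (W p)))"
    by (simp only: perm_mean_sum)
  also have "\<dots> = perm_mean S (\<lambda>p. (\<Sum>i\<in>S. \<Sum>l\<in>S. complex_of_real (b i l) * R p i l)
       + (\<i> * t * V * e t (W p) + \<i> * t * (Q p * e t (W p))))"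
  proof (rule perm_mean_cong)
    fix p assume p: "p permutes S"
    have "(\<Sum>i\<in>S. \<Sum>l\<in>S. complex_of_real (b i l) * (\<i> * t * \<Delta> p i l * e t (W p)))
        = complex_of_real (\<Sum>i\<in>S. \<Sum>l\<in>S. b i l * \<Delta> p i l) * (\<i> * t * e t (W p))"
      unfolding of_real_sum sum_distrib_right by (intro sum.cong refl) (simp add: mult_ac)
    also have "\<dots> = \<i> * t * V * e t (W p) + \<i> * t * (Q p * e t (W p))"
      unfolding sum_b_Delta[OF p] Q_def by (simp add: algebra_simps)
    finally show "(\<Sum>i\<in>S. \<Sum>l\<in>S. complex_of_real (b i l) * (e t (W p + \<Delta> p i l) - e t (W p)))
       = (\<Sum>i\<in>S. \<Sum>l\<in>S. complex_of_real (b i l) * R p i l) + (\<i> * t * V * e t (W p) + \<i> * t * (Q p * e t (W p)))"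
      unfolding R_def by (simp add: right_diff_distrib sum_subtractf)
  qed
  also have "\<dots> = perm_mean S (\<lambda>p. \<Sum>i\<in>S. \<Sum>l\<in>S. complex_of_real (b i l) * R p i l)
       + (\<i> * t * V * E + \<i> * t * perm_mean S (\<lambda>p. Q p * e t (W p)))"
    by (simp only: perm_mean_add perm_mean_mult E_def)
  finally have eq: "n *\<^sub>R EW - \<i> * t * V * E = perm_mean S (\<lambda>p. \<Sum>i\<in>S. \<Sum>l\<in>S. complex_of_real (b i l) * R p i l)
       + \<i> * t * perm_mean S (\<lambda>p. Q p * e t (W p))" by simp
  have "norm (perm_mean S (\<lambda>p. \<Sum>i\<in>S. \<Sum>l\<in>S. complex_of_real (b i l) * R p i l))
      \<le> perm_mean S (\<lambda>p. t\<^sup>2 / 2 * (24 * T + 8 * (n * D3 p)))"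
  proof (rule norm_perm_mean_le')
    fix p assume p: "p permutes S"
    have "norm (\<Sum>i\<in>S. \<Sum>l\<in>S. complex_of_real (b i l) * R p i l)
        \<le> (\<Sum>i\<in>S. \<Sum>l\<in>S. \<bar>b i l\<bar> * (t\<^sup>2 * (\<Delta> p i l)\<^sup>2 / 2))"
    proof (intro sum_norm_le)
      fix i l
      have "norm (complex_of_real (b i l) * R p i l) = \<bar>b i l\<bar> * norm (R p i l)" by (simp add: norm_mult)
      also have "\<dots> \<le> \<bar>b i l\<bar> * (t\<^sup>2 * (\<Delta> p i l)\<^sup>2 / 2)"
        unfolding R_def by (intro mult_left_mono norm_e_diff2) auto
      finally show "norm (complex_of_real (b i l) * R p i l) \<le> \<bar>b i l\<bar> * (t\<^sup>2 * (\<Delta> p i l)\<^sup>2 / 2)" .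
    qed
    also have "\<dots> = t\<^sup>2 / 2 * (\<Sum>i\<in>S. \<Sum>l\<in>S. \<bar>b i l\<bar> * (\<Delta> p i l)\<^sup>2)"
      by (simp add: sum_distrib_left mult_ac)
    also have "\<dots> \<le> t\<^sup>2 / 2 * (24 * T + 8 * (n * D3 p))"
      by (intro mult_left_mono sum_weighted_square_le[OF p]) auto
    finally show "norm (\<Sum>i\<in>S. \<Sum>l\<in>S. complex_of_real (b i l) * R p i l) \<le> \<dots>" .
  qed
  also have "\<dots> = t\<^sup>2 / 2 * (24 * T + 8 * (n * perm_mean S D3))"
    by (simp only: perm_mean_add perm_mean_mult perm_mean_const[OF fin])
  also have "\<dots> = 16 * t\<^sup>2 * T" unfolding mean_D3 by simp
  finally have 1: "norm (perm_mean S (\<lambda>p. \<Sum>i\<in>S. \<Sum>l\<in>S. complex_of_real (b i l) * R p i l)) \<le> 16 * t\<^sup>2 * T" .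
  have "norm (\<i> * t * perm_mean S (\<lambda>p. Q p * e t (W p))) \<le> \<bar>t\<bar> * (3 * V / n + 12 * \<bar>t\<bar> * T)"
    using norm_perm_mean_interaction_le[of t] by (simp add: norm_mult Q_def mult_left_mono)
  then have "norm (n *\<^sub>R EW - \<i> * t * V * E) \<le> 16 * t\<^sup>2 * T + \<bar>t\<bar> * (3 * V / n + 12 * \<bar>t\<bar> * T)"
    unfolding eq using 1 by (intro order_trans[OF norm_triangle_ineq] add_mono)
  also have "16 * t\<^sup>2 * T + \<bar>t\<bar> * (3 * V / n + 12 * \<bar>t\<bar> * T) = n * (28 * t\<^sup>2 * (T / n) + 3 * \<bar>t\<bar> * (V / n) / n)"
    using n_pos by (simp add: field_simps power2_eq_square)
  also have "n *\<^sub>R EW - \<i> * t * V * E = n *\<^sub>R (EW - \<i> * t * (V / n) * E)"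
    using n_pos by (simp add: scaleR_conv_of_real field_simps)
  also have "norm \<dots> = n * norm (EW - \<i> * t * (V / n) * E)"
    using n_pos by simp
  finally show ?thesis using n_pos unfolding E_def EW_def by (subst (asm) mult_le_cancel_left_pos) auto
qed

lemma perm_mean_has_field_derivative:
  fixes F :: "('b \<Rightarrow> 'b) \<Rightarrow> complex \<Rightarrow> complex"
  assumes "\<And>p. (F p has_field_derivative F' p) (at z within A)"
  shows "((\<lambda>z. perm_mean S' (\<lambda>p. F p z)) has_field_derivative perm_mean S' F') (at z within A)"
  unfolding perm_mean_def scaleR_conv_of_real by (intro DERIV_cmult DERIV_sum assms)

text \<open>After multiplication by \<open>exp (v * z\<^sup>2 / 2)\<close> the derivative of the
  characteristic function consists of the defect in \<open>stein_identity\<close> alone. The mean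
  value bound over the unit segment costs the factor \<open>exp (v / 2)\<close>, which is the value
  of the multiplier at 1 and cancels.\<close>

lemma char_fun_bound:
  "norm (perm_mean S (\<lambda>p. iexp (W p)) - exp (- (V / n) / 2)) \<le> 28 * (T / n) + 3 * (V / n) / n"
proof -
  define v where "v = V / n"
  define B where "B = 28 * (T / n) + 3 * v / n"
  define \<phi> where "\<phi> z = perm_mean S (\<lambda>p. exp (\<i> * z * W p)) * exp (v * z\<^sup>2 / 2)" for z :: complex
  define \<phi>' where "\<phi>' z = (perm_mean S (\<lambda>p. \<i> * W p * exp (\<i> * z * W p))
      + v * z * perm_mean S (\<lambda>p. exp (\<i> * z * W p))) * exp (v * z\<^sup>2 / 2)" for z :: complex
  have v0: "0 \<le> v" using n_pos V_nonneg by (simp add: v_def)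
  have B0: "0 \<le> T / n" "0 \<le> v / n" using n_pos T_nonneg v0 by auto
  have "norm (\<phi> 1 - \<phi> 0) \<le> B * exp (v / 2) * norm (1 - 0 :: complex)"
  proof (rule field_differentiable_bound[where S = "closed_segment 0 1" and f' = \<phi>'])
    fix z :: complex assume z: "z \<in> closed_segment 0 1"
    show "(\<phi> has_field_derivative \<phi>' z) (at z within closed_segment 0 1)"
    proof -
      have 1: "((\<lambda>z. perm_mean S (\<lambda>p. exp (\<i> * z * W p))) has_field_derivative
          perm_mean S (\<lambda>p. \<i> * W p * exp (\<i> * z * W p))) (at z within closed_segment 0 1)"
        by (rule perm_mean_has_field_derivative) (auto intro!: derivative_eq_intros)
      have 2: "((\<lambda>z. exp (v * z\<^sup>2 / 2)) has_field_derivative v * z * exp (v * z\<^sup>2 / 2))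
          (at z within closed_segment 0 1)"
        by (auto intro!: derivative_eq_intros)
      show ?thesis unfolding \<phi>_def \<phi>'_def using DERIV_mult[OF 1 2] by (simp add: algebra_simps)
    qed
    \<comment> \<open>Complex derivatives are taken because the values are complex, but on the
      segment the argument is a real \<open>t\<close> in the unit interval, where the Stein bound
      applies and is largest at \<open>t = 1\<close>.\<close>
    obtain t where t: "0 \<le> t" "t \<le> 1" "z = complex_of_real t"
      using z by (auto simp: in_segment scaleR_conv_of_real)
    have ez: "exp (\<i> * z * W p) = e t (W p)" for p by (simp add: t(3) mult_ac)
    have "perm_mean S (\<lambda>p. \<i> * W p * e t (W p)) = \<i> * perm_mean S (\<lambda>p. W p * e t (W p))"
      by (simp only: perm_mean_mult mult.assoc)
    then have "\<phi>' z = \<i> * (perm_mean S (\<lambda>p. W p * e t (W p)) - \<i> * t * v * perm_mean S (\<lambda>p. e t (W p)))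
        * exp (complex_of_real (v * t\<^sup>2 / 2))"
      unfolding \<phi>'_def ez by (simp add: t(3) algebra_simps)
    then have "norm (\<phi>' z) = norm (perm_mean S (\<lambda>p. W p * e t (W p)) - \<i> * t * v * perm_mean S (\<lambda>p. e t (W p)))
        * exp (v * t\<^sup>2 / 2)"
      by (simp only: norm_mult norm_exp_eq_Re Re_complex_of_real norm_ii)
    also have "\<dots> \<le> B * exp (v / 2)"
    proof (rule mult_mono)
      have "t\<^sup>2 \<le> 1" using t by (simp add: power_le_one)
      then have "28 * t\<^sup>2 * (T / n) + 3 * \<bar>t\<bar> * v / n \<le> 28 * 1 * (T / n) + 3 * 1 * (v / n)"
        using t B0 v0 n_pos unfolding times_divide_eq_right[symmetric]
        by (intro add_mono mult_right_mono mult_left_mono) auto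
      then show "norm (perm_mean S (\<lambda>p. W p * e t (W p)) - \<i> * t * v * perm_mean S (\<lambda>p. e t (W p))) \<le> B"
        using stein_identity[of t] by (simp add: B_def v_def)
      show "exp (v * t\<^sup>2 / 2) \<le> exp (v / 2)" using \<open>t\<^sup>2 \<le> 1\<close> v0 by (simp add: mult_left_le)
      show "0 \<le> B" using B0 by (simp add: B_def)
    qed simp
    finally show "norm (\<phi>' z) \<le> B * exp (v / 2)" .
  qed auto
  moreover have "\<phi> 0 = 1" by (simp add: \<phi>_def perm_mean_const[OF fin])
  moreover have "\<phi> 1 - 1 = (perm_mean S (\<lambda>p. iexp (W p)) - exp (- v / 2)) * exp (v / 2)"
    by (simp add: \<phi>_def left_diff_distrib exp_of_real[symmetric] mult_exp_exp)
  ultimately have "norm ((perm_mean S (\<lambda>p. iexp (W p)) - exp (- v / 2)) * exp (v / 2)) \<le> B * exp (v / 2)"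
    by simp
  then have "norm (perm_mean S (\<lambda>p. iexp (W p)) - exp (- v / 2)) * exp (v / 2) \<le> B * exp (v / 2)"
    by (simp add: norm_mult exp_of_real)
  then show ?thesis unfolding mult_le_cancel_right_pos[OF exp_gt_zero] B_def v_def by simp
qed

end

section \<open>From row-centred to doubly centred matrices\<close>

lemma abs_diff_power3_le: "\<bar>x - y\<bar> ^ 3 \<le> 4 * (\<bar>x\<bar> ^ 3 + \<bar>y\<bar> ^ 3)" for x y :: real
proof -
  have "\<bar>x - y\<bar> ^ 3 \<le> (\<bar>x\<bar> + \<bar>y\<bar>) ^ 3" by (intro power_mono) auto
  also have "\<dots> \<le> 4 * (\<bar>x\<bar> ^ 3 + \<bar>y\<bar> ^ 3)"
  proof -
    have "4 * (u ^ 3 + w ^ 3) - (u + w) ^ 3 = 3 * (u + w) * (u - w)\<^sup>2" for u w :: real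
      by (simp add: power3_eq_cube power2_eq_square algebra_simps)
    from this[of "\<bar>x\<bar>" "\<bar>y\<bar>"] have "0 \<le> 4 * (\<bar>x\<bar> ^ 3 + \<bar>y\<bar> ^ 3) - (\<bar>x\<bar> + \<bar>y\<bar>) ^ 3" by simp
    then show ?thesis by simp
  qed
  finally show ?thesis .
qed

lemma abs_mean_power3_le:
  fixes x :: "'a \<Rightarrow> real"
  assumes "finite S" "S \<noteq> {}"
  shows "\<bar>(\<Sum>i\<in>S. x i) / card S\<bar> ^ 3 \<le> (\<Sum>i\<in>S. \<bar>x i\<bar> ^ 3) / card S"
proof -
  have c: "0 < real (card S)" using assms by (simp add: card_gt_0_iff)
  have "(\<lambda>x. x ^ 3) (\<Sum>i\<in>S. (1 / card S) *\<^sub>R \<bar>x i\<bar>) \<le> (\<Sum>i\<in>S. (1 / card S) * (\<lambda>x. x ^ 3) \<bar>x i\<bar>)"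
    using assms c by (intro convex_on_sum[of S "{0..}"]) (auto intro: convex_power_odd)
  moreover have "\<bar>(\<Sum>i\<in>S. x i) / card S\<bar> ^ 3 \<le> (\<Sum>i\<in>S. (1 / card S) *\<^sub>R \<bar>x i\<bar>) ^ 3"
    using c by (intro power_mono) (auto simp: sum_divide_distrib[symmetric] divide_right_mono sum_abs)
  ultimately show ?thesis by (simp add: sum_divide_distrib)
qed

text \<open>Subtracting the column means does not change the sum along a permutation.\<close>

theorem combinatorial_clt_bound:
  fixes b :: "'a \<Rightarrow> 'a \<Rightarrow> real"
  assumes fin: "finite S" and ne: "S \<noteq> {}" and rows: "\<And>i. i \<in> S \<Longrightarrow> (\<Sum>l\<in>S. b i l) = 0"
  defines "v \<equiv> (\<Sum>i\<in>S. \<Sum>l\<in>S. (b i l)\<^sup>2) / card S - (\<Sum>l\<in>S. (\<Sum>i\<in>S. b i l)\<^sup>2) / (card S)\<^sup>2"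
  shows "0 \<le> v"
    and "norm (perm_mean S (\<lambda>p. iexp (\<Sum>i\<in>S. b i (p i))) - exp (- v / 2))
      \<le> 224 * ((\<Sum>i\<in>S. \<Sum>l\<in>S. \<bar>b i l\<bar> ^ 3) / card S) + 3 * v / card S"
proof -
  define m where "m l = (\<Sum>i\<in>S. b i l) / card S" for l
  define b' where "b' i l = b i l - m l" for i l
  have c: "0 < real (card S)" using fin ne by (simp add: card_gt_0_iff)
  have m0: "(\<Sum>l\<in>S. m l) = 0"
    unfolding m_def sum_divide_distrib[symmetric] using rows by (subst sum.swap) simp
  have mc: "(\<Sum>i\<in>S. b i l) = card S * m l" for l using c by (simp add: m_def)
  interpret centred_matrix S b'
    by unfold_locales (use fin ne rows m0 in \<open>auto simp: b'_def sum_subtractf mc\<close>)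
  have W: "W p = (\<Sum>i\<in>S. b i (p i))" if "p permutes S" for p
    unfolding W_def b'_def sum_subtractf using sum_perm[OF that, of m] m0 by simp
  have "V = (\<Sum>i\<in>S. \<Sum>l\<in>S. (b i l)\<^sup>2 - 2 * (m l * b i l) + (m l)\<^sup>2)"
    unfolding V_def b'_def by (simp add: power2_eq_square algebra_simps)
  also have "\<dots> = (\<Sum>i\<in>S. \<Sum>l\<in>S. (b i l)\<^sup>2) - 2 * (\<Sum>l\<in>S. \<Sum>i\<in>S. m l * b i l) + card S * (\<Sum>l\<in>S. (m l)\<^sup>2)"
    unfolding sum.distrib sum_subtractf sum_distrib_left[symmetric]
    by (subst (2) sum.swap) (simp add: sum_distrib_left)
  also have "(\<Sum>l\<in>S. \<Sum>i\<in>S. m l * b i l) = card S * (\<Sum>l\<in>S. (m l)\<^sup>2)"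
    unfolding sum_distrib_left[symmetric] mc by (simp add: sum_distrib_left power2_eq_square mult_ac)
  finally have "V = (\<Sum>i\<in>S. \<Sum>l\<in>S. (b i l)\<^sup>2) - card S * (\<Sum>l\<in>S. (m l)\<^sup>2)" by simp
  also have "card S * (\<Sum>l\<in>S. (m l)\<^sup>2) = (\<Sum>l\<in>S. (\<Sum>i\<in>S. b i l)\<^sup>2) / card S"
    using c by (simp add: m_def power_divide sum_divide_distrib[symmetric] power2_eq_square)
  finally have V: "V / n = v"
    using c by (simp add: v_def n_def diff_divide_distrib power2_eq_square)
  show "0 \<le> v" using V V_nonneg n_pos by (metis divide_nonneg_nonneg order_trans zero_le_one)
  \<comment> \<open>The cube of a difference costs 4, and by Jensen's inequality the cubes of the
    column means sum to no more than those of the entries; together 8, and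
    \<open>28 * 8 = 224\<close>.\<close>
  have "T \<le> (\<Sum>i\<in>S. \<Sum>l\<in>S. 4 * (\<bar>b i l\<bar> ^ 3 + \<bar>m l\<bar> ^ 3))"
    unfolding T_def b'_def by (intro sum_mono abs_diff_power3_le)
  also have "\<dots> = 4 * (\<Sum>i\<in>S. \<Sum>l\<in>S. \<bar>b i l\<bar> ^ 3) + 4 * (card S * (\<Sum>l\<in>S. \<bar>m l\<bar> ^ 3))"
    by (simp add: distrib_left sum.distrib sum_distrib_left mult.left_commute)
  also have "card S * (\<Sum>l\<in>S. \<bar>m l\<bar> ^ 3) \<le> card S * (\<Sum>l\<in>S. (\<Sum>i\<in>S. \<bar>b i l\<bar> ^ 3) / card S)"
    unfolding m_def by (intro mult_left_mono sum_mono abs_mean_power3_le fin ne) auto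
  also have "\<dots> = (\<Sum>i\<in>S. \<Sum>l\<in>S. \<bar>b i l\<bar> ^ 3)"
    using c by (subst sum.swap) (simp add: sum_divide_distrib[symmetric])
  finally have "T \<le> 8 * (\<Sum>i\<in>S. \<Sum>l\<in>S. \<bar>b i l\<bar> ^ 3)" by simp
  then have "T / n \<le> 8 * ((\<Sum>i\<in>S. \<Sum>l\<in>S. \<bar>b i l\<bar> ^ 3) / card S)"
    using c by (simp add: n_def divide_right_mono)
  then have "28 * (T / n) + 3 * v / n \<le> 224 * ((\<Sum>i\<in>S. \<Sum>l\<in>S. \<bar>b i l\<bar> ^ 3) / card S) + 3 * v / card S"
    by (simp add: n_def)
  moreover have "perm_mean S (\<lambda>p. iexp (W p)) = perm_mean S (\<lambda>p. iexp (\<Sum>i\<in>S. b i (p i)))"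
    by (rule perm_mean_cong) (simp add: W)
  ultimately show "norm (perm_mean S (\<lambda>p. iexp (\<Sum>i\<in>S. b i (p i))) - exp (- v / 2))
      \<le> 224 * ((\<Sum>i\<in>S. \<Sum>l\<in>S. \<bar>b i l\<bar> ^ 3) / card S) + 3 * v / card S"
    using char_fun_bound unfolding V by simp
qed

section \<open>Weak convergence from characteristic functions\<close>

lemma (in prob_space) integrable_bounded:
  fixes f :: "'a \<Rightarrow> real"
  assumes "f \<in> borel_measurable M" "\<And>x. \<bar>f x\<bar> \<le> B"
  shows "integrable M f"
  using assms by (intro integrable_const_bound[where B = B]) auto

definition linear_comb :: "'i set \<Rightarrow> ('i \<Rightarrow> real) \<Rightarrow> ('i \<Rightarrow> real) \<Rightarrow> real" where
  "linear_comb I \<theta> x = (\<Sum>i\<in>I. \<theta> i * x i)"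

text \<open>This changes the frequency at \<open>r\<close> by \<open>c\<close>. Splitting the
  coefficient into two conditionals treats \<open>r\<close> inside and outside \<open>I\<close>
  alike.\<close>

lemma linear_comb_shift:
  assumes "finite I"
  shows "linear_comb (insert r I) (\<lambda>i. (if i \<in> I then \<theta> i else 0) + (if i = r then c else 0)) x
    = linear_comb I \<theta> x + c * x r"
proof -
  have "(\<Sum>i\<in>insert r I. (if i \<in> I then \<theta> i else 0) * x i) = (\<Sum>i\<in>I. \<theta> i * x i)"
    using assms by (intro sum.mono_neutral_cong_right) auto
  moreover have "(\<Sum>i\<in>insert r I. (if i = r then c else 0) * x i) = c * x r"
    using assms by (simp add: if_distrib[of "\<lambda>y. y * _"] sum.delta cong: if_cong)
  ultimately show ?thesis by (simp add: linear_comb_def distrib_right sum.distrib)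
qed

lemma borel_measurable_coordinate [measurable]: "(\<lambda>x. x i) \<in> borel_measurable (borel :: ('i \<Rightarrow> real) measure)"
  by (intro borel_measurable_continuous_onI) simp

lemma borel_measurable_linear_comb [measurable]:
  "linear_comb I \<theta> \<in> borel_measurable (borel :: ('i \<Rightarrow> real) measure)"
  unfolding linear_comb_def by measurable

text \<open>Tychonoff's theorem, as the index type may be infinite.\<close>

lemma compact_cube: "compact {y :: 'i \<Rightarrow> real. \<forall>i. y i \<in> {-1..1}}"
proof -
  have "compactin (product_topology (\<lambda>_::'i. euclideanreal) UNIV) (PiE UNIV (\<lambda>_. {-1..1}))"
    by (simp add: compactin_PiE)
  moreover have "PiE UNIV (\<lambda>_. {-1..1}) = {y :: 'i \<Rightarrow> real. \<forall>i. y i \<in> {-1..1}}"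
    by (auto simp: PiE_def Pi_def)
  ultimately show ?thesis by (simp add: euclidean_product_topology)
qed

locale char_convergence =
  fixes M :: "nat \<Rightarrow> 'a measure" and X :: "nat \<Rightarrow> 'a \<Rightarrow> 'i::countable \<Rightarrow> real"
    and N :: "'b measure" and Z :: "'b \<Rightarrow> 'i \<Rightarrow> real"
  assumes prob_M: "\<And>n. prob_space (M n)" and prob_N: "prob_space N"
    and X [measurable]: "\<And>n. X n \<in> borel_measurable (M n)"
    and Z [measurable]: "Z \<in> borel_measurable N"
    and cos_lim: "\<And>I \<theta>. finite I \<Longrightarrow>
      (\<lambda>n. \<integral>\<omega>. cos (linear_comb I \<theta> (X n \<omega>)) \<partial>M n) \<longlonglongrightarrow> (\<integral>\<omega>. cos (linear_comb I \<theta> (Z \<omega>)) \<partial>N)"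
    and sin_lim: "\<And>I \<theta>. finite I \<Longrightarrow>
      (\<lambda>n. \<integral>\<omega>. sin (linear_comb I \<theta> (X n \<omega>)) \<partial>M n) \<longlonglongrightarrow> (\<integral>\<omega>. sin (linear_comb I \<theta> (Z \<omega>)) \<partial>N)"
begin

definition conv :: "(('i \<Rightarrow> real) \<Rightarrow> real) \<Rightarrow> bool" where
  "conv T \<longleftrightarrow> (\<lambda>n. \<integral>\<omega>. T (X n \<omega>) \<partial>M n) \<longlonglongrightarrow> (\<integral>\<omega>. T (Z \<omega>) \<partial>N)"

definition bdd :: "(('i \<Rightarrow> real) \<Rightarrow> real) \<Rightarrow> bool" where
  "bdd T \<longleftrightarrow> T \<in> borel_measurable borel \<and> (\<exists>B. \<forall>x. \<bar>T x\<bar> \<le> B)"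

lemma bdd_integrable:
  assumes "bdd T"
  shows "integrable (M n) (\<lambda>\<omega>. T (X n \<omega>))" "integrable N (\<lambda>\<omega>. T (Z \<omega>))"
proof -
  obtain B where [measurable]: "T \<in> borel_measurable borel" and B: "\<And>x. \<bar>T x\<bar> \<le> B"
    using assms by (auto simp: bdd_def)
  show "integrable (M n) (\<lambda>\<omega>. T (X n \<omega>))" "integrable N (\<lambda>\<omega>. T (Z \<omega>))"
    by (auto intro!: prob_space.integrable_bounded prob_M prob_N B)
qed

lemma bdd_add: "bdd T \<Longrightarrow> bdd T' \<Longrightarrow> bdd (\<lambda>x. T x + T' x)"
  unfolding bdd_def by (auto intro!: exI order_trans[OF abs_triangle_ineq] add_mono)

lemma bdd_mult: "bdd T \<Longrightarrow> bdd T' \<Longrightarrow> bdd (\<lambda>x. T x * T' x)"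
  unfolding bdd_def abs_mult
proof (safe, goal_cases)
  case (2 B B')
  have "\<bar>T x\<bar> * \<bar>T' x\<bar> \<le> B * B'" for x
    using 2 by (intro mult_mono) (auto intro: order_trans[OF abs_ge_zero])
  then show ?case by blast
qed auto

lemma bdd_const: "bdd (\<lambda>x. c)"
  unfolding bdd_def by auto

lemma bdd_trig: "bdd (\<lambda>x. cos (linear_comb I \<theta> x))" "bdd (\<lambda>x. sin (linear_comb I \<theta> x))"
  unfolding bdd_def by (auto intro!: exI[of _ 1])

lemma bdd_sin_coordinate: "bdd (\<lambda>x. sin (c * x r))"
  unfolding bdd_def by (auto intro!: exI[of _ 1])

lemma conv_add: "conv T \<Longrightarrow> conv T' \<Longrightarrow> bdd T \<Longrightarrow> bdd T' \<Longrightarrow> conv (\<lambda>x. T x + T' x)"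
  unfolding conv_def by (simp add: bdd_integrable tendsto_add)

lemma conv_cmult: "conv T \<Longrightarrow> conv (\<lambda>x. c * T x)"
  unfolding conv_def by (simp add: tendsto_mult_left)

text \<open>Convergence under all trigonometric modulations is the notion that is stable under
  multiplication by \<open>sin (c * x r)\<close>.\<close>

definition mod_conv :: "(('i \<Rightarrow> real) \<Rightarrow> real) \<Rightarrow> bool" where
  "mod_conv T \<longleftrightarrow> bdd T \<and> (\<forall>I \<theta>. finite I \<longrightarrow>
     conv (\<lambda>x. T x * cos (linear_comb I \<theta> x)) \<and> conv (\<lambda>x. T x * sin (linear_comb I \<theta> x)))"

lemma mod_conv_const: "mod_conv (\<lambda>x. c)"
proof -
  have "conv (\<lambda>x. c * cos (linear_comb I \<theta> x))" "conv (\<lambda>x. c * sin (linear_comb I \<theta> x))" if "finite I" for I \<theta>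
    by (rule conv_cmult, simp add: conv_def cos_lim sin_lim that)+
  then show ?thesis by (simp add: mod_conv_def bdd_const)
qed

lemma mod_conv_cmult: "mod_conv T \<Longrightarrow> mod_conv (\<lambda>x. c * T x)"
  unfolding mod_conv_def by (auto simp: mult.assoc intro: conv_cmult bdd_mult bdd_const)

lemma mod_conv_add: "mod_conv T \<Longrightarrow> mod_conv T' \<Longrightarrow> mod_conv (\<lambda>x. T x + T' x)"
  unfolding mod_conv_def by (auto simp: distrib_right intro!: conv_add bdd_add bdd_mult bdd_trig)

text \<open>By the product formulas, a sine times a modulation is a difference of two modulations
  whose frequencies at \<open>r\<close> are shifted by \<open>c\<close> and
  \<open>- c\<close>.\<close>

lemma mod_conv_sin_coordinate:
  assumes T: "mod_conv T"
  shows "mod_conv (\<lambda>x. sin (c * x r) * T x)"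
  unfolding mod_conv_def
proof (intro conjI allI impI)
  show "bdd (\<lambda>x. sin (c * x r) * T x)"
    using T by (auto simp: mod_conv_def intro: bdd_mult bdd_sin_coordinate)
  fix I :: "'i set" and \<theta> :: "'i \<Rightarrow> real" assume I: "finite I"
  let ?I = "insert r I" and ?\<theta> = "\<lambda>d i. (if i \<in> I then \<theta> i else 0) + (if i = r then d else 0)"
  have Tc: "conv (\<lambda>x. a * (T x * cos (linear_comb ?I (?\<theta> d) x)))" "conv (\<lambda>x. a * (T x * sin (linear_comb ?I (?\<theta> d) x)))" for a d
    using T I by (auto simp: mod_conv_def intro: conv_cmult)
  have Tb: "bdd (\<lambda>x. a * (T x * cos (linear_comb ?I (?\<theta> d) x)))" "bdd (\<lambda>x. a * (T x * sin (linear_comb ?I (?\<theta> d) x)))" for a d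
    using T by (auto simp: mod_conv_def intro!: bdd_mult bdd_const bdd_trig)
  have s: "linear_comb ?I (?\<theta> d) x = linear_comb I \<theta> x + d * x r" for d x
    using linear_comb_shift[OF I] .
  have "conv (\<lambda>x. (1/2) * (T x * sin (linear_comb ?I (?\<theta> c) x)) + (-1/2) * (T x * sin (linear_comb ?I (?\<theta> (-c)) x)))"
    by (intro conv_add Tc Tb)
  also have "(\<lambda>x. (1/2) * (T x * sin (linear_comb ?I (?\<theta> c) x)) + (-1/2) * (T x * sin (linear_comb ?I (?\<theta> (-c)) x)))
      = (\<lambda>x. sin (c * x r) * T x * cos (linear_comb I \<theta> x))"
    unfolding s by (simp add: fun_eq_iff sin_add sin_diff algebra_simps)
  finally show "conv (\<lambda>x. sin (c * x r) * T x * cos (linear_comb I \<theta> x))" .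
  have "conv (\<lambda>x. (-1/2) * (T x * cos (linear_comb ?I (?\<theta> c) x)) + (1/2) * (T x * cos (linear_comb ?I (?\<theta> (-c)) x)))"
    by (intro conv_add Tc Tb)
  also have "(\<lambda>x. (-1/2) * (T x * cos (linear_comb ?I (?\<theta> c) x)) + (1/2) * (T x * cos (linear_comb ?I (?\<theta> (-c)) x)))
      = (\<lambda>x. sin (c * x r) * T x * sin (linear_comb I \<theta> x))"
    unfolding s by (simp add: fun_eq_iff cos_add cos_diff algebra_simps)
  finally show "conv (\<lambda>x. sin (c * x r) * T x * sin (linear_comb I \<theta> x))" .
qed

lemma mod_conv_imp_conv: "mod_conv T \<Longrightarrow> conv T"
  unfolding mod_conv_def by (auto dest: spec[of _ "{}"] simp: linear_comb_def)

text \<open>Replacing \<open>x\<close> by \<open>sin (x / R)\<close> makes a Stone-Weierstrass approximation on the cube globally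
  bounded by the bound of the test function.\<close>

lemma conv_bounded_continuous:
  assumes F: "finite F" and dep: "\<And>x y. (\<And>i. i \<in> F \<Longrightarrow> x i = y i) \<Longrightarrow> \<phi> x = \<phi> y"
    and cont: "continuous_on UNIV \<phi>" and B: "\<And>x. \<bar>\<phi> x\<bar> \<le> B"
    and X2: "\<And>n i. i \<in> F \<Longrightarrow> integrable (M n) (\<lambda>\<omega>. (X n \<omega> i)\<^sup>2) \<and> (\<integral>\<omega>. (X n \<omega> i)\<^sup>2 \<partial>M n) \<le> c"
    and Z2: "\<And>i. i \<in> F \<Longrightarrow> integrable N (\<lambda>\<omega>. (Z \<omega> i)\<^sup>2) \<and> (\<integral>\<omega>. (Z \<omega> i)\<^sup>2 \<partial>N) \<le> c"
  shows "conv \<phi>"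
proof -
  have B0: "0 \<le> B" using B[of "\<lambda>_. 0"] by simp
  have \<phi>b: "bdd \<phi>" using cont B by (auto simp: bdd_def intro: borel_measurable_continuous_onI)
  have approx: "\<exists>G. conv G \<and> (\<forall>n. \<bar>(\<integral>\<omega>. \<phi> (X n \<omega>) \<partial>M n) - (\<integral>\<omega>. G (X n \<omega>) \<partial>M n)\<bar> \<le> 2 * e)
      \<and> \<bar>(\<integral>\<omega>. \<phi> (Z \<omega>) \<partial>N) - (\<integral>\<omega>. G (Z \<omega>) \<partial>N)\<bar> \<le> 2 * e" if e: "0 < e" for e
  proof -
    \<comment> \<open>\<open>R\<close> is large enough for Chebyshev's inequality to make the
      contribution of points outside the box of radius \<open>R\<close> at most \<open>e\<close>;
      \<open>R \<ge> 1\<close> allows replacing \<open>R\<^sup>2\<close> by \<open>R\<close>. The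
      scale \<open>R'\<close> maps that box to angles of at most \<open>pi / 2\<close>, where
      \<open>arcsin\<close> inverts \<open>sin\<close>.\<close>
    define K0 where "K0 = (2 * B + e) * (real (card F) * \<bar>c\<bar>)"
    have K0: "0 \<le> K0" using B0 e by (simp add: K0_def)
    define R where "R = max 1 (K0 / e)"
    have R: "1 \<le> R" "K0 / e \<le> R" by (auto simp: R_def)
    define R' where "R' = 2 * R / pi"
    have R': "0 < R'" using R by (simp add: R'_def)
    define s where "s x = (\<lambda>i::'i. sin ((1 / R') * x i))" for x
    define K where "K = {y :: 'i \<Rightarrow> real. \<forall>i. y i \<in> {-1..1}}"
    define \<psi> where "\<psi> y = \<phi> (\<lambda>i. R' * arcsin (y i))" for y
    have sK: "s x \<in> K" for x by (simp add: s_def K_def)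
    \<comment> \<open>The predicate makes \<open>G\<close> act as a multiplier that preserves
      \<open>mod_conv\<close>. In this form closure under products is just composition, and
      separation of points comes from the coordinates.\<close>
    have "\<exists>G. (continuous_on K G \<and> (\<forall>T. mod_conv T \<longrightarrow> mod_conv (\<lambda>x. G (s x) * T x))) \<and> (\<forall>y\<in>K. \<bar>\<psi> y - G y\<bar> < e)"
    proof (rule Stone_Weierstrass_HOL[where P = "\<lambda>G. continuous_on K G \<and> (\<forall>T. mod_conv T \<longrightarrow> mod_conv (\<lambda>x. G (s x) * T x))"])
      show "compact K" unfolding K_def by (rule compact_cube)
      show "continuous_on K \<psi>" unfolding \<psi>_def
        by (intro continuous_on_compose2[OF cont] continuous_on_coordinatewise_then_product
              continuous_intros continuous_on_arcsin)
           (auto simp: K_def intro: continuous_on_subset[OF continuous_on_product_coordinates])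
      show "continuous_on K (\<lambda>x. d) \<and> (\<forall>T. mod_conv T \<longrightarrow> mod_conv (\<lambda>x. d * T x))" for d
        by (auto intro: mod_conv_cmult)
      show "\<exists>f. (continuous_on K f \<and> (\<forall>T. mod_conv T \<longrightarrow> mod_conv (\<lambda>x. f (s x) * T x))) \<and> f x \<noteq> f y"
        if xy: "x \<in> K \<and> y \<in> K \<and> x \<noteq> y" for x y
      proof -
        obtain i where "x i \<noteq> y i" using xy by auto
        moreover have "continuous_on K (\<lambda>x. x i)"
          by (rule continuous_on_subset[OF continuous_on_product_coordinates]) simp
        moreover have "mod_conv (\<lambda>x. s x i * T x)" if "mod_conv T" for T
          unfolding s_def using that by (rule mod_conv_sin_coordinate)
        ultimately show ?thesis by blast
      qed
      show "continuous_on K (\<lambda>x. f x + g x) \<and> (\<forall>T. mod_conv T \<longrightarrow> mod_conv (\<lambda>x. (f (s x) + g (s x)) * T x))"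
        if "(continuous_on K f \<and> (\<forall>T. mod_conv T \<longrightarrow> mod_conv (\<lambda>x. f (s x) * T x))) \<and>
            continuous_on K g \<and> (\<forall>T. mod_conv T \<longrightarrow> mod_conv (\<lambda>x. g (s x) * T x))" for f g
        using that by (auto simp: distrib_right intro!: mod_conv_add continuous_on_add)
      show "continuous_on K (\<lambda>x. f x * g x) \<and> (\<forall>T. mod_conv T \<longrightarrow> mod_conv (\<lambda>x. (f (s x) * g (s x)) * T x))"
        if "(continuous_on K f \<and> (\<forall>T. mod_conv T \<longrightarrow> mod_conv (\<lambda>x. f (s x) * T x))) \<and>
            continuous_on K g \<and> (\<forall>T. mod_conv T \<longrightarrow> mod_conv (\<lambda>x. g (s x) * T x))" for f g
        using that by (auto simp: mult.assoc intro!: continuous_on_mult)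
    qed (use e in auto)
    then obtain G where G: "\<And>T. mod_conv T \<Longrightarrow> mod_conv (\<lambda>x. G (s x) * T x)" and Ge: "\<And>y. y \<in> K \<Longrightarrow> \<bar>\<psi> y - G y\<bar> < e"
      by blast
    have Gm: "mod_conv (\<lambda>x. G (s x))" using G[OF mod_conv_const[of 1]] by simp
    have Gb: "bdd (\<lambda>x. G (s x))" using Gm by (simp add: mod_conv_def)
    have pt: "\<bar>\<phi> x - G (s x)\<bar> \<le> e + (2 * B + e) * (\<Sum>i\<in>F. (x i)\<^sup>2 / R\<^sup>2)" for x
    proof (cases "\<forall>i\<in>F. \<bar>x i\<bar> \<le> R")
      case True
      have "R' * arcsin (s x i) = x i" if "i \<in> F" for i
      proof -
        have "\<bar>x i\<bar> \<le> R' * (pi / 2)" using True that by (simp add: R'_def)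
        then have "- (pi / 2) \<le> 1 / R' * x i" "1 / R' * x i \<le> pi / 2" using R' by (auto simp: field_simps abs_le_iff)
        then show ?thesis using R' by (simp add: s_def arcsin_sin)
      qed
      then have "\<psi> (s x) = \<phi> x" unfolding \<psi>_def by (intro dep)
      then have "\<bar>\<phi> x - G (s x)\<bar> < e" using Ge[OF sK[of x]] by simp
      moreover have "0 \<le> (2 * B + e) * (\<Sum>i\<in>F. (x i)\<^sup>2 / R\<^sup>2)" using B0 e by (auto intro!: mult_nonneg_nonneg sum_nonneg)
      ultimately show ?thesis by linarith
    next
      case False
      then obtain i where i: "i \<in> F" "R < \<bar>x i\<bar>" by auto
      have "1 \<le> (x i)\<^sup>2 / R\<^sup>2"
        using i R power_mono[of R "\<bar>x i\<bar>" 2] by (simp add: le_divide_eq)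
      also have "\<dots> \<le> (\<Sum>i\<in>F. (x i)\<^sup>2 / R\<^sup>2)" using i F by (intro member_le_sum) auto
      finally have *: "(2 * B + e) * 1 \<le> (2 * B + e) * (\<Sum>i\<in>F. (x i)\<^sup>2 / R\<^sup>2)"
        using B0 e by (intro mult_left_mono) auto
      have "\<bar>G (s x)\<bar> \<le> B + e" using Ge[OF sK[of x]] B[of "\<lambda>i. R' * arcsin (s x i)"] by (simp add: \<psi>_def)
      then have "\<bar>\<phi> x - G (s x)\<bar> \<le> 2 * B + e" using B[of x] by linarith
      also have "\<dots> \<le> (2 * B + e) * (\<Sum>i\<in>F. (x i)\<^sup>2 / R\<^sup>2)" using * by simp
      finally show ?thesis using e by simp
    qed
    \<comment> \<open>Stated for an arbitrary probability space, so that it serves both the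
      converging sequence and the limit.\<close>
    have est: "\<bar>(\<integral>\<omega>. \<phi> (Y \<omega>) \<partial>Q) - (\<integral>\<omega>. G (s (Y \<omega>)) \<partial>Q)\<bar> \<le> 2 * e"
      if Q: "prob_space Q" and int: "integrable Q (\<lambda>\<omega>. \<phi> (Y \<omega>))" "integrable Q (\<lambda>\<omega>. G (s (Y \<omega>)))"
        and Y: "\<And>i. i \<in> F \<Longrightarrow> integrable Q (\<lambda>\<omega>. (Y \<omega> i)\<^sup>2) \<and> (\<integral>\<omega>. (Y \<omega> i)\<^sup>2 \<partial>Q) \<le> c"
      for Q :: "'c measure" and Y
    proof -
      interpret Q: prob_space Q by fact
      have "\<bar>(\<integral>\<omega>. \<phi> (Y \<omega>) \<partial>Q) - (\<integral>\<omega>. G (s (Y \<omega>)) \<partial>Q)\<bar> = \<bar>\<integral>\<omega>. \<phi> (Y \<omega>) - G (s (Y \<omega>)) \<partial>Q\<bar>"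
        using int by simp
      also have "\<dots> \<le> (\<integral>\<omega>. \<bar>\<phi> (Y \<omega>) - G (s (Y \<omega>))\<bar> \<partial>Q)" by (rule integral_abs_bound)
      also have "\<dots> \<le> (\<integral>\<omega>. e + (2 * B + e) * (\<Sum>i\<in>F. (Y \<omega> i)\<^sup>2 / R\<^sup>2) \<partial>Q)"
        using int Y by (intro integral_mono pt) auto
      also have "\<dots> = e + (2 * B + e) * (\<Sum>i\<in>F. (\<integral>\<omega>. (Y \<omega> i)\<^sup>2 \<partial>Q) / R\<^sup>2)"
        using Y by (simp add: Q.prob_space)
      also have "\<dots> \<le> e + (2 * B + e) * (\<Sum>i\<in>F. \<bar>c\<bar> / R\<^sup>2)"
      proof -
        have "(\<integral>\<omega>. (Y \<omega> i)\<^sup>2 \<partial>Q) \<le> \<bar>c\<bar>" if "i \<in> F" for i using Y[OF that] by linarith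
        then show ?thesis using B0 e by (intro add_left_mono mult_left_mono sum_mono divide_right_mono) auto
      qed
      also have "\<dots> = e + K0 / R\<^sup>2" by (simp add: K0_def)
      also have "K0 / R\<^sup>2 \<le> K0 / R"
        using R K0 by (intro divide_left_mono) (auto simp: power2_eq_square)
      also have "K0 / R \<le> e" using R e by (simp add: field_simps)
      finally show ?thesis by simp
    qed
    show ?thesis
      using est[OF prob_M bdd_integrable(1)[OF \<phi>b] bdd_integrable(1)[OF Gb] X2]
        est[OF prob_N bdd_integrable(2)[OF \<phi>b] bdd_integrable(2)[OF Gb] Z2] mod_conv_imp_conv[OF Gm]
      by (intro exI[of _ "\<lambda>x. G (s x)"]) auto
  qed
  show ?thesis unfolding conv_def
  proof (rule LIMSEQ_I)
    fix r :: real assume r: "0 < r"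
    obtain G where G: "conv G" "\<And>n. \<bar>(\<integral>\<omega>. \<phi> (X n \<omega>) \<partial>M n) - (\<integral>\<omega>. G (X n \<omega>) \<partial>M n)\<bar> \<le> 2 * (r / 6)"
      "\<bar>(\<integral>\<omega>. \<phi> (Z \<omega>) \<partial>N) - (\<integral>\<omega>. G (Z \<omega>) \<partial>N)\<bar> \<le> 2 * (r / 6)"
      using approx[of "r / 6"] r by auto
    obtain n0 where n0: "\<And>n. n \<ge> n0 \<Longrightarrow> \<bar>(\<integral>\<omega>. G (X n \<omega>) \<partial>M n) - (\<integral>\<omega>. G (Z \<omega>) \<partial>N)\<bar> < r / 3"
      using LIMSEQ_D[OF G(1)[unfolded conv_def], of "r / 3"] r by auto
    have "norm ((\<integral>\<omega>. \<phi> (X n \<omega>) \<partial>M n) - (\<integral>\<omega>. \<phi> (Z \<omega>) \<partial>N)) < r" if "n \<ge> n0" for n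
      using n0[OF that] G(2)[of n] G(3) unfolding real_norm_def by linarith
    then show "\<exists>no. \<forall>n\<ge>no. norm ((\<integral>\<omega>. \<phi> (X n \<omega>) \<partial>M n) - (\<integral>\<omega>. \<phi> (Z \<omega>) \<partial>N)) < r" by blast
  qed
qed

end

section \<open>Gaussian families with given covariance\<close>

definition psd_kernel :: "('i \<Rightarrow> 'i \<Rightarrow> real) \<Rightarrow> bool" where
  "psd_kernel K \<longleftrightarrow> (\<forall>i j. K i j = K j i) \<and>
     (\<forall>I c. finite I \<longrightarrow> 0 \<le> (\<Sum>i\<in>I. \<Sum>j\<in>I. c i * c j * K i j))"

text \<open>The Schur complement: the covariance that remains after regression on variable
  \<open>k\<close>. For \<open>K k k = 0\<close> the quotient is 0 by convention, which is right
  because column \<open>k\<close> then vanishes.\<close>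

definition schur_step :: "('i \<Rightarrow> 'i \<Rightarrow> real) \<Rightarrow> 'i \<Rightarrow> 'i \<Rightarrow> 'i \<Rightarrow> real" where
  "schur_step K k i j = K i j - K i k * K j k / K k k"

lemma psd_kernel_commute: "psd_kernel K \<Longrightarrow> K i j = K j i"
  by (simp add: psd_kernel_def)

lemma psd_kernel_nonneg: "psd_kernel K \<Longrightarrow> finite I \<Longrightarrow> 0 \<le> (\<Sum>i\<in>I. \<Sum>j\<in>I. c i * c j * K i j)"
  by (simp add: psd_kernel_def)

text \<open>The quadratic form at \<open>c\<close> plus \<open>\<beta>\<close> times the unit vector
  of \<open>k\<close>, where \<open>k\<close> may or may not lie in \<open>I\<close>. Choosing
  \<open>\<beta>\<close> in this quadratic polynomial gives the Cauchy-Schwarz inequality for the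
  kernel.\<close>

lemma psd_kernel_extend:
  assumes K: "psd_kernel K" and I: "finite I"
  shows "0 \<le> (\<Sum>i\<in>I. \<Sum>j\<in>I. c i * c j * K i j) + 2 * \<beta> * (\<Sum>i\<in>I. c i * K i k) + \<beta>\<^sup>2 * K k k"
proof -
  let ?J = "insert k I"
  define c1 where "c1 i = (if i \<in> I then c i else 0)" for i
  define c2 where "c2 i = (if i = k then \<beta> else 0)" for i
  have s1: "(\<Sum>i\<in>?J. c1 i * g i) = (\<Sum>i\<in>I. c i * g i)" for g
    using I by (intro sum.mono_neutral_cong_right) (auto simp: c1_def)
  have s2: "(\<Sum>i\<in>?J. c2 i * g i) = \<beta> * g k" for g
    using I by (simp add: c2_def if_distrib[of "\<lambda>y. y * _"] sum.delta cong: if_cong)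
  have "0 \<le> (\<Sum>i\<in>?J. \<Sum>j\<in>?J. (c1 i + c2 i) * (c1 j + c2 j) * K i j)"
    using K I by (auto simp: psd_kernel_def)
  also have "\<dots> = (\<Sum>i\<in>?J. (c1 i + c2 i) * (\<Sum>j\<in>?J. (c1 j + c2 j) * K i j))"
    by (simp add: sum_distrib_left mult.assoc)
  also have "\<dots> = (\<Sum>i\<in>I. c i * ((\<Sum>j\<in>I. c j * K i j) + \<beta> * K i k)) + \<beta> * ((\<Sum>j\<in>I. c j * K k j) + \<beta> * K k k)"
    by (simp only: distrib_right sum.distrib s1 s2)
  also have "(\<Sum>j\<in>I. c j * K k j) = (\<Sum>i\<in>I. c i * K i k)"
    using psd_kernel_commute[OF K] by metis
  also have "(\<Sum>i\<in>I. c i * ((\<Sum>j\<in>I. c j * K i j) + \<beta> * K i k)) + \<beta> * ((\<Sum>i\<in>I. c i * K i k) + \<beta> * K k k)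
      = (\<Sum>i\<in>I. \<Sum>j\<in>I. c i * c j * K i j) + 2 * \<beta> * (\<Sum>i\<in>I. c i * K i k) + \<beta>\<^sup>2 * K k k"
    by (simp add: algebra_simps sum.distrib sum_distrib_left power2_eq_square)
  finally show ?thesis .
qed

lemma psd_kernel_diag: "psd_kernel K \<Longrightarrow> 0 \<le> K k k"
  using psd_kernel_extend[of K "{}" _ 1 k] by simp

lemma psd_kernel_diag_zero:
  assumes K: "psd_kernel K" and k: "K k k = 0"
  shows "K i k = 0"
proof (rule ccontr)
  assume "K i k \<noteq> 0"
  then show False
    using psd_kernel_extend[OF K, of "{i}" "\<lambda>_. 1" "- (K i i + 1) / (2 * K i k)" k] k by (simp add: field_simps)
qed

lemma psd_kernel_schur_step:
  assumes K: "psd_kernel K"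
  shows "psd_kernel (schur_step K k)"
  unfolding psd_kernel_def
proof (intro conjI allI impI)
  show "schur_step K k i j = schur_step K k j i" for i j
    using psd_kernel_commute[OF K, of i j] by (simp add: schur_step_def mult.commute)
  fix I :: "'a set" and c :: "'a \<Rightarrow> real" assume I: "finite I"
  let ?Q = "\<Sum>i\<in>I. \<Sum>j\<in>I. c i * c j * K i j" and ?l = "\<Sum>i\<in>I. c i * K i k"
  have "(\<Sum>i\<in>I. \<Sum>j\<in>I. c i * c j * schur_step K k i j)
      = ?Q - (\<Sum>i\<in>I. \<Sum>j\<in>I. (c i * K i k) * (c j * K j k)) / K k k"
    by (simp add: schur_step_def right_diff_distrib sum_subtractf sum_divide_distrib mult_ac)
  also have "(\<Sum>i\<in>I. \<Sum>j\<in>I. (c i * K i k) * (c j * K j k)) = ?l * ?l"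
    by (simp add: sum_product)
  finally have eq: "(\<Sum>i\<in>I. \<Sum>j\<in>I. c i * c j * schur_step K k i j) = ?Q - ?l * ?l / K k k" .
  show "0 \<le> (\<Sum>i\<in>I. \<Sum>j\<in>I. c i * c j * schur_step K k i j)"
  proof (cases "K k k = 0")
    case True
    then show ?thesis using K I unfolding eq by (simp add: psd_kernel_def)
  next
    case False
    then show ?thesis
      using psd_kernel_extend[OF K I, of c "- ?l / K k k" k] unfolding eq
      by (simp add: power2_eq_square field_simps)
  qed
qed

text \<open>Variables are eliminated in the order 0, 1, 2, and so on; after \<open>m\<close>
  eliminations the rows below \<open>m\<close> are zero, so the remainder vanishes for
  \<open>i < m\<close>. A zero pivot produces a zero column of \<open>L\<close> through division by
  zero, in agreement with the zero column of the kernel.\<close>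

lemma psd_kernel_cholesky:
  fixes K :: "nat \<Rightarrow> nat \<Rightarrow> real"
  assumes K: "psd_kernel K"
  shows "\<exists>L. (\<forall>i k. i < k \<longrightarrow> L i k = 0) \<and> (\<forall>i j m. i < m \<longrightarrow> K i j = (\<Sum>k<m. L i k * L j k))"
proof -
  define Ks where "Ks = rec_nat K (\<lambda>k K. schur_step K k)"
  have Ks_0: "Ks 0 = K" and Ks_Suc: "Ks (Suc k) = schur_step (Ks k) k" for k by (simp_all add: Ks_def)
  have psd: "psd_kernel (Ks k)" for k
    by (induction k) (auto simp: Ks_0 Ks_Suc K psd_kernel_schur_step)
  have zero: "Ks k i j = 0" if "i < k" for i j k
    using that
  proof (induction k arbitrary: i j)
    case (Suc k)
    show ?case
    proof (cases "i < k")
      case True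
      then show ?thesis using Suc.IH by (simp add: Ks_Suc schur_step_def)
    next
      case False
      then have "i = k" using Suc.prems by simp
      then show ?thesis
        using psd_kernel_diag_zero[OF psd, of k k j] psd_kernel_commute[OF psd, of k k j]
        by (auto simp: Ks_Suc schur_step_def)
    qed
  qed simp
  define L where "L i k = Ks k i k / sqrt (Ks k k k)" for i k
  have L: "L i k * L j k = Ks k i k * Ks k j k / Ks k k k" for i j k
    using psd_kernel_diag[OF psd, of k k] by (simp add: L_def)
  have sum: "K i j = Ks m i j + (\<Sum>k<m. L i k * L j k)" for i j m
    by (induction m) (simp_all add: Ks_0 Ks_Suc schur_step_def L)
  show ?thesis
  proof (intro exI[of _ L] conjI allI impI)
    show "L i k = 0" if "i < k" for i k using zero[OF that] by (simp add: L_def)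
    show "K i j = (\<Sum>k<m. L i k * L j k)" if "i < m" for i j m
      using sum[of i j m] zero[OF that] by simp
  qed
qed

text \<open>The index set is the whole real line because the sample space asked for consists of
  functions on the reals; only the coordinates at natural numbers drive the process.\<close>

abbreviation white_noise :: "(real \<Rightarrow> real) measure" where
  "white_noise \<equiv> \<Pi>\<^sub>M _\<in>UNIV. std_normal_distribution"

lemma prob_space_std_normal: "prob_space std_normal_distribution"
  by (rule prob_space_normal_density) simp

lemma prob_space_white_noise: "prob_space white_noise"
  by (intro prob_space_PiM prob_space_std_normal)

lemma white_noise_coordinate [measurable]: "(\<lambda>\<omega>. \<omega> x) \<in> borel_measurable white_noise"
proof -
  have "(\<lambda>\<omega>. \<omega> x) \<in> measurable white_noise std_normal_distribution"
    by (rule measurable_component_singleton) simp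
  then show ?thesis by (simp add: measurable_def)
qed

lemma distr_white_noise_coordinate: "distr white_noise borel (\<lambda>\<omega>. \<omega> x) = std_normal_distribution"
proof -
  have "distr white_noise borel (\<lambda>\<omega>. \<omega> x) = distr white_noise std_normal_distribution (\<lambda>\<omega>. \<omega> x)"
    by (rule distr_cong) auto
  also have "\<dots> = std_normal_distribution"
    by (rule distr_PiM_component[where M = "\<lambda>_. std_normal_distribution"]) (auto intro: prob_space_std_normal)
  finally show ?thesis .
qed

lemma indep_white_noise:
  assumes "I \<noteq> {}"
  shows "prob_space.indep_vars white_noise (\<lambda>_. borel) (\<lambda>(k::nat) \<omega>. \<omega> (real k)) I"
proof -
  interpret prob_space white_noise by (rule prob_space_white_noise)
  have "distr white_noise (\<Pi>\<^sub>M i\<in>I. borel) (\<lambda>\<omega>. \<lambda>k\<in>I. \<omega> (real k))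
      = distr white_noise (\<Pi>\<^sub>M i\<in>I. std_normal_distribution) (\<lambda>\<omega>. \<lambda>k\<in>I. \<omega> (real k))"
    by (rule distr_cong) (auto intro!: sets_PiM_cong)
  also have "\<dots> = (\<Pi>\<^sub>M i\<in>I. std_normal_distribution)"
    by (rule distr_PiM_reindex[where M = "\<lambda>_. std_normal_distribution" and f = real])
       (auto intro: prob_space_std_normal inj_onI)
  finally show ?thesis
    using assms by (subst indep_vars_iff_distr_eq_PiM) (auto simp: distr_white_noise_coordinate)
qed

lemma char_white_noise:
  "(\<integral>\<omega>. iexp (\<Sum>k<m. c k * \<omega> (real k)) \<partial>white_noise) = exp (- (\<Sum>k<m. (c k)\<^sup>2) / 2)"
proof (cases "m = 0")
  \<comment> \<open>Treated separately because \<open>indep_white_noise\<close> is stated for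
    nonempty index sets.\<close>
  case True
  interpret prob_space white_noise by (rule prob_space_white_noise)
  show ?thesis using True prob_space by simp
next
  case False
  interpret prob_space white_noise by (rule prob_space_white_noise)
  have ind: "indep_vars (\<lambda>_. borel) (\<lambda>k \<omega>. c k * \<omega> (real k)) {..<m}"
    using indep_vars_compose2[OF indep_white_noise[of "{..<m}"], of "\<lambda>k x. c k * x" "\<lambda>_. borel"] False by auto
  have "(\<integral>\<omega>. iexp (\<Sum>k<m. c k * \<omega> (real k)) \<partial>white_noise)
      = char (distr white_noise borel (\<lambda>\<omega>. \<Sum>k<m. c k * \<omega> (real k))) 1"
    by (simp add: char_def integral_distr)
  also have "\<dots> = (\<Prod>k<m. char (distr white_noise borel (\<lambda>\<omega>. c k * \<omega> (real k))) 1)"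
    by (rule char_distr_sum[OF ind])
  also have "\<dots> = (\<Prod>k<m. complex_of_real (exp (- (c k)\<^sup>2 / 2)))"
  proof (rule prod.cong[OF refl])
    fix k
    have "char (distr white_noise borel (\<lambda>\<omega>. c k * \<omega> (real k))) 1 = char (distr white_noise borel (\<lambda>\<omega>. \<omega> (real k))) (c k)"
      by (simp add: char_def integral_distr)
    then show "char (distr white_noise borel (\<lambda>\<omega>. c k * \<omega> (real k))) 1 = complex_of_real (exp (- (c k)\<^sup>2 / 2))"
      by (simp add: distr_white_noise_coordinate char_std_normal_distribution)
  qed
  also have "\<dots> = complex_of_real (exp (- (\<Sum>k<m. (c k)\<^sup>2) / 2))"
    by (simp only: of_real_prod[symmetric] exp_sum[symmetric, OF finite_lessThan] sum_divide_distrib[symmetric] sum_negf)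
  finally show ?thesis .
qed

theorem gaussian_family_exists:
  fixes K :: "'i::countable \<Rightarrow> 'i \<Rightarrow> real"
  assumes K: "psd_kernel K"
  obtains Z :: "(real \<Rightarrow> real) \<Rightarrow> 'i \<Rightarrow> real"
  where "\<And>i. (\<lambda>\<omega>. Z \<omega> i) \<in> borel_measurable white_noise"
    and "\<And>I c. finite I \<Longrightarrow> (\<integral>\<omega>. iexp (\<Sum>i\<in>I. c i * Z \<omega> i) \<partial>white_noise)
        = exp (- (\<Sum>i\<in>I. \<Sum>j\<in>I. c i * c j * K i j) / 2)"
proof -
  \<comment> \<open>The kernel is carried to the natural numbers, where elimination has an order,
    and is zero outside the range of \<open>to_nat\<close>.\<close>
  define K' where "K' i j = (if i \<in> range (to_nat :: 'i \<Rightarrow> nat) \<and> j \<in> range (to_nat :: 'i \<Rightarrow> nat)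
      then K (from_nat i) (from_nat j) else 0)" for i j
  have "psd_kernel K'" unfolding psd_kernel_def
  proof (intro conjI allI impI)
    show "K' i j = K' j i" for i j
      using psd_kernel_commute[OF K] by (simp add: K'_def conj_commute)
    fix J :: "nat set" and c :: "nat \<Rightarrow> real" assume J: "finite J"
    let ?I = "to_nat -` J :: 'i set"
    have fI: "finite ?I" using J by (intro finite_vimageI) auto
    have "(\<Sum>i\<in>J. \<Sum>j\<in>J. c i * c j * K' i j) = (\<Sum>i\<in>J \<inter> range (to_nat :: 'i \<Rightarrow> nat). \<Sum>j\<in>J \<inter> range (to_nat :: 'i \<Rightarrow> nat). c i * c j * K' i j)"
    proof -
      have "(\<Sum>j\<in>J. c i * c j * K' i j) = (\<Sum>j\<in>J \<inter> range (to_nat :: 'i \<Rightarrow> nat). c i * c j * K' i j)" for i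
        using J by (intro sum.mono_neutral_right) (auto simp: K'_def)
      then have "(\<Sum>i\<in>J. \<Sum>j\<in>J. c i * c j * K' i j) = (\<Sum>i\<in>J. \<Sum>j\<in>J \<inter> range (to_nat :: 'i \<Rightarrow> nat). c i * c j * K' i j)" by simp
      also have "\<dots> = (\<Sum>i\<in>J \<inter> range (to_nat :: 'i \<Rightarrow> nat). \<Sum>j\<in>J \<inter> range (to_nat :: 'i \<Rightarrow> nat). c i * c j * K' i j)"
        using J by (intro sum.mono_neutral_right) (auto simp: K'_def)
      finally show ?thesis .
    qed
    also have "J \<inter> range (to_nat :: 'i \<Rightarrow> nat) = to_nat ` ?I" by auto
    also have "(\<Sum>i\<in>to_nat ` ?I. \<Sum>j\<in>to_nat ` ?I. c i * c j * K' i j)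
        = (\<Sum>i\<in>?I. \<Sum>j\<in>?I. c (to_nat i) * c (to_nat j) * K i j)"
    proof -
      have *: "(\<Sum>i\<in>to_nat ` ?I. g i) = (\<Sum>i\<in>?I. g (to_nat i))" for g :: "nat \<Rightarrow> real"
        by (subst sum.reindex) (auto simp: o_def)
      show ?thesis unfolding * by (simp add: K'_def)
    qed
    also have "\<dots> \<ge> 0" using psd_kernel_nonneg[OF K fI, of "\<lambda>i. c (to_nat i)"] .
    finally show "0 \<le> (\<Sum>i\<in>J. \<Sum>j\<in>J. c i * c j * K' i j)" .
  qed
  from psd_kernel_cholesky[OF this]
  obtain L where L0: "\<And>i k. i < k \<Longrightarrow> L i k = 0"
    and LK: "\<And>i j m. i < m \<Longrightarrow> K' i j = (\<Sum>k<m. L i k * L j k)" by auto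
  define Z where "Z \<omega> i = (\<Sum>k\<le>to_nat i. L (to_nat i) k * \<omega> (real k))" for \<omega> :: "real \<Rightarrow> real" and i :: 'i
  show ?thesis
  proof
    show "(\<lambda>\<omega>. Z \<omega> i) \<in> borel_measurable white_noise" for i unfolding Z_def by measurable
    fix I :: "'i set" and c :: "'i \<Rightarrow> real" assume I: "finite I"
    obtain m where m: "\<And>i. i \<in> I \<Longrightarrow> to_nat i < m"
      using I finite_nat_set_iff_bounded[of "to_nat ` I"] by auto
    have Z: "Z \<omega> i = (\<Sum>k<m. L (to_nat i) k * \<omega> (real k))" if "i \<in> I" for \<omega> i
      unfolding Z_def using m[OF that] L0 by (intro sum.mono_neutral_left) auto
    define d where "d k = (\<Sum>i\<in>I. c i * L (to_nat i) k)" for k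
    have "(\<Sum>i\<in>I. c i * Z \<omega> i) = (\<Sum>k<m. d k * \<omega> (real k))" for \<omega>
    proof -
      have "(\<Sum>i\<in>I. c i * Z \<omega> i) = (\<Sum>i\<in>I. \<Sum>k<m. c i * L (to_nat i) k * \<omega> (real k))"
        by (simp add: Z sum_distrib_left mult.assoc)
      also have "\<dots> = (\<Sum>k<m. \<Sum>i\<in>I. c i * L (to_nat i) k * \<omega> (real k))" by (rule sum.swap)
      finally show ?thesis by (simp add: d_def sum_distrib_right)
    qed
    then have "(\<integral>\<omega>. iexp (\<Sum>i\<in>I. c i * Z \<omega> i) \<partial>white_noise) = exp (- (\<Sum>k<m. (d k)\<^sup>2) / 2)"
      using char_white_noise[of d m] by simp
    also have "(\<Sum>k<m. (d k)\<^sup>2) = (\<Sum>k<m. \<Sum>i\<in>I. \<Sum>j\<in>I. c i * c j * (L (to_nat i) k * L (to_nat j) k))"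
      by (simp add: d_def power2_eq_square sum_product mult_ac)
    also have "\<dots> = (\<Sum>i\<in>I. \<Sum>j\<in>I. \<Sum>k<m. c i * c j * (L (to_nat i) k * L (to_nat j) k))"
      by (subst sum.swap, intro sum.cong refl, rule sum.swap)
    also have "\<dots> = (\<Sum>i\<in>I. \<Sum>j\<in>I. c i * c j * K i j)"
    proof (intro sum.cong refl)
      fix i j assume "i \<in> I"
      then have "K i j = (\<Sum>k<m. L (to_nat i) k * L (to_nat j) k)"
        using LK[of "to_nat i" m "to_nat j"] m by (simp add: K'_def)
      then show "(\<Sum>k<m. c i * c j * (L (to_nat i) k * L (to_nat j) k)) = c i * c j * K i j"
        by (simp add: sum_distrib_left)
    qed
    finally show "(\<integral>\<omega>. iexp (\<Sum>i\<in>I. c i * Z \<omega> i) \<partial>white_noise)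
        = exp (- (\<Sum>i\<in>I. \<Sum>j\<in>I. c i * c j * K i j) / 2)" by simp
  qed
qed

section \<open>Gaussian laws and moments read off from characteristic functions\<close>

lemma (in prob_space) standardise_from_char:
  assumes X [measurable]: "X \<in> borel_measurable M" and v: "0 < v"
    and ch: "\<And>t. (\<integral>\<omega>. iexp (t * X \<omega>) \<partial>M) = exp (- (v * t\<^sup>2) / 2)"
  shows "distr M borel (\<lambda>\<omega>. X \<omega> / sqrt v) = std_normal_distribution"
proof (rule Levy_uniqueness)
  show "real_distribution (distr M borel (\<lambda>\<omega>. X \<omega> / sqrt v))" by (rule real_distribution_distr) simp
  show "real_distribution std_normal_distribution" by (rule real_dist_normal_dist)
  show "char (distr M borel (\<lambda>\<omega>. X \<omega> / sqrt v)) = char std_normal_distribution"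
  proof
    fix t
    have "char (distr M borel (\<lambda>\<omega>. X \<omega> / sqrt v)) t = (\<integral>\<omega>. iexp (t / sqrt v * X \<omega>) \<partial>M)"
      by (simp add: char_def integral_distr)
    also have "\<dots> = exp (- (v * (t / sqrt v)\<^sup>2) / 2)" by (rule ch)
    also have "v * (t / sqrt v)\<^sup>2 = t\<^sup>2" using v by (simp add: power_divide)
    finally show "char (distr M borel (\<lambda>\<omega>. X \<omega> / sqrt v)) t = char std_normal_distribution t"
      by (simp add: char_std_normal_distribution)
  qed
qed

lemma (in prob_space) AE_zero_from_char:
  assumes X [measurable]: "X \<in> borel_measurable M"
    and ch: "\<And>t. (\<integral>\<omega>. iexp (t * X \<omega>) \<partial>M) = 1"
  shows "AE \<omega> in M. X \<omega> = 0"
proof -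
  have "distr M borel X = return borel 0"
  proof (rule Levy_uniqueness)
    show "real_distribution (distr M borel X)" by (rule real_distribution_distr) simp
    show "real_distribution (return borel 0)"
      by (auto simp: real_distribution_def real_distribution_axioms_def intro: prob_space_return)
    show "char (distr M borel X) = char (return borel 0)"
      using ch by (simp add: fun_eq_iff char_def integral_distr integral_return)
  qed
  then have "AE x in distr M borel X. x = 0" by (simp only:) (subst AE_return, auto)
  then show ?thesis by (subst (asm) AE_distr_iff) auto
qed

lemma (in prob_space) gaussian_moments_from_char:
  assumes X [measurable]: "X \<in> borel_measurable M" and v: "0 \<le> v"
    and ch: "\<And>t. (\<integral>\<omega>. iexp (t * X \<omega>) \<partial>M) = exp (- (v * t\<^sup>2) / 2)"
  shows "(\<integral>\<omega>. X \<omega> \<partial>M) = 0" "(\<integral>\<omega>. (X \<omega>)\<^sup>2 \<partial>M) = v" "(\<integral>\<omega>. (X \<omega>) ^ 4 \<partial>M) = 3 * v\<^sup>2"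
    "integrable M X" "integrable M (\<lambda>\<omega>. (X \<omega>) ^ k)"
proof -
  have *: "(\<integral>\<omega>. X \<omega> \<partial>M) = 0 \<and> (\<integral>\<omega>. (X \<omega>)\<^sup>2 \<partial>M) = v \<and> (\<integral>\<omega>. (X \<omega>) ^ 4 \<partial>M) = 3 * v\<^sup>2
    \<and> (\<forall>k. integrable M (\<lambda>\<omega>. (X \<omega>) ^ k))"
  proof (cases "v = 0")
    \<comment> \<open>The degenerate law: division by \<open>sqrt v\<close> is impossible, but the
      variable is almost surely zero.\<close>
    case True
    have AE: "AE \<omega> in M. X \<omega> = 0" using ch True by (intro AE_zero_from_char) auto
    have "(\<integral>\<omega>. (X \<omega>) ^ k \<partial>M) = (\<integral>\<omega>. 0 ^ k \<partial>M)" for k using AE by (intro integral_cong_AE) auto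
    from this[of 1] this[of 2] this[of 4]
    have "(\<integral>\<omega>. X \<omega> \<partial>M) = 0" "(\<integral>\<omega>. (X \<omega>)\<^sup>2 \<partial>M) = 0" "(\<integral>\<omega>. (X \<omega>) ^ 4 \<partial>M) = 0" by simp_all
    moreover have "integrable M (\<lambda>\<omega>. (X \<omega>) ^ k)" for k
      using AE by (subst integrable_cong_AE[where g = "\<lambda>_. 0 ^ k"]) auto
    ultimately show ?thesis using True by simp
  next
    case False
    then have v: "0 < v" using v by simp
    have d: "distr M borel (\<lambda>\<omega>. X \<omega> / sqrt v) = std_normal_distribution"
      by (rule standardise_from_char[OF X v ch])
    have i: "integrable M (\<lambda>\<omega>. (X \<omega> / sqrt v) ^ k)" for k
      using integrable_std_normal_distribution_moment[of k] unfolding d[symmetric]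
      by (subst (asm) integrable_distr_eq) auto
    have e: "(\<integral>\<omega>. (X \<omega> / sqrt v) ^ k \<partial>M) = (\<integral>x. x ^ k \<partial>std_normal_distribution)" for k
      unfolding d[symmetric] by (subst integral_distr) auto
    have X': "(X \<omega>) ^ k = sqrt v ^ k * (X \<omega> / sqrt v) ^ k" for \<omega> k using v by (simp add: power_divide)
    have "integrable M (\<lambda>\<omega>. (X \<omega>) ^ k)" for k unfolding X' using i by simp
    moreover have m: "(\<integral>\<omega>. (X \<omega>) ^ k \<partial>M) = sqrt v ^ k * (\<integral>x. x ^ k \<partial>std_normal_distribution)" for k
      unfolding X' using e[of k] by simp
    moreover have "(\<integral>\<omega>. (X \<omega>)\<^sup>2 \<partial>M) = v"
      using m[of 2] std_normal_distribution_even_moments(1)[of 1] v by (simp add: fact_numeral)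
    moreover have "(\<integral>\<omega>. (X \<omega>) ^ 4 \<partial>M) = 3 * v\<^sup>2"
    proof -
      have "sqrt v ^ 4 = v\<^sup>2" using v by (simp add: power4_eq_xxxx power2_eq_square)
      then show ?thesis using m[of 4] std_normal_distribution_even_moments(1)[of 2] by (simp add: fact_numeral)
    qed
    moreover have "(\<integral>\<omega>. X \<omega> \<partial>M) = 0"
      using m[of 1] integral_std_normal_distribution_moment_odd[of 1] by simp
    ultimately show ?thesis by blast
  qed
  show "(\<integral>\<omega>. X \<omega> \<partial>M) = 0" "(\<integral>\<omega>. (X \<omega>)\<^sup>2 \<partial>M) = v" "(\<integral>\<omega>. (X \<omega>) ^ 4 \<partial>M) = 3 * v\<^sup>2"
    "integrable M (\<lambda>\<omega>. (X \<omega>) ^ k)" using * by auto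
  have "integrable M (\<lambda>\<omega>. (X \<omega>) ^ 1)" using * by blast
  then show "integrable M X" by simp
qed

lemma (in prob_space) distributed_normal_from_char:
  assumes X [measurable]: "X \<in> borel_measurable M" and v: "0 < v"
    and ch: "\<And>t. (\<integral>\<omega>. iexp (t * X \<omega>) \<partial>M) = exp (- (v * t\<^sup>2) / 2)"
  shows "distributed M lborel X (\<lambda>x. ennreal (normal_density 0 (sqrt v) x))"
proof -
  have "distr M lborel (\<lambda>\<omega>. X \<omega> / sqrt v) = distr M borel (\<lambda>\<omega>. X \<omega> / sqrt v)"
    by (rule distr_cong) auto
  then have "distributed M lborel (\<lambda>\<omega>. (X \<omega> - 0) / sqrt v) (\<lambda>x. ennreal (std_normal_density x))"
    using standardise_from_char[OF X v ch] by (simp add: distributed_def)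
  then show ?thesis using normal_standard_normal_convert[of "sqrt v" X 0] v by simp
qed

section \<open>Limits of the partial sums\<close>

definition idx :: "nat \<Rightarrow> real \<Rightarrow> nat" where
  "idx n t = nat \<lfloor>real n * t\<rfloor>"

lemma idx_mono: "t \<le> u \<Longrightarrow> idx n t \<le> idx n u"
  unfolding idx_def by (intro nat_mono floor_mono mult_left_mono) auto

lemma idx_min: "idx n (min t u) = min (idx n t) (idx n u)"
  using idx_mono[of t u n] idx_mono[of u t n] by (auto simp: min_def not_le)

lemma idx_0 [simp]: "idx n 0 = 0" and idx_1 [simp]: "idx n 1 = n"
  by (simp_all add: idx_def)

lemma idx_le: "t \<le> 1 \<Longrightarrow> idx n t \<le> n"
  using idx_mono[of t 1 n] by simp

definition partial_sum :: "(nat \<Rightarrow> nat \<Rightarrow> real) \<Rightarrow> (nat \<Rightarrow> nat) \<Rightarrow> nat \<Rightarrow> real" where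
  "partial_sum b p k = (\<Sum>i=1..k. b i (p i))"

lemma partial_sum_diff:
  assumes "j \<le> k"
  shows "partial_sum b p k - partial_sum b p j = (\<Sum>i\<in>{j+1..k}. b i (p i))"
proof -
  have "{1..k} = {1..j} \<union> {j+1..k}" "{1..j} \<inter> {j+1..k} = {}" using assms by auto
  then show ?thesis unfolding partial_sum_def by (simp add: sum.union_disjoint)
qed

text \<open>\<open>b\<close> stands for the matrix already divided by its scale. \<open>F\<close>
  and \<open>G\<close> are indexed by numbers of rows instead of times, since the moment bounds
  speak of blocks of rows.\<close>

locale matrix_arrays =
  fixes b :: "nat \<Rightarrow> nat \<Rightarrow> nat \<Rightarrow> real" and f :: "real \<Rightarrow> real" and g :: "real \<Rightarrow> real \<Rightarrow> real"
    and F :: "nat \<Rightarrow> nat \<Rightarrow> real" and G :: "nat \<Rightarrow> nat \<Rightarrow> nat \<Rightarrow> real"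
  defines "F n k \<equiv> (\<Sum>i=1..k. \<Sum>l=1..n. (b n i l)\<^sup>2) / n"
    and "G n j k \<equiv> (\<Sum>l=1..n. (\<Sum>i=1..j. b n i l) * (\<Sum>i=1..k. b n i l)) / (real n)\<^sup>2"
  assumes rows: "\<And>n i. n \<ge> 2 \<Longrightarrow> i \<in> {1..n} \<Longrightarrow> (\<Sum>l=1..n. b n i l) = 0"
    and f_lim: "\<And>t. t \<in> {0..1} \<Longrightarrow> (\<lambda>n. F n (idx n t)) \<longlonglongrightarrow> f t"
    and g_lim: "\<And>t u. t \<in> {0..1} \<Longrightarrow> u \<in> {0..1} \<Longrightarrow> (\<lambda>n. G n (idx n t) (idx n u)) \<longlonglongrightarrow> g t u"
    and f_cont: "continuous_on {0..1} f"
    and lyapunov: "(\<lambda>n. (\<Sum>i=1..n. \<Sum>l=1..n. \<bar>b n i l\<bar> ^ 3) / n) \<longlonglongrightarrow> 0"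
begin

definition \<sigma> :: "real \<Rightarrow> real \<Rightarrow> real" where "\<sigma> t u = f (min t u) - g t u"

lemma F_diff:
  assumes "j \<le> k"
  shows "F n k - F n j = (\<Sum>i\<in>{j+1..k}. \<Sum>l=1..n. (b n i l)\<^sup>2) / n"
proof -
  have "{1..k} = {1..j} \<union> {j+1..k}" "{1..j} \<inter> {j+1..k} = {}" using assms by auto
  then show ?thesis unfolding F_def by (simp add: sum.union_disjoint add_divide_distrib)
qed

lemma F_mono: "j \<le> k \<Longrightarrow> F n j \<le> F n k"
  using F_diff[of j k n] by (smt (verit) divide_nonneg_nonneg of_nat_0_le_iff sum_nonneg zero_le_power2)

lemma f_mono:
  assumes "0 \<le> t" "t \<le> u" "u \<le> 1"
  shows "f t \<le> f u"
  using assms by (intro LIMSEQ_le[OF f_lim f_lim]) (auto intro!: F_mono idx_mono)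

lemma f_0: "f 0 = 0"
proof -
  have "(\<lambda>n. F n (idx n 0)) \<longlonglongrightarrow> f 0" by (intro f_lim) auto
  then have "(\<lambda>n. 0) \<longlonglongrightarrow> f 0" by (simp add: F_def)
  then show ?thesis by (simp add: LIMSEQ_const_iff)
qed

lemma g_commute:
  assumes "t \<in> {0..1}" "u \<in> {0..1}"
  shows "g t u = g u t"
proof -
  have "(\<lambda>n. G n (idx n t) (idx n u)) \<longlonglongrightarrow> g u t"
    using g_lim[OF assms(2,1)] unfolding G_def by (simp add: mult.commute)
  then show ?thesis using g_lim[OF assms] LIMSEQ_unique by blast
qed

lemma \<sigma>_commute: "t \<in> {0..1} \<Longrightarrow> u \<in> {0..1} \<Longrightarrow> \<sigma> t u = \<sigma> u t"
  by (simp add: \<sigma>_def g_commute min.commute)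

lemma row_sums_locale: "n \<ge> 2 \<Longrightarrow> zero_row_sums {1..n} (b n)"
  by unfold_locales (auto intro: rows simp del: One_nat_def)

context
  fixes I :: "'i set" and \<tau> :: "'i \<Rightarrow> real" and \<theta> :: "'i \<Rightarrow> real"
  assumes I: "finite I" and \<tau>: "\<And>q. q \<in> I \<Longrightarrow> \<tau> q \<in> {0..1}"
begin

text \<open>The quadratic form of the limit before passing to the limit; by \<open>quad_eq\<close>
  it is exactly the variance in \<open>combinatorial_clt_bound\<close> for the weighted
  rows.\<close>

definition quad :: "nat \<Rightarrow> real" where
  "quad n = (\<Sum>q\<in>I. \<Sum>r\<in>I. \<theta> q * \<theta> r * (F n (idx n (min (\<tau> q) (\<tau> r))) - G n (idx n (\<tau> q)) (idx n (\<tau> r))))"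

lemma quad_lim: "quad \<longlonglongrightarrow> (\<Sum>q\<in>I. \<Sum>r\<in>I. \<theta> q * \<theta> r * \<sigma> (\<tau> q) (\<tau> r))"
  unfolding quad_def \<sigma>_def using \<tau>
  by (intro tendsto_sum tendsto_mult tendsto_const tendsto_diff f_lim g_lim) (auto simp: min_def)

text \<open>With these row weights a linear combination of partial sums becomes one sum over all
  rows. Scaling rows keeps the row sums zero, so \<open>combinatorial_clt_bound\<close> covers all
  finite-dimensional distributions at once.\<close>

definition weight :: "nat \<Rightarrow> nat \<Rightarrow> real" where
  "weight n i = (\<Sum>q\<in>I. if i \<le> idx n (\<tau> q) then \<theta> q else 0)"

lemma sum_weight:
  "(\<Sum>i=1..n. weight n i * x i) = (\<Sum>q\<in>I. \<theta> q * (\<Sum>i=1..idx n (\<tau> q). x i))"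
proof -
  have "(\<Sum>i=1..n. weight n i * x i) = (\<Sum>i=1..n. \<Sum>q\<in>I. if i \<le> idx n (\<tau> q) then \<theta> q * x i else 0)"
    unfolding weight_def sum_distrib_right by (intro sum.cong refl) auto
  also have "\<dots> = (\<Sum>q\<in>I. \<Sum>i=1..n. if i \<le> idx n (\<tau> q) then \<theta> q * x i else 0)"
    by (rule sum.swap)
  also have "\<dots> = (\<Sum>q\<in>I. \<theta> q * (\<Sum>i=1..idx n (\<tau> q). x i))"
  proof (rule sum.cong[OF refl])
    fix q assume "q \<in> I"
    then have "idx n (\<tau> q) \<le> n" using \<tau> idx_le by auto
    then show "(\<Sum>i=1..n. if i \<le> idx n (\<tau> q) then \<theta> q * x i else 0) = \<theta> q * (\<Sum>i=1..idx n (\<tau> q). x i)"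
      unfolding sum_distrib_left by (intro sum.mono_neutral_cong_right) auto
  qed
  finally show ?thesis .
qed

lemma sum_weight_square:
  "(\<Sum>i=1..n. (weight n i)\<^sup>2 * x i)
    = (\<Sum>q\<in>I. \<Sum>r\<in>I. \<theta> q * \<theta> r * (\<Sum>i=1..idx n (min (\<tau> q) (\<tau> r)). x i))"
proof -
  have "(weight n i)\<^sup>2 * x i = (\<Sum>q\<in>I. \<Sum>r\<in>I. if i \<le> idx n (min (\<tau> q) (\<tau> r)) then \<theta> q * \<theta> r * x i else 0)" for i
  proof -
    have *: "(weight n i)\<^sup>2 = (\<Sum>q\<in>I. \<Sum>r\<in>I. (if i \<le> idx n (\<tau> q) then \<theta> q else 0) * (if i \<le> idx n (\<tau> r) then \<theta> r else 0))"
      by (simp only: weight_def power2_eq_square sum_product)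
    show ?thesis unfolding * sum_distrib_right by (intro sum.cong refl) (auto simp: idx_min)
  qed
  then have "(\<Sum>i=1..n. (weight n i)\<^sup>2 * x i)
      = (\<Sum>i=1..n. \<Sum>q\<in>I. \<Sum>r\<in>I. if i \<le> idx n (min (\<tau> q) (\<tau> r)) then \<theta> q * \<theta> r * x i else 0)" by simp
  also have "\<dots> = (\<Sum>q\<in>I. \<Sum>r\<in>I. \<Sum>i=1..n. if i \<le> idx n (min (\<tau> q) (\<tau> r)) then \<theta> q * \<theta> r * x i else 0)"
    by (subst sum.swap, rule sum.cong[OF refl], rule sum.swap)
  also have "\<dots> = (\<Sum>q\<in>I. \<Sum>r\<in>I. \<theta> q * \<theta> r * (\<Sum>i=1..idx n (min (\<tau> q) (\<tau> r)). x i))"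
  proof (rule sum.cong[OF refl], rule sum.cong[OF refl])
    fix q r assume "q \<in> I" "r \<in> I"
    then have "idx n (min (\<tau> q) (\<tau> r)) \<le> n" using \<tau> by (intro idx_le) (auto simp: min_le_iff_disj)
    then show "(\<Sum>i=1..n. if i \<le> idx n (min (\<tau> q) (\<tau> r)) then \<theta> q * \<theta> r * x i else 0)
        = \<theta> q * \<theta> r * (\<Sum>i=1..idx n (min (\<tau> q) (\<tau> r)). x i)"
      unfolding sum_distrib_left by (intro sum.mono_neutral_cong_right) auto
  qed
  finally show ?thesis .
qed

lemma quad_eq:
  "quad n = (\<Sum>i=1..n. \<Sum>l=1..n. (weight n i * b n i l)\<^sup>2) / n
     - (\<Sum>l=1..n. (\<Sum>i=1..n. weight n i * b n i l)\<^sup>2) / (real n)\<^sup>2"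
proof -
  have "(\<Sum>i=1..n. \<Sum>l=1..n. (weight n i * b n i l)\<^sup>2) = (\<Sum>i=1..n. (weight n i)\<^sup>2 * (\<Sum>l=1..n. (b n i l)\<^sup>2))"
    by (simp add: power_mult_distrib sum_distrib_left)
  also have "\<dots> = (\<Sum>q\<in>I. \<Sum>r\<in>I. \<theta> q * \<theta> r * (\<Sum>i=1..idx n (min (\<tau> q) (\<tau> r)). \<Sum>l=1..n. (b n i l)\<^sup>2))"
    by (rule sum_weight_square)
  finally have 1: "(\<Sum>i=1..n. \<Sum>l=1..n. (weight n i * b n i l)\<^sup>2) / n
      = (\<Sum>q\<in>I. \<Sum>r\<in>I. \<theta> q * \<theta> r * F n (idx n (min (\<tau> q) (\<tau> r))))"
    by (simp only: F_def sum_divide_distrib[where A = I] times_divide_eq_right)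
  let ?c = "\<lambda>q l. \<Sum>i=1..idx n (\<tau> q). b n i l"
  have "(\<Sum>l=1..n. (\<Sum>i=1..n. weight n i * b n i l)\<^sup>2) = (\<Sum>l=1..n. \<Sum>q\<in>I. \<Sum>r\<in>I. \<theta> q * \<theta> r * (?c q l * ?c r l))"
  proof -
    have "(\<Sum>q\<in>I. \<theta> q * x q)\<^sup>2 = (\<Sum>q\<in>I. \<Sum>r\<in>I. \<theta> q * \<theta> r * (x q * x r))" for x
      by (simp add: power2_eq_square sum_product mult_ac)
    then show ?thesis unfolding sum_weight by simp
  qed
  also have "\<dots> = (\<Sum>q\<in>I. \<Sum>r\<in>I. \<Sum>l=1..n. \<theta> q * \<theta> r * (?c q l * ?c r l))"
    by (subst sum.swap, rule sum.cong[OF refl], rule sum.swap)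
  also have "\<dots> = (\<Sum>q\<in>I. \<Sum>r\<in>I. \<theta> q * \<theta> r * (\<Sum>l=1..n. ?c q l * ?c r l))"
    by (simp only: sum_distrib_left)
  finally have 2: "(\<Sum>l=1..n. (\<Sum>i=1..n. weight n i * b n i l)\<^sup>2) / (real n)\<^sup>2
      = (\<Sum>q\<in>I. \<Sum>r\<in>I. \<theta> q * \<theta> r * G n (idx n (\<tau> q)) (idx n (\<tau> r)))"
    by (simp only: G_def sum_divide_distrib[where A = I] times_divide_eq_right)
  show ?thesis unfolding quad_def 1 2 by (simp add: right_diff_distrib sum_subtractf)
qed

lemma char_bound:
  assumes n: "n \<ge> 2"
  shows "0 \<le> quad n"
    "norm (perm_mean {1..n} (\<lambda>p. iexp (\<Sum>q\<in>I. \<theta> q * partial_sum (b n) p (idx n (\<tau> q)))) - exp (- quad n / 2))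
      \<le> 224 * (\<Sum>q\<in>I. \<bar>\<theta> q\<bar>) ^ 3 * ((\<Sum>i=1..n. \<Sum>l=1..n. \<bar>b n i l\<bar> ^ 3) / n) + 3 * quad n / n"
proof -
  have "(\<Sum>l=1..n. weight n i * b n i l) = 0" if "i \<in> {1..n}" for i
    unfolding sum_distrib_left[symmetric] rows[OF n that] by simp
  note clt = combinatorial_clt_bound[of "{1..n}" "\<lambda>i l. weight n i * b n i l", OF _ _ this]
  show "0 \<le> quad n" unfolding quad_eq using clt(1) n by simp
  have w: "\<bar>weight n i\<bar> \<le> (\<Sum>q\<in>I. \<bar>\<theta> q\<bar>)" for i
    unfolding weight_def by (rule order_trans[OF sum_abs]) (intro sum_mono, auto)
  have "\<bar>weight n i * b n i l\<bar> ^ 3 \<le> (\<Sum>q\<in>I. \<bar>\<theta> q\<bar>) ^ 3 * \<bar>b n i l\<bar> ^ 3" for i l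
    unfolding abs_mult power_mult_distrib using w by (intro mult_right_mono power_mono) auto
  then have "(\<Sum>i=1..n. \<Sum>l=1..n. \<bar>weight n i * b n i l\<bar> ^ 3)
      \<le> (\<Sum>i=1..n. \<Sum>l=1..n. (\<Sum>q\<in>I. \<bar>\<theta> q\<bar>) ^ 3 * \<bar>b n i l\<bar> ^ 3)"
    by (intro sum_mono)
  also have "\<dots> = (\<Sum>q\<in>I. \<bar>\<theta> q\<bar>) ^ 3 * (\<Sum>i=1..n. \<Sum>l=1..n. \<bar>b n i l\<bar> ^ 3)"
    by (simp only: sum_distrib_left)
  finally have "(\<Sum>i=1..n. \<Sum>l=1..n. \<bar>weight n i * b n i l\<bar> ^ 3) / n
      \<le> (\<Sum>q\<in>I. \<bar>\<theta> q\<bar>) ^ 3 * (\<Sum>i=1..n. \<Sum>l=1..n. \<bar>b n i l\<bar> ^ 3) / n"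
    by (rule divide_right_mono) simp
  moreover have "norm (perm_mean {1..n} (\<lambda>p. iexp (\<Sum>i=1..n. weight n i * b n i (p i))) - exp (- quad n / 2))
      \<le> 224 * ((\<Sum>i=1..n. \<Sum>l=1..n. \<bar>weight n i * b n i l\<bar> ^ 3) / n) + 3 * quad n / n"
    unfolding quad_eq using clt(2) n by simp
  ultimately show "norm (perm_mean {1..n} (\<lambda>p. iexp (\<Sum>q\<in>I. \<theta> q * partial_sum (b n) p (idx n (\<tau> q)))) - exp (- quad n / 2))
      \<le> 224 * (\<Sum>q\<in>I. \<bar>\<theta> q\<bar>) ^ 3 * ((\<Sum>i=1..n. \<Sum>l=1..n. \<bar>b n i l\<bar> ^ 3) / n) + 3 * quad n / n"
    unfolding sum_weight partial_sum_def by simp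
qed

text \<open>A limit of variances. The times are given by a family and may repeat.\<close>

lemma quadratic_form_nonneg: "0 \<le> (\<Sum>q\<in>I. \<Sum>r\<in>I. \<theta> q * \<theta> r * \<sigma> (\<tau> q) (\<tau> r))"
  by (rule LIMSEQ_le_const[OF quad_lim]) (auto intro!: exI[of _ 2] char_bound)

lemma char_limit:
  "(\<lambda>n. perm_mean {1..n} (\<lambda>p. iexp (\<Sum>q\<in>I. \<theta> q * partial_sum (b n) p (idx n (\<tau> q)))))
    \<longlonglongrightarrow> exp (- (\<Sum>q\<in>I. \<Sum>r\<in>I. \<theta> q * \<theta> r * \<sigma> (\<tau> q) (\<tau> r)) / 2)"
proof -
  let ?c = "\<lambda>n. perm_mean {1..n} (\<lambda>p. iexp (\<Sum>q\<in>I. \<theta> q * partial_sum (b n) p (idx n (\<tau> q))))"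
  have "(\<lambda>n. 3 * quad n * inverse (real n)) \<longlonglongrightarrow> 3 * (\<Sum>q\<in>I. \<Sum>r\<in>I. \<theta> q * \<theta> r * \<sigma> (\<tau> q) (\<tau> r)) * 0"
    by (intro tendsto_mult tendsto_const quad_lim lim_inverse_n)
  then have "(\<lambda>n. 224 * (\<Sum>q\<in>I. \<bar>\<theta> q\<bar>) ^ 3 * ((\<Sum>i=1..n. \<Sum>l=1..n. \<bar>b n i l\<bar> ^ 3) / n) + 3 * quad n / n) \<longlonglongrightarrow>
      224 * (\<Sum>q\<in>I. \<bar>\<theta> q\<bar>) ^ 3 * 0 + 0"
    by (intro tendsto_add tendsto_mult tendsto_const lyapunov) (simp add: field_simps)
  then have lim: "(\<lambda>n. 224 * (\<Sum>q\<in>I. \<bar>\<theta> q\<bar>) ^ 3 * ((\<Sum>i=1..n. \<Sum>l=1..n. \<bar>b n i l\<bar> ^ 3) / n) + 3 * quad n / n) \<longlonglongrightarrow> 0"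
    by simp
  have "(\<lambda>n. ?c n - complex_of_real (exp (- quad n / 2))) \<longlonglongrightarrow> 0"
  proof (rule Lim_null_comparison[OF _ lim])
    show "\<forall>\<^sub>F n in sequentially. norm (?c n - complex_of_real (exp (- quad n / 2)))
        \<le> 224 * (\<Sum>q\<in>I. \<bar>\<theta> q\<bar>) ^ 3 * ((\<Sum>i=1..n. \<Sum>l=1..n. \<bar>b n i l\<bar> ^ 3) / n) + 3 * quad n / n"
      using char_bound(2) by (intro eventually_sequentiallyI[of 2]) blast
  qed
  moreover have "(\<lambda>n. complex_of_real (exp (- quad n / 2)))
      \<longlonglongrightarrow> complex_of_real (exp (- (\<Sum>q\<in>I. \<Sum>r\<in>I. \<theta> q * \<theta> r * \<sigma> (\<tau> q) (\<tau> r)) / 2))"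
    by (intro tendsto_of_real tendsto_exp tendsto_divide tendsto_minus quad_lim tendsto_const) simp
  ultimately have "(\<lambda>n. (?c n - complex_of_real (exp (- quad n / 2))) + complex_of_real (exp (- quad n / 2)))
      \<longlonglongrightarrow> 0 + complex_of_real (exp (- (\<Sum>q\<in>I. \<Sum>r\<in>I. \<theta> q * \<theta> r * \<sigma> (\<tau> q) (\<tau> r)) / 2))"
    by (rule tendsto_add)
  then show ?thesis by simp
qed

end

lemma psd_kernel_\<sigma>:
  assumes "\<And>q. \<tau> q \<in> {0..1}"
  shows "psd_kernel (\<lambda>q r. \<sigma> (\<tau> q) (\<tau> r))"
  unfolding psd_kernel_def using assms by (auto intro: \<sigma>_commute quadratic_form_nonneg)

text \<open>The variance falls short of \<open>f u - f t\<close> by a limit of sums of squares,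
  namely of the column sums over the rows between the two times.\<close>

lemma increment_variance:
  assumes "0 \<le> t" "t \<le> u" "u \<le> 1"
  shows "0 \<le> \<sigma> t t - 2 * \<sigma> t u + \<sigma> u u" "\<sigma> t t - 2 * \<sigma> t u + \<sigma> u u \<le> f u - f t"
proof -
  have tu: "t \<in> {0..1}" "u \<in> {0..1}" using assms by auto
  \<comment> \<open>Two labels instead of the set of the two times, since the times may
    coincide.\<close>
  have "0 \<le> (\<Sum>q\<in>{False, True}. \<Sum>r\<in>{False, True}. (if q then 1 else -1) * (if r then 1 else -1)
      * \<sigma> (if q then u else t) (if r then u else t))"
    by (rule quadratic_form_nonneg) (use tu in auto)
  then show "0 \<le> \<sigma> t t - 2 * \<sigma> t u + \<sigma> u u" using \<sigma>_commute[OF tu] by simp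
  have "(\<lambda>n. G n (idx n t) (idx n t) - 2 * G n (idx n t) (idx n u) + G n (idx n u) (idx n u))
      \<longlonglongrightarrow> g t t - 2 * g t u + g u u"
    by (intro tendsto_intros g_lim tu)
  moreover have "0 \<le> G n (idx n t) (idx n t) - 2 * G n (idx n t) (idx n u) + G n (idx n u) (idx n u)" for n
  proof -
    let ?c = "\<lambda>k l. \<Sum>i=1..k. b n i l"
    have "G n j j - 2 * G n j k + G n k k = (\<Sum>l=1..n. (?c j l - ?c k l)\<^sup>2) / (real n)\<^sup>2" for j k
    proof -
      have "(\<Sum>l=1..n. (?c j l - ?c k l)\<^sup>2)
          = (\<Sum>l=1..n. ?c j l * ?c j l) - 2 * (\<Sum>l=1..n. ?c j l * ?c k l) + (\<Sum>l=1..n. ?c k l * ?c k l)"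
      proof -
        have "(x - y)\<^sup>2 = x * x - 2 * (x * y) + y * y" for x y :: real
          by (simp add: power2_eq_square algebra_simps)
        then show ?thesis by (simp only: sum.distrib sum_subtractf sum_distrib_left[symmetric])
      qed
      then show ?thesis by (simp add: G_def add_divide_distrib diff_divide_distrib)
    qed
    then show ?thesis by (simp add: sum_nonneg)
  qed
  ultimately have "0 \<le> g t t - 2 * g t u + g u u" by (intro LIMSEQ_le_const) auto
  then show "\<sigma> t t - 2 * \<sigma> t u + \<sigma> u u \<le> f u - f t" using assms by (simp add: \<sigma>_def)
qed

lemma second_moment_bound:
  assumes n: "n \<ge> 2" and k: "k \<le> n"
  shows "perm_mean {1..n} (\<lambda>p. (partial_sum (b n) p k)\<^sup>2) \<le> 3 * F n n"
proof -
  interpret zero_row_sums "{1..n}" "b n" using row_sums_locale[OF n] .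
  have "real n * perm_mean {1..n} (\<lambda>p. (partial_sum (b n) p k)\<^sup>2) \<le> 3 * energy {1..k}"
    unfolding partial_sum_def using second_moment_le[of "{1..k}"] n k by auto
  also have "energy {1..k} = real n * F n k" unfolding energy_def F_def using n by simp
  also have "\<dots> \<le> real n * F n n" using F_mono[OF k] by (intro mult_left_mono) auto
  finally show ?thesis using n by simp
qed

text \<open>The product of two adjacent increments of \<open>F\<close> is at most the square of the
  total one, which is the hypothesis of the maximal inequality;
  \<open>5320000 = 70000 * 76\<close>.\<close>

lemma split_max_moment:
  assumes n: "n \<ge> 4" and ik: "i \<le> k" "k \<le> n"
  shows "perm_mean {1..n} (\<lambda>p. split_max (partial_sum (b n) p) i k ^ 4) \<le> 5320000 * (F n k - F n i)\<^sup>2"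
proof -
  interpret zero_row_sums "{1..n}" "b n" using row_sums_locale n by simp
  have e: "energy {i+1..k} = real n * (F n k - F n i)" if "i \<le> k" for i k
    unfolding energy_def F_diff[OF that] using n by simp
  \<comment> \<open>The maximal inequality speaks of plain sums, so the number of permutations goes
    into its constant.\<close>
  have "(\<Sum>p | p permutes {1..n}. split_max (partial_sum (b n) p) i k ^ 4)
      \<le> 70000 * (76 * fact n) * (F n k - F n i)\<^sup>2"
  proof (rule sum_split_max_power4_le[where N = n])
    fix i j k assume ijk: "i \<le> j" "j \<le> k" "k \<le> n"
    have "(real n)\<^sup>2 * perm_mean {1..n} (\<lambda>p. (partial_sum (b n) p j - partial_sum (b n) p i)\<^sup>2 *
        (partial_sum (b n) p k - partial_sum (b n) p j)\<^sup>2)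
        \<le> 76 * (energy {i+1..j} * energy {j+1..k})"
      unfolding partial_sum_diff[OF ijk(1)] partial_sum_diff[OF ijk(2)]
      using fourth_moment_le[of "{i+1..j}" "{j+1..k}"] n ijk by auto
    also have "\<dots> = (real n)\<^sup>2 * (76 * ((F n j - F n i) * (F n k - F n j)))"
      unfolding e[OF ijk(1)] e[OF ijk(2)] by (simp add: power2_eq_square mult_ac)
    finally have "perm_mean {1..n} (\<lambda>p. (partial_sum (b n) p j - partial_sum (b n) p i)\<^sup>2 *
        (partial_sum (b n) p k - partial_sum (b n) p j)\<^sup>2) \<le> 76 * ((F n j - F n i) * (F n k - F n j))"
      using n by simp
    also have "(F n j - F n i) * (F n k - F n j) \<le> (F n k - F n i) * (F n k - F n i)"
      using F_mono[OF ijk(1), of n] F_mono[OF ijk(2), of n] by (intro mult_mono) auto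
    finally have "perm_mean {1..n} (\<lambda>p. (partial_sum (b n) p j - partial_sum (b n) p i)\<^sup>2 *
        (partial_sum (b n) p k - partial_sum (b n) p j)\<^sup>2) \<le> 76 * (F n k - F n i)\<^sup>2"
      by (simp add: power2_eq_square)
    then show "(\<Sum>p | p permutes {1..n}. (partial_sum (b n) p j - partial_sum (b n) p i)\<^sup>2 *
        (partial_sum (b n) p k - partial_sum (b n) p j)\<^sup>2) \<le> 76 * fact n * (F n k - F n i)\<^sup>2"
      by (simp add: perm_mean_def field_simps)
  qed (use F_mono ik in auto)
  then show ?thesis by (simp add: perm_mean_def field_simps)
qed

end

section \<open>Permutations as a probability space, and rational times\<close>

lemma Re_perm_mean: "Re (perm_mean S F) = perm_mean S (\<lambda>p. Re (F p))"
  and Im_perm_mean: "Im (perm_mean S F) = perm_mean S (\<lambda>p. Im (F p))"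
  by (simp_all add: perm_mean_def)

definition perm_measure :: "'a set \<Rightarrow> ('a \<Rightarrow> 'a) measure" where
  "perm_measure S = measure_pmf (pmf_of_set {p. p permutes S})"

lemma prob_space_perm_measure: "prob_space (perm_measure S)"
  unfolding perm_measure_def by (rule measure_pmf.prob_space_axioms)

lemma borel_measurable_perm_measure [measurable]: "F \<in> borel_measurable (perm_measure S)"
  by (simp add: perm_measure_def)

lemma integral_perm_measure:
  fixes F :: "('a \<Rightarrow> 'a) \<Rightarrow> real"
  assumes "finite S"
  shows "(\<integral>p. F p \<partial>perm_measure S) = perm_mean S F"
proof -
  have "{p. p permutes S} \<noteq> {}" using permutes_id[of S] by blast
  moreover have "finite {p. p permutes S}" using assms by (rule finite_permutations)
  ultimately show ?thesis
    by (simp add: perm_measure_def integral_pmf_of_set perm_mean_def card_permutations[OF refl assms] divide_inverse mult.commute)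
qed

lemma integrable_perm_measure:
  fixes F :: "('a \<Rightarrow> 'a) \<Rightarrow> real"
  assumes "finite S"
  shows "integrable (perm_measure S) F"
proof -
  have "{p. p permutes S} \<noteq> {}" using permutes_id[of S] by blast
  moreover have "finite {p. p permutes S}" using assms by (rule finite_permutations)
  ultimately show ?thesis unfolding perm_measure_def
    by (intro integrable_measure_pmf_finite) simp
qed

lemma add_power4_le_8:
  fixes x y :: real
  shows "(x + y) ^ 4 \<le> 8 * x ^ 4 + 8 * y ^ 4"
proof -
  have sq: "(u + v)\<^sup>2 \<le> 2 * u\<^sup>2 + 2 * v\<^sup>2" for u v :: real
    using sum_squares_bound[of u v] by (simp add: power2_sum)
  have "((x + y)\<^sup>2)\<^sup>2 \<le> (2 * x\<^sup>2 + 2 * y\<^sup>2)\<^sup>2" using sq by (intro power_mono) auto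
  also have "\<dots> \<le> 2 * (2 * x\<^sup>2)\<^sup>2 + 2 * (2 * y\<^sup>2)\<^sup>2" by (rule sq)
  finally show ?thesis by (simp add: power_mult_distrib power_mult[symmetric])
qed

text \<open>Clamping makes the time total on \<open>rat\<close>, so the covariance is a positive
  semidefinite kernel on a whole countable type.\<close>

definition rat_time :: "rat \<Rightarrow> real" where
  "rat_time q = max 0 (min 1 (of_rat q))"

lemma rat_time_in: "rat_time q \<in> {0..1}"
  by (auto simp: rat_time_def)

lemma rat_time_id: "(of_rat q :: real) \<in> {0..1} \<Longrightarrow> rat_time q = of_rat q"
  by (auto simp: rat_time_def)

abbreviation grid :: "nat \<Rightarrow> nat \<Rightarrow> rat" where
  "grid m k \<equiv> of_nat k / of_nat m"

lemma of_rat_grid: "of_rat (grid m k) = real k / real m"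
  by (simp add: of_rat_divide)

lemma rat_time_grid: "k \<le> m \<Longrightarrow> 0 < m \<Longrightarrow> rat_time (grid m k) = real k / real m"
  by (subst rat_time_id) (auto simp: of_rat_grid divide_le_eq)

section \<open>Finite-dimensional limits and the oscillation over grid cells\<close>

locale gaussian_limit = matrix_arrays +
  fixes Z :: "(real \<Rightarrow> real) \<Rightarrow> rat \<Rightarrow> real"
  assumes Z_measurable [measurable]: "\<And>i. (\<lambda>\<omega>. Z \<omega> i) \<in> borel_measurable white_noise"
    and Z_char: "\<And>I c. finite I \<Longrightarrow> (\<integral>\<omega>. iexp (\<Sum>i\<in>I. c i * Z \<omega> i) \<partial>white_noise)
        = exp (- (\<Sum>i\<in>I. \<Sum>j\<in>I. c i * c j * \<sigma> (rat_time i) (rat_time j)) / 2)"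
begin

sublocale noise: prob_space white_noise by (rule prob_space_white_noise)

definition X :: "nat \<Rightarrow> (nat \<Rightarrow> nat) \<Rightarrow> rat \<Rightarrow> real" where
  "X n p q = partial_sum (b n) p (idx n (rat_time q))"

lemma Z_measurable' [measurable]: "Z \<in> borel_measurable white_noise"
  by (intro measurable_coordinatewise_then_product Z_measurable)

lemma Z_moments:
  "(\<integral>\<omega>. (Z \<omega> q)\<^sup>2 \<partial>white_noise) = \<sigma> (rat_time q) (rat_time q)" "integrable white_noise (\<lambda>\<omega>. (Z \<omega> q)\<^sup>2)"
proof -
  have v: "0 \<le> \<sigma> (rat_time q) (rat_time q)"
    using quadratic_form_nonneg[of "{q}" rat_time "\<lambda>_. 1"] rat_time_in by auto
  have ch: "(\<integral>\<omega>. iexp (t * Z \<omega> q) \<partial>white_noise) = exp (- (\<sigma> (rat_time q) (rat_time q) * t\<^sup>2) / 2)" for t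
    using Z_char[of "{q}" "\<lambda>_. t"] by (simp add: power2_eq_square mult_ac)
  show "(\<integral>\<omega>. (Z \<omega> q)\<^sup>2 \<partial>white_noise) = \<sigma> (rat_time q) (rat_time q)" "integrable white_noise (\<lambda>\<omega>. (Z \<omega> q)\<^sup>2)"
    by (rule noise.gaussian_moments_from_char[OF Z_measurable v ch])+
qed

lemma Z_increment_moment:
  assumes "0 \<le> rat_time q" "rat_time q \<le> rat_time r" "rat_time r \<le> 1"
  shows "(\<integral>\<omega>. (Z \<omega> r - Z \<omega> q) ^ 4 \<partial>white_noise) \<le> 3 * (f (rat_time r) - f (rat_time q))\<^sup>2"
    "integrable white_noise (\<lambda>\<omega>. (Z \<omega> r - Z \<omega> q) ^ 4)"
proof -
  define v where "v = \<sigma> (rat_time q) (rat_time q) - 2 * \<sigma> (rat_time q) (rat_time r) + \<sigma> (rat_time r) (rat_time r)"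
  have v: "0 \<le> v" "v \<le> f (rat_time r) - f (rat_time q)" unfolding v_def by (rule increment_variance[OF assms])+
  have ch: "(\<integral>\<omega>. iexp (t * (Z \<omega> r - Z \<omega> q)) \<partial>white_noise) = exp (- (v * t\<^sup>2) / 2)" for t
  proof (cases "q = r")
    \<comment> \<open>For equal indices the set \<open>{q, r}\<close> collapses and the coefficients
      used below would not give a difference.\<close>
    case True
    then have "v = 0" by (simp add: v_def)
    then show ?thesis using True noise.prob_space by simp
  next
    case False
    have eq: "(\<Sum>i\<in>{q, r}. (if i = r then t else - t) * Z \<omega> i) = t * (Z \<omega> r - Z \<omega> q)" for \<omega>
      using False by (simp add: algebra_simps)
    show ?thesis unfolding eq[symmetric]
      using False \<sigma>_commute[OF rat_time_in[of q] rat_time_in[of r]]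
      by (subst Z_char) (auto simp: v_def power2_eq_square algebra_simps)
  qed
  have m: "(\<lambda>\<omega>. Z \<omega> r - Z \<omega> q) \<in> borel_measurable white_noise" by measurable
  have "(\<integral>\<omega>. (Z \<omega> r - Z \<omega> q) ^ 4 \<partial>white_noise) = 3 * v\<^sup>2"
    by (rule noise.gaussian_moments_from_char[OF m v(1) ch])
  also have "\<dots> \<le> 3 * (f (rat_time r) - f (rat_time q))\<^sup>2"
    using v by (intro mult_left_mono power_mono) auto
  finally show "(\<integral>\<omega>. (Z \<omega> r - Z \<omega> q) ^ 4 \<partial>white_noise) \<le> 3 * (f (rat_time r) - f (rat_time q))\<^sup>2" .
  show "integrable white_noise (\<lambda>\<omega>. (Z \<omega> r - Z \<omega> q) ^ 4)"
    by (rule noise.gaussian_moments_from_char[OF m v(1) ch])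
qed

lemma finite_dimensional_limit:
  fixes \<phi> :: "(rat \<Rightarrow> real) \<Rightarrow> real"
  assumes T: "finite T" and dep: "\<And>x y. (\<And>i. i \<in> T \<Longrightarrow> x i = y i) \<Longrightarrow> \<phi> x = \<phi> y"
    and cont: "continuous_on UNIV \<phi>" and B: "\<And>x. \<bar>\<phi> x\<bar> \<le> B"
  shows "(\<lambda>n. perm_mean {1..n} (\<lambda>p. \<phi> (X n p))) \<longlonglongrightarrow> (\<integral>\<omega>. \<phi> (Z \<omega>) \<partial>white_noise)"
proof -
  have char_lim: "(\<lambda>n. perm_mean {1..n} (\<lambda>p. iexp (linear_comb I \<theta> (X n p))))
      \<longlonglongrightarrow> (\<integral>\<omega>. iexp (linear_comb I \<theta> (Z \<omega>)) \<partial>white_noise)" if I: "finite I" for I \<theta>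
    unfolding linear_comb_def Z_char[OF I] X_def using char_limit[OF I, of rat_time \<theta>] rat_time_in by simp
  have int: "integrable white_noise (\<lambda>\<omega>. iexp (linear_comb I \<theta> (Z \<omega>)))" for I \<theta>
    by (intro noise.integrable_const_bound[where B = 1]) (auto intro!: AE_I2 measurable_compose[OF Z_measurable'])
  \<comment> \<open>A second moment bound is required at every index, and
    \<open>second_moment_bound\<close> holds from 2 on; hence the shifted sequence.\<close>
  interpret char_convergence "\<lambda>n. perm_measure {1..n + 4}" "\<lambda>n. X (n + 4)" white_noise Z
  proof (rule char_convergence.intro)
    fix I :: "rat set" and \<theta> assume I: "finite I"
    note lim = LIMSEQ_ignore_initial_segment[OF char_lim[OF I, of \<theta>], of 4]
    show "(\<lambda>n. \<integral>p. cos (linear_comb I \<theta> (X (n + 4) p)) \<partial>perm_measure {1..n + 4})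
        \<longlonglongrightarrow> (\<integral>\<omega>. cos (linear_comb I \<theta> (Z \<omega>)) \<partial>white_noise)"
      using tendsto_Re[OF lim] integral_Re[OF int, of I \<theta>] by (simp add: integral_perm_measure Re_perm_mean Re_exp)
    show "(\<lambda>n. \<integral>p. sin (linear_comb I \<theta> (X (n + 4) p)) \<partial>perm_measure {1..n + 4})
        \<longlonglongrightarrow> (\<integral>\<omega>. sin (linear_comb I \<theta> (Z \<omega>)) \<partial>white_noise)"
      using tendsto_Im[OF lim] integral_Im[OF int, of I \<theta>] by (simp add: integral_perm_measure Im_perm_mean Im_exp)
  qed (rule prob_space_perm_measure noise.prob_space_axioms borel_measurable_perm_measure Z_measurable')+
  have "(\<lambda>n. F n (idx n 1)) \<longlonglongrightarrow> f 1" by (intro f_lim) auto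
  then obtain c0 where c0: "\<And>n. \<bar>F n n\<bar> \<le> c0"
    using convergent_imp_Bseq[of "\<lambda>n. F n n"] by (auto simp: convergent_def Bseq_def)
  let ?c = "3 * c0 + (\<Sum>i\<in>T. \<bar>\<sigma> (rat_time i) (rat_time i)\<bar>)"
  have "0 \<le> c0" using c0[of 0] by linarith
  have "conv \<phi>"
  proof (rule conv_bounded_continuous[OF T dep cont B])
    fix n i assume "i \<in> T"
    have "perm_mean {1..n + 4} (\<lambda>p. (X (n + 4) p i)\<^sup>2) \<le> 3 * F (n + 4) (n + 4)"
      unfolding X_def using rat_time_in by (intro second_moment_bound idx_le) auto
    also have "\<dots> \<le> 3 * c0" using c0[of "n + 4"] by linarith
    also have "\<dots> \<le> ?c" by (simp add: sum_nonneg)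
    finally show "integrable (perm_measure {1..n + 4}) (\<lambda>p. (X (n + 4) p i)\<^sup>2) \<and>
        (\<integral>p. (X (n + 4) p i)\<^sup>2 \<partial>perm_measure {1..n + 4}) \<le> ?c"
      by (simp add: integrable_perm_measure integral_perm_measure)
  next
    fix i assume i: "i \<in> T"
    have "\<bar>\<sigma> (rat_time i) (rat_time i)\<bar> \<le> (\<Sum>i\<in>T. \<bar>\<sigma> (rat_time i) (rat_time i)\<bar>)"
      using i T by (intro member_le_sum) auto
    then show "integrable white_noise (\<lambda>\<omega>. (Z \<omega> i)\<^sup>2) \<and> (\<integral>\<omega>. (Z \<omega> i)\<^sup>2 \<partial>white_noise) \<le> ?c"
      using \<open>0 \<le> c0\<close> by (simp add: Z_moments)
  qed
  then show ?thesis
    unfolding conv_def by (subst (asm) integral_perm_measure) (auto dest: LIMSEQ_offset[where k = 4])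
qed

text \<open>A sum over the cells in place of the maximum. The increment over a cell is truncated
  because its fourth moment is under control only in the limit; the factors 8 come from the fourth
  power of a sum of two terms.\<close>

definition osc_bound :: "nat \<Rightarrow> nat \<Rightarrow> (nat \<Rightarrow> nat) \<Rightarrow> real" where
  "osc_bound n m p = (\<Sum>k<m. 8 * split_max (partial_sum (b n) p) (idx n (real k / m)) (idx n (real (Suc k) / m)) ^ 4
     + 8 * min 1 ((X n p (grid m (Suc k)) - X n p (grid m k)) ^ 4))"

text \<open>The limiting bound for the mean of \<open>osc_bound\<close>:
  \<open>42560024 = 8 * 5320000 + 8 * 3\<close>, with 3 from the Gaussian fourth moment.\<close>

definition eps :: "nat \<Rightarrow> real" where
  "eps m = 42560024 * (\<Sum>k<m. (f (real (Suc k) / m) - f (real k / m))\<^sup>2)"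

lemma osc_bound_summand_nonneg:
  "0 \<le> 8 * split_max (partial_sum (b n) p) (idx n (real k / m)) (idx n (real (Suc k) / m)) ^ 4
     + 8 * min 1 ((X n p (grid m (Suc k)) - X n p (grid m k)) ^ 4)"
  by (auto intro!: add_nonneg_nonneg)

lemma osc_bound_ge:
  assumes k: "k < m" and t: "real k / m \<le> t" "t \<le> real (Suc k) / m"
  shows "min 1 ((partial_sum (b n) p (idx n t) - X n p (grid m k)) ^ 4) \<le> osc_bound n m p"
proof -
  let ?S = "partial_sum (b n) p" and ?lo = "idx n (real k / m)" and ?hi = "idx n (real (Suc k) / m)"
  have X: "X n p (grid m k) = ?S ?lo" "X n p (grid m (Suc k)) = ?S ?hi"
    using k rat_time_grid[of k m] rat_time_grid[of "Suc k" m] by (simp_all add: X_def del: of_nat_Suc)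
  let ?M = "split_max ?S ?lo ?hi"
  have "idx n t \<in> {?lo..?hi}" using t by (auto intro: idx_mono)
  then have "\<bar>?S (idx n t) - ?S ?lo\<bar> \<le> ?M + \<bar>?S ?hi - ?S ?lo\<bar>" by (rule abs_diff_le_split_max)
  then have "\<bar>?S (idx n t) - ?S ?lo\<bar> ^ 4 \<le> (?M + \<bar>?S ?hi - ?S ?lo\<bar>) ^ 4" by (intro power_mono) auto
  also have "\<dots> \<le> 8 * ?M ^ 4 + 8 * \<bar>?S ?hi - ?S ?lo\<bar> ^ 4" by (rule add_power4_le_8)
  finally have "(?S (idx n t) - ?S ?lo) ^ 4 \<le> 8 * ?M ^ 4 + 8 * (?S ?hi - ?S ?lo) ^ 4" by (simp add: power_even_abs)
  moreover have "0 \<le> ?M ^ 4" by simp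
  \<comment> \<open>The truncation may be moved onto the increment alone: once \<open>y > 1\<close>
    the right-hand side is already at least 8.\<close>
  moreover have "min 1 x \<le> a + 8 * min 1 y" if "x \<le> a + 8 * y" "0 \<le> a" for x a y :: real
    using that by (cases "y \<le> 1") auto
  ultimately have "min 1 ((?S (idx n t) - ?S ?lo) ^ 4) \<le> 8 * ?M ^ 4 + 8 * min 1 ((?S ?hi - ?S ?lo) ^ 4)"
    by (metis mult_nonneg_nonneg zero_le_numeral)
  also have "\<dots> \<le> osc_bound n m p"
    unfolding osc_bound_def X[symmetric] using k
    by (intro member_le_sum[of k] osc_bound_summand_nonneg) auto
  finally show ?thesis by (simp add: X)
qed

lemma continuous_min_power4: "continuous_on UNIV (\<lambda>y :: rat \<Rightarrow> real. min 1 ((y q - y r) ^ 4))"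
  by (intro continuous_intros continuous_on_product_coordinates)

text \<open>The split maxima have a moment bound for each \<open>n\<close>. The truncated increments
  converge by the finite-dimensional limit, and only there is the truncation dropped and the
  Gaussian fourth moment used.\<close>

lemma osc_bound_mean_eventually:
  assumes m: "0 < m" and \<delta>: "0 < \<delta>"
  shows "eventually (\<lambda>n. perm_mean {1..n} (osc_bound n m) \<le> eps m + \<delta>) sequentially"
proof -
  let ?hi = "\<lambda>k. grid m (Suc k)" and ?lo = "\<lambda>k. grid m k"
  define u where "u n = (\<Sum>k<m. 8 * (5320000 * (F n (idx n (real (Suc k) / m)) - F n (idx n (real k / m)))\<^sup>2)
     + 8 * perm_mean {1..n} (\<lambda>p. min 1 ((X n p (?hi k) - X n p (?lo k)) ^ 4)))" for n
  have le: "perm_mean {1..n} (osc_bound n m) \<le> u n" if n: "n \<ge> 4" for n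
  proof -
    have "perm_mean {1..n} (osc_bound n m) = (\<Sum>k<m. 8 * perm_mean {1..n} (\<lambda>p. split_max (partial_sum (b n) p) (idx n (real k / m)) (idx n (real (Suc k) / m)) ^ 4)
       + 8 * perm_mean {1..n} (\<lambda>p. min 1 ((X n p (?hi k) - X n p (?lo k)) ^ 4)))"
      unfolding osc_bound_def perm_mean_sum perm_mean_add perm_mean_mult ..
    also have "\<dots> \<le> u n" unfolding u_def
      using n by (intro sum_mono add_mono mult_left_mono split_max_moment order_refl idx_mono idx_le)
        (auto simp: divide_right_mono)
    finally show ?thesis .
  qed
  have "u \<longlonglongrightarrow> (\<Sum>k<m. 8 * (5320000 * (f (real (Suc k) / m) - f (real k / m))\<^sup>2)
     + 8 * (\<integral>\<omega>. min 1 ((Z \<omega> (?hi k) - Z \<omega> (?lo k)) ^ 4) \<partial>white_noise))" (is "_ \<longlonglongrightarrow> ?U")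
    unfolding u_def
  proof (intro tendsto_sum tendsto_add tendsto_mult tendsto_const tendsto_power tendsto_diff f_lim)
    fix k assume "k \<in> {..<m}"
    then show "real (Suc k) / m \<in> {0..1}" "real k / m \<in> {0..1}" by auto
    show "(\<lambda>n. perm_mean {1..n} (\<lambda>p. min 1 ((X n p (?hi k) - X n p (?lo k)) ^ 4)))
        \<longlonglongrightarrow> (\<integral>\<omega>. min 1 ((Z \<omega> (?hi k) - Z \<omega> (?lo k)) ^ 4) \<partial>white_noise)"
      by (rule finite_dimensional_limit[of "{?hi k, ?lo k}" "\<lambda>y. min 1 ((y (?hi k) - y (?lo k)) ^ 4)" 1])
         (auto intro: continuous_min_power4)
  qed
  moreover have "?U \<le> eps m"
    unfolding eps_def sum_distrib_left
  proof (rule sum_mono)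
    fix k assume "k \<in> {..<m}"
    then have k: "rat_time (?hi k) = real (Suc k) / m" "rat_time (?lo k) = real k / m"
      using rat_time_grid[of k m] rat_time_grid[of "Suc k" m] by (simp_all del: of_nat_Suc)
    have inc: "0 \<le> rat_time (?lo k)" "rat_time (?lo k) \<le> rat_time (?hi k)" "rat_time (?hi k) \<le> 1"
      using rat_time_in[of "?lo k"] rat_time_in[of "?hi k"] by (simp_all add: k divide_right_mono del: of_nat_Suc)
    have "(\<integral>\<omega>. min 1 ((Z \<omega> (?hi k) - Z \<omega> (?lo k)) ^ 4) \<partial>white_noise)
        \<le> (\<integral>\<omega>. (Z \<omega> (?hi k) - Z \<omega> (?lo k)) ^ 4 \<partial>white_noise)"
      by (rule integral_mono[OF noise.integrable_bounded[where B = 1] Z_increment_moment(2)[OF inc]]) auto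
    also have "\<dots> \<le> 3 * (f (real (Suc k) / m) - f (real k / m))\<^sup>2"
      using Z_increment_moment(1)[OF inc] unfolding k .
    finally show "8 * (5320000 * (f (real (Suc k) / m) - f (real k / m))\<^sup>2)
        + 8 * (\<integral>\<omega>. min 1 ((Z \<omega> (?hi k) - Z \<omega> (?lo k)) ^ 4) \<partial>white_noise)
        \<le> 42560024 * (f (real (Suc k) / m) - f (real k / m))\<^sup>2" by simp
  qed
  ultimately have "eventually (\<lambda>n. u n < eps m + \<delta>) sequentially"
    using \<delta> by (intro order_tendstoD(2)) auto
  then show ?thesis
    using eventually_ge_at_top[of 4] by eventually_elim (use le in force)
qed

text \<open>The sum of squared increments of the monotone \<open>f\<close> is at most its largest
  increment over a cell times \<open>f 1\<close>, and uniform continuity makes the largest increment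
  small.\<close>

lemma eps_lim: "eps \<longlonglongrightarrow> 0"
proof (rule LIMSEQ_I)
  fix r :: real assume r: "0 < r"
  have f1: "0 \<le> f 1" using f_mono[of 0 1] f_0 by simp
  \<comment> \<open>Chosen so that the final bound is exactly \<open>r\<close>; the added 1 keeps
    the denominator positive when \<open>f 1 = 0\<close>.\<close>
  define \<eta> where "\<eta> = r / (42560024 * (f 1 + 1))"
  have \<eta>: "0 < \<eta>" using r f1 by (simp add: \<eta>_def)
  have "uniformly_continuous_on {0..1} f" by (rule compact_uniformly_continuous[OF f_cont]) simp
  then obtain d where d: "0 < d" "\<And>x y. x \<in> {0..1} \<Longrightarrow> y \<in> {0..1} \<Longrightarrow> dist y x < d \<Longrightarrow> dist (f y) (f x) < \<eta>"
    using \<eta> unfolding uniformly_continuous_on_def by meson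
  obtain m0 :: nat where m0: "1 / d < m0" using reals_Archimedean2 by blast
  have "norm (eps m - 0) < r" if m: "m \<ge> Suc m0" for m
  proof -
    have mpos: "0 < real m" using m by simp
    let ?D = "\<lambda>k. f (real (Suc k) / m) - f (real k / m)"
    have D: "0 \<le> ?D k" "?D k \<le> \<eta>" if "k < m" for k
    proof -
      have in01: "real (Suc k) / m \<in> {0..1}" "real k / m \<in> {0..1}" using that by auto
      show "0 \<le> ?D k" using in01 f_mono[of "real k / m" "real (Suc k) / m"] by (simp add: divide_right_mono)
      have "1 / d < m" using m0 m by simp
      then have "1 / real m < d" using d(1) mpos by (simp add: field_simps)
      then have "dist (real (Suc k) / m) (real k / m) < d"
        by (simp add: dist_real_def diff_divide_distrib[symmetric])
      then have "dist (f (real (Suc k) / m)) (f (real k / m)) < \<eta>" by (rule d(2)[OF in01(2,1)])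
      then show "?D k \<le> \<eta>" by (simp add: dist_real_def)
    qed
    have "(\<Sum>k<m. (?D k)\<^sup>2) \<le> (\<Sum>k<m. \<eta> * ?D k)"
      unfolding power2_eq_square using D by (intro sum_mono mult_right_mono) auto
    also have "\<dots> = \<eta> * f 1"
      using sum_lessThan_telescope[of "\<lambda>k. f (real k / m)" m] mpos f_0 by (simp add: sum_distrib_left[symmetric])
    finally have "eps m \<le> 42560024 * (\<eta> * f 1)" unfolding eps_def by (rule mult_left_mono) simp
    also have "\<dots> < 42560024 * (\<eta> * (f 1 + 1))" using \<eta> by simp
    also have "\<dots> = r" using f1 by (simp add: \<eta>_def field_simps)
    finally show ?thesis by (simp add: eps_def sum_nonneg abs_of_nonneg)
  qed
  then show "\<exists>no. \<forall>n\<ge>no. norm (eps n - 0) < r" by blast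
qed

end

section \<open>The continuous version of the Gaussian limit\<close>

context gaussian_limit
begin

definition osc_pairs :: "nat \<Rightarrow> (nat \<times> rat) set" where
  "osc_pairs m = {(k, q). k < m \<and> real k / m \<le> of_rat q \<and> of_rat q \<le> real (Suc k) / m}"

definition osc :: "nat \<Rightarrow> nat \<times> rat \<Rightarrow> (rat \<Rightarrow> real) \<Rightarrow> real" where
  "osc m kq y = min 1 ((y (snd kq) - y (grid m (fst kq))) ^ 4)"

text \<open>The running maximum along an enumeration of all pairs of a cell and a rational point in
  it. Each stage depends on finitely many coordinates, so finite-dimensional limits apply to it, and
  together the stages reach every pair.\<close>

primrec run_max :: "nat \<Rightarrow> nat \<Rightarrow> (rat \<Rightarrow> real) \<Rightarrow> real" where
  "run_max m 0 y = osc m (from_nat_into (osc_pairs m) 0) y"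
| "run_max m (Suc j) y = max (run_max m j y) (osc m (from_nat_into (osc_pairs m) (Suc j)) y)"

lemma osc_pairs_nonempty: "0 < m \<Longrightarrow> osc_pairs m \<noteq> {}"
proof -
  assume "0 < m"
  then have "(0, 0) \<in> osc_pairs m" by (simp add: osc_pairs_def)
  then show ?thesis by blast
qed

lemma osc_range: "0 \<le> osc m kq y" "osc m kq y \<le> 1"
  by (auto simp: osc_def)

lemma run_max_range: "0 \<le> run_max m j y" "run_max m j y \<le> 1"
  by (induction j) (auto simp: osc_range le_max_iff_disj)

lemma run_max_mono: "i \<le> j \<Longrightarrow> run_max m i y \<le> run_max m j y"
  by (rule lift_Suc_mono_le[of "\<lambda>j. run_max m j y"]) auto

lemma osc_le_run_max: "osc m (from_nat_into (osc_pairs m) j) y \<le> run_max m j y"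
  by (cases j) auto

lemma run_max_continuous: "continuous_on UNIV (run_max m j)"
proof (induction j)
  case 0
  show ?case by (simp add: osc_def fun_eq_iff[symmetric] continuous_min_power4)
next
  case (Suc j)
  have "continuous_on UNIV (\<lambda>y. max (run_max m j y) (osc m (from_nat_into (osc_pairs m) (Suc j)) y))"
    using Suc by (intro continuous_on_max) (auto simp: osc_def continuous_min_power4)
  then show ?case by simp
qed

lemma run_max_measurable [measurable]: "(\<lambda>\<omega>. run_max m j (Z \<omega>)) \<in> borel_measurable white_noise"
  by (rule measurable_compose[OF Z_measurable']) (intro borel_measurable_continuous_onI run_max_continuous)

lemma run_max_depends:
  "\<exists>T. finite T \<and> (\<forall>x y. (\<forall>i\<in>T. x i = y i) \<longrightarrow> run_max m j x = run_max m j y)"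
proof (induction j)
  case 0
  show ?case
    by (intro exI[of _ "{snd (from_nat_into (osc_pairs m) 0), grid m (fst (from_nat_into (osc_pairs m) 0))}"])
       (simp add: osc_def)
next
  case (Suc j)
  then obtain T where T: "finite T" "\<forall>x y. (\<forall>i\<in>T. x i = y i) \<longrightarrow> run_max m j x = run_max m j y" by blast
  let ?kq = "from_nat_into (osc_pairs m) (Suc j)"
  let ?T = "insert (snd ?kq) (insert (grid m (fst ?kq)) T)"
  have "run_max m (Suc j) x = run_max m (Suc j) y" if xy: "\<forall>i\<in>?T. x i = y i" for x y
  proof -
    have "run_max m j x = run_max m j y" using T(2) xy by blast
    moreover have "osc m ?kq x = osc m ?kq y" using xy by (simp add: osc_def)
    ultimately show ?thesis by simp
  qed
  then show ?case using T(1) by (intro exI[of _ ?T]) blast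
qed

lemma run_max_le_osc_bound:
  assumes m: "0 < m"
  shows "run_max m j (X n p) \<le> osc_bound n m p"
proof -
  have o: "osc m kq (X n p) \<le> osc_bound n m p" if kq: "kq \<in> osc_pairs m" for kq
  proof -
    obtain k q where kq': "kq = (k, q)" "k < m" "real k / m \<le> of_rat q" "of_rat q \<le> real (Suc k) / m"
      using kq by (auto simp: osc_pairs_def)
    have "real (Suc k) / m \<le> 1" using kq'(2) by simp
    then have "(of_rat q :: real) \<le> 1" using kq'(4) by (rule order_trans[rotated])
    moreover have "0 \<le> (of_rat q :: real)" by (rule order_trans[OF _ kq'(3)]) simp
    ultimately have "rat_time q = of_rat q"
      unfolding rat_time_def by (simp only: min_absorb2 max_absorb2)
    then have "X n p q = partial_sum (b n) p (idx n (of_rat q))" by (simp add: X_def)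
    then show ?thesis using osc_bound_ge[OF kq'(2-4), of n p] by (simp add: kq'(1) osc_def)
  qed
  have "from_nat_into (osc_pairs m) j \<in> osc_pairs m" for j
    using osc_pairs_nonempty[OF m] by (rule from_nat_into)
  then show ?thesis by (induction j) (auto intro: o)
qed

text \<open>For permutation sums every stage is below \<open>osc_bound\<close>, and the stage is a
  bounded continuous function of finitely many coordinates, so the bound survives in the limit. It
  does not depend on \<open>j\<close>.\<close>

lemma run_max_Z:
  assumes m: "0 < m"
  shows "(\<integral>\<omega>. run_max m j (Z \<omega>) \<partial>white_noise) \<le> eps m"
proof (rule field_le_epsilon)
  fix \<delta> :: real assume \<delta>: "0 < \<delta>"
  obtain T where T: "finite T" "\<forall>x y. (\<forall>i\<in>T. x i = y i) \<longrightarrow> run_max m j x = run_max m j y"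
    using run_max_depends[of m j] by blast
  have le1: "\<bar>run_max m j x\<bar> \<le> 1" for x using run_max_range[of m j x] by simp
  have lim: "(\<lambda>n. perm_mean {1..n} (\<lambda>p. run_max m j (X n p))) \<longlonglongrightarrow> (\<integral>\<omega>. run_max m j (Z \<omega>) \<partial>white_noise)"
  proof (rule finite_dimensional_limit[of T "run_max m j" 1])
    show "run_max m j x = run_max m j y" if "\<And>i. i \<in> T \<Longrightarrow> x i = y i" for x y
      by (rule T(2)[rule_format]) (rule that)
  qed (rule T(1) run_max_continuous le1)+
  show "(\<integral>\<omega>. run_max m j (Z \<omega>) \<partial>white_noise) \<le> eps m + \<delta>"
  proof (rule tendsto_upperbound[OF lim])
    show "\<forall>\<^sub>F n in sequentially. perm_mean {1..n} (\<lambda>p. run_max m j (X n p)) \<le> eps m + \<delta>"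
      using osc_bound_mean_eventually[OF m \<delta>]
    proof eventually_elim
      case (elim n)
      have "perm_mean {1..n} (\<lambda>p. run_max m j (X n p)) \<le> perm_mean {1..n} (osc_bound n m)"
        by (intro perm_mean_mono run_max_le_osc_bound m)
      then show ?case using elim by simp
    qed
  qed simp
qed

section \<open>Almost sure uniform continuity at rational times\<close>

definition good :: "(real \<Rightarrow> real) \<Rightarrow> bool" where
  "good \<omega> \<longleftrightarrow> (\<forall>N::nat. \<exists>m. 0 < m \<and> (\<forall>j. run_max m j (Z \<omega>) < 1 / (real N + 1)))"

lemma good_measurable [measurable]: "Measurable.pred white_noise good"
  unfolding good_def by measurable

text \<open>For fixed mesh Markov's inequality bounds the exceedance probability of every stage by
  \<open>eps m / \<eta>\<close>, and the stages increase, so the bound holds for their union. A path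
  failing for every mesh lies in all these unions, while \<open>eps m\<close> tends to zero.\<close>

lemma AE_good: "AE \<omega> in white_noise. good \<omega>"
proof -
  have "AE \<omega> in white_noise. \<exists>m. 0 < m \<and> (\<forall>j. run_max m j (Z \<omega>) < 1 / (real N + 1))" for N :: nat
  proof -
    define \<eta> where "\<eta> = 1 / (real N + 1)"
    have \<eta>: "0 < \<eta>" by (simp add: \<eta>_def)
    let ?B = "{\<omega> \<in> space white_noise. \<not> (\<exists>m. 0 < m \<and> (\<forall>j. run_max m j (Z \<omega>) < \<eta>))}"
    have le: "noise.prob ?B \<le> eps m / \<eta>" if m: "0 < m" for m
    proof -
      let ?A = "\<lambda>j. {\<omega> \<in> space white_noise. \<eta> \<le> run_max m j (Z \<omega>)}"
      have A: "?A j \<in> sets white_noise" for j by measurable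
      have inc: "incseq ?A"
        by (auto simp: incseq_def intro: order_trans[OF _ run_max_mono])
      have PA: "noise.prob (?A j) \<le> eps m / \<eta>" for j
      proof -
        have "noise.prob (?A j) \<le> (\<integral>\<omega>. run_max m j (Z \<omega>) \<partial>white_noise) / \<eta>"
          using run_max_range \<eta>
          by (intro integral_Markov_inequality_measure[where A = "{}"] noise.integrable_bounded[where B = 1])
             (auto simp: abs_le_iff intro: order_trans[of _ 0])
        also have "\<dots> \<le> eps m / \<eta>" using run_max_Z[OF m] \<eta> by (intro divide_right_mono) auto
        finally show ?thesis .
      qed
      have "noise.prob (\<Union>j. ?A j) \<le> eps m / \<eta>"
        by (rule LIMSEQ_le_const2[OF noise.finite_Lim_measure_incseq]) (use A inc PA in auto)
      moreover have "noise.prob ?B \<le> noise.prob (\<Union>j. ?A j)"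
        using m A by (intro noise.finite_measure_mono) (auto simp: not_less dest!: spec[of _ m])
      ultimately show ?thesis by simp
    qed
    have "noise.prob ?B \<le> 0"
    proof (rule LIMSEQ_le_const)
      show "(\<lambda>m. eps m / \<eta>) \<longlonglongrightarrow> 0" using tendsto_divide[OF eps_lim tendsto_const, of \<eta>] \<eta> by simp
      show "\<exists>N. \<forall>n\<ge>N. noise.prob ?B \<le> eps n / \<eta>" using le by (intro exI[of _ 1]) auto
    qed
    then have P0: "noise.prob ?B = 0" by (simp add: measure_le_0_iff)
    have "?B \<in> sets white_noise" by measurable
    then have "AE \<omega> in white_noise. \<not> \<not> (\<exists>m. 0 < m \<and> (\<forall>j. run_max m j (Z \<omega>) < \<eta>))"
      using P0 by (rule noise.prob_Collect_eq_0[THEN iffD1])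
    then show ?thesis by (simp add: \<eta>_def)
  qed
  then show ?thesis unfolding good_def by (subst AE_all_countable) auto
qed

lemma good_modulus:
  assumes "good \<omega>" and e: "0 < e"
  obtains m where "0 < m"
    "\<And>k q. k < m \<Longrightarrow> real k / m \<le> of_rat q \<Longrightarrow> of_rat q \<le> real (Suc k) / m \<Longrightarrow> \<bar>Z \<omega> q - Z \<omega> (grid m k)\<bar> < e"
proof -
  obtain N :: nat where N: "1 / min 1 (e ^ 4) < N" using reals_Archimedean2 by blast
  have "\<exists>m. 0 < m \<and> (\<forall>j. run_max m j (Z \<omega>) < 1 / (real N + 1))"
    using assms(1) unfolding good_def ..
  then obtain m where m: "0 < m" "\<And>j. run_max m j (Z \<omega>) < 1 / (real N + 1)" by auto
  have e4: "0 < min 1 (e ^ 4)" using e by simp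
  have "x \<noteq> 0 \<Longrightarrow> 1 / x < real N \<Longrightarrow> 0 < x \<Longrightarrow> 1 / (real N + 1) \<le> x" for x :: real
    by (simp add: field_simps)
  from this[OF _ N e4] e4 have le: "1 / (real N + 1) \<le> min 1 (e ^ 4)" by (metis less_numeral_extra(3))
  have m': "run_max m j (Z \<omega>) < min 1 (e ^ 4)" for j by (rule less_le_trans[OF m(2) le])
  show ?thesis
  proof
    show "0 < m" by fact
    fix k q assume kq: "k < m" "real k / m \<le> of_rat q" "of_rat q \<le> real (Suc k) / m"
    then have "(k, q) \<in> osc_pairs m" by (simp add: osc_pairs_def)
    then have "\<exists>j. from_nat_into (osc_pairs m) j = (k, q)"
      by (rule from_nat_into_surj[OF countableI_type])
    then obtain j where j: "from_nat_into (osc_pairs m) j = (k, q)" ..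
    have "osc m (k, q) (Z \<omega>) < min 1 (e ^ 4)"
      using osc_le_run_max[of m j "Z \<omega>"] m'[of j] by (simp add: j)
    then have "min 1 ((Z \<omega> q - Z \<omega> (grid m k)) ^ 4) < min 1 (e ^ 4)" unfolding osc_def by simp
    moreover have "x < y" if "min 1 x < min 1 y" for x y :: real
      using that by (auto simp: min_def split: if_splits)
    ultimately have "(Z \<omega> q - Z \<omega> (grid m k)) ^ 4 < e ^ 4" by blast
    then have "\<bar>Z \<omega> q - Z \<omega> (grid m k)\<bar> ^ 4 < e ^ 4" by (simp add: power_even_abs)
    then show "\<bar>Z \<omega> q - Z \<omega> (grid m k)\<bar> < e"
      by (rule power_less_imp_less_base) (use e in simp)
  qed
qed

text \<open>Two points closer than the mesh lie in the same cell or in neighbouring cells, so at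
  most three comparisons with left endpoints are needed, each costing \<open>e / 3\<close>.\<close>

lemma good_uniformly_continuous:
  assumes g: "good \<omega>" and e: "0 < e"
  shows "\<exists>d>0. \<forall>q r. (of_rat q :: real) \<in> {0..1} \<longrightarrow> (of_rat r :: real) \<in> {0..1} \<longrightarrow> \<bar>of_rat q - of_rat r :: real\<bar> < d \<longrightarrow>
    \<bar>Z \<omega> q - Z \<omega> r\<bar> < e"
proof -
  have e3: "0 < e / 3" using e by simp
  obtain m where m: "0 < m" and mo: "\<And>k q. k < m \<Longrightarrow> real k / m \<le> of_rat q \<Longrightarrow> of_rat q \<le> real (Suc k) / m
      \<Longrightarrow> \<bar>Z \<omega> q - Z \<omega> (grid m k)\<bar> < e / 3"
    using good_modulus[OF g e3] by blast
  have mr: "0 < real m" using m by simp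
  have main: "\<bar>Z \<omega> q - Z \<omega> r\<bar> < e"
    if qr: "(of_rat q :: real) \<in> {0..1}" "(of_rat r :: real) \<in> {0..1}" "(of_rat q :: real) \<le> of_rat r"
      "of_rat r - of_rat q < 1 / real m" for q r
  proof -
    obtain k where k: "k < m" "real k / m \<le> of_rat q" "of_rat q \<le> real (Suc k) / m"
    proof (cases "(of_rat q :: real) = 1")
      \<comment> \<open>At the right end the floor would give the cell number \<open>m\<close>; the
        point belongs to the last cell instead.\<close>
      case True
      then show ?thesis using m by (intro that[of "m - 1"]) (auto simp: of_nat_diff field_simps)
    next
      case False
      let ?k = "nat \<lfloor>real m * of_rat q\<rfloor>"
      have nn: "0 \<le> real m * of_rat q" using qr mr by simp
      have k1: "real ?k \<le> real m * of_rat q" using nn by (simp add: of_nat_nat)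
      have k2: "real m * of_rat q \<le> real (Suc ?k)" using nn by (simp add: of_nat_nat) linarith
      have "real m * of_rat q < real m" using qr False mr by simp
      then have "?k < m" using k1 by linarith
      then show ?thesis using k1 k2 mr by (intro that[of ?k]) (auto simp: field_simps)
    qed
    show ?thesis
    proof (cases "of_rat r \<le> real (Suc k) / m")
      case True
      then have "\<bar>Z \<omega> r - Z \<omega> (grid m k)\<bar> < e / 3" using k qr(3) by (intro mo) auto
      then show ?thesis using mo[OF k] by linarith
    next
      case False
      have "of_rat r < real (Suc k) / m + 1 / m" using k(3) qr(4) by linarith
      then have r2: "of_rat r \<le> real (Suc (Suc k)) / m" by (simp add: add_divide_distrib)
      have "real (Suc k) / m < 1" using False qr(2) unfolding atLeastAtMost_iff by linarith
      then have Sk: "Suc k < m" using mr by (simp add: divide_less_eq)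
      have 1: "\<bar>Z \<omega> r - Z \<omega> (grid m (Suc k))\<bar> < e / 3" using False r2 Sk by (intro mo) auto
      have 2: "\<bar>Z \<omega> (grid m (Suc k)) - Z \<omega> (grid m k)\<bar> < e / 3"
      proof (rule mo[OF k(1)])
        show "real k / m \<le> of_rat (grid m (Suc k))" "of_rat (grid m (Suc k)) \<le> real (Suc k) / m"
          unfolding of_rat_grid by (auto simp: divide_right_mono)
      qed
      show ?thesis using mo[OF k] 1 2 by linarith
    qed
  qed
  show ?thesis
  proof (intro exI[of _ "1 / real m"] conjI allI impI)
    fix q r assume *: "(of_rat q :: real) \<in> {0..1}" "(of_rat r :: real) \<in> {0..1}" "\<bar>of_rat q - of_rat r :: real\<bar> < 1 / m"
    show "\<bar>Z \<omega> q - Z \<omega> r\<bar> < e"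
    proof (cases "(of_rat q :: real) \<le> of_rat r")
      case True then show ?thesis using * by (intro main) auto
    next
      case False then show ?thesis using * main[of r q] by (auto simp: abs_minus_commute)
    qed
  qed (use mr in auto)
qed

section \<open>Extension from rational to real times\<close>

definition below :: "nat \<Rightarrow> real \<Rightarrow> rat" where
  "below m t = grid m (idx m t)"

lemma below_bounds:
  assumes "0 < m" "t \<in> {0..1}"
  shows "(of_rat (below m t) :: real) \<in> {0..1}" "of_rat (below m t) \<le> t" "t - of_rat (below m t) \<le> 1 / m"
proof -
  have m: "0 < real m" and nn: "0 \<le> real m * t" using assms by auto
  have r: "(of_rat (below m t) :: real) = real (idx m t) / m" unfolding below_def by (rule of_rat_grid)
  have 1: "real (idx m t) \<le> real m * t" using nn by (simp add: idx_def of_nat_nat)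
  have 2: "real m * t \<le> real (idx m t) + 1" using nn by (simp add: idx_def of_nat_nat)
  show le: "of_rat (below m t) \<le> t" unfolding r using 1 m by (simp add: divide_le_eq mult.commute)
  show "t - of_rat (below m t) \<le> 1 / m"
  proof -
    have "t \<le> (real (idx m t) + 1) / m" using 2 m by (simp add: le_divide_eq mult.commute)
    then show ?thesis unfolding r by (simp add: add_divide_distrib)
  qed
  show "(of_rat (below m t) :: real) \<in> {0..1}" using assms idx_le[of t m] unfolding r by simp
qed

lemma below_tendsto:
  assumes t: "t \<in> {0..1}"
  shows "(\<lambda>m. of_rat (below (Suc m) t) :: real) \<longlonglongrightarrow> t"
proof -
  have "\<forall>m. \<bar>of_rat (below (Suc m) t) - t\<bar> \<le> inverse (real (Suc m))"
    using below_bounds[OF _ t] by (auto simp: abs_le_iff inverse_eq_divide simp del: of_nat_Suc)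
  then have "(\<lambda>m. of_rat (below (Suc m) t) - t) \<longlonglongrightarrow> 0"
    by (intro Lim_null_comparison[OF _ LIMSEQ_inverse_real_of_nat]) auto
  then show ?thesis by (rule LIM_zero_cancel)
qed

text \<open>\<open>Suc m\<close> excludes the mesh number 0. Off the good event the path is set to
  zero, so that continuity holds for every sample point and not only almost surely.\<close>

definition Zpath :: "real \<Rightarrow> (real \<Rightarrow> real) \<Rightarrow> real" where
  "Zpath t \<omega> = (if good \<omega> then lim (\<lambda>m. Z \<omega> (below (Suc m) t)) else 0)"

lemma Zpath_extends:
  assumes g: "good \<omega>"
  shows "continuous_on {0..1} (\<lambda>t. Zpath t \<omega>)"
    and "(of_rat q :: real) \<in> {0..1} \<Longrightarrow> Zpath (of_rat q) \<omega> = Z \<omega> q"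
    and "t \<in> {0..1} \<Longrightarrow> (\<lambda>m. Z \<omega> (below (Suc m) t)) \<longlonglongrightarrow> Zpath t \<omega>"
proof -
  let ?D = "{x. \<exists>q. x = of_rat q \<and> (of_rat q :: real) \<in> {0..1}} :: real set"
  \<comment> \<open>The description is well defined because \<open>of_rat\<close> is
    injective.\<close>
  define z where "z x = Z \<omega> (THE q. x = of_rat q)" for x :: real
  have z: "z (of_rat q) = Z \<omega> q" for q by (simp add: z_def)
  have uc: "uniformly_continuous_on ?D z"
    unfolding uniformly_continuous_on_def
  proof (intro allI impI)
    fix e :: real assume "0 < e"
    then obtain d where d: "0 < d" "\<And>q r. (of_rat q :: real) \<in> {0..1} \<Longrightarrow> (of_rat r :: real) \<in> {0..1} \<Longrightarrow>
        \<bar>of_rat q - of_rat r :: real\<bar> < d \<Longrightarrow> \<bar>Z \<omega> q - Z \<omega> r\<bar> < e"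
      using good_uniformly_continuous[OF g] by metis
    show "\<exists>d>0. \<forall>x\<in>?D. \<forall>x'\<in>?D. dist x' x < d \<longrightarrow> dist (z x') (z x) < e"
      using d by (intro exI[of _ d]) (auto simp: z dist_real_def)
  qed
  obtain c where c: "uniformly_continuous_on (closure ?D) c" "\<And>x. x \<in> ?D \<Longrightarrow> z x = c x"
    by (rule uniformly_continuous_on_extension_on_closure[OF uc], rule that)
  have sub: "{0..1} \<subseteq> closure ?D"
  proof
    fix t :: real assume t: "t \<in> {0..1}"
    have "\<forall>m. of_rat (below (Suc m) t) \<in> ?D" using below_bounds(1)[OF _ t] by blast
    then show "t \<in> closure ?D" unfolding closure_sequential using below_tendsto[OF t]
      by (intro exI[of _ "\<lambda>m. of_rat (below (Suc m) t)"] conjI)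
  qed
  have cc: "continuous_on {0..1} c"
    using uniformly_continuous_imp_continuous[OF c(1)] sub by (rule continuous_on_subset)
  have cq: "c (of_rat q) = Z \<omega> q" if "(of_rat q :: real) \<in> {0..1}" for q
    using c(2)[of "of_rat q"] that z by auto
  have lim: "(\<lambda>m. Z \<omega> (below (Suc m) t)) \<longlonglongrightarrow> c t" if t: "t \<in> {0..1}" for t
  proof -
    have "(\<lambda>m. c (of_rat (below (Suc m) t))) \<longlonglongrightarrow> c t"
      using below_bounds(1)[OF _ t] t
      by (intro continuous_on_tendsto_compose[OF cc below_tendsto[OF t]]) auto
    then show ?thesis using below_bounds(1)[OF _ t] by (simp add: cq)
  qed
  have path: "Zpath t \<omega> = c t" if "t \<in> {0..1}" for t
    using g lim[OF that] by (simp add: Zpath_def limI)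
  show "continuous_on {0..1} (\<lambda>t. Zpath t \<omega>)"
    using cc by (rule continuous_on_eq) (simp add: path)
  show "Zpath (of_rat q) \<omega> = Z \<omega> q" if "(of_rat q :: real) \<in> {0..1}" using that by (simp add: path cq)
  show "(\<lambda>m. Z \<omega> (below (Suc m) t)) \<longlonglongrightarrow> Zpath t \<omega>" if "t \<in> {0..1}" using lim[OF that] by (simp add: path[OF that])
qed

lemma Zpath_continuous: "continuous_on {0..1} (\<lambda>t. Zpath t \<omega>)"
proof (cases "good \<omega>")
  case False
  then show ?thesis by (simp add: Zpath_def)
qed (rule Zpath_extends)

lemma Zpath_measurable [measurable]:
  assumes t: "t \<in> {0..1}"
  shows "Zpath t \<in> borel_measurable white_noise"
proof (rule borel_measurable_LIMSEQ_real)
  show "(\<lambda>m. if good \<omega> then Z \<omega> (below (Suc m) t) else 0) \<longlonglongrightarrow> Zpath t \<omega>" for \<omega>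
    using Zpath_extends(3)[OF _ t] by (cases "good \<omega>") (auto simp: Zpath_def)
  show "(\<lambda>\<omega>. if good \<omega> then Z \<omega> (below (Suc m) t) else 0) \<in> borel_measurable white_noise" for m
    by measurable
qed

end

section \<open>Skorohod continuous functionals\<close>

lemma idx_right_const:
  assumes "0 \<le> t" "t < 1"
  shows "\<exists>b>t. \<forall>u. t < u \<longrightarrow> u < b \<longrightarrow> idx m u = idx m t \<and> u \<in> {0..1}"
proof (cases "m = 0")
  case True
  then show ?thesis using assms by (intro exI[of _ 1]) (auto simp: idx_def)
next
  case False
  let ?b = "min 1 ((of_int \<lfloor>real m * t\<rfloor> + 1) / real m)"
  have m: "0 < real m" using False by simp
  have "real m * t < of_int \<lfloor>real m * t\<rfloor> + 1" by linarith
  then have "t < ?b" using assms m by (simp add: less_divide_eq mult.commute)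
  moreover have "idx m u = idx m t" if u: "t < u" "u < ?b" for u
  proof -
    have 1: "of_int \<lfloor>real m * t\<rfloor> \<le> real m * u"
      using u(1) m by (intro order_trans[OF of_int_floor_le] mult_left_mono) auto
    have 2: "real m * u < of_int \<lfloor>real m * t\<rfloor> + 1"
      using u(2) m by (simp add: less_divide_eq mult.commute)
    have "\<lfloor>real m * u\<rfloor> = \<lfloor>real m * t\<rfloor>" using 1 2 by (rule floor_unique)
    then show ?thesis by (simp add: idx_def)
  qed
  ultimately show ?thesis using assms by (intro exI[of _ ?b]) auto
qed

lemma idx_left_const:
  assumes "0 < t" "t \<le> 1"
  shows "\<exists>a<t. \<exists>k. \<forall>u. a < u \<longrightarrow> u < t \<longrightarrow> idx m u = k \<and> u \<in> {0..1}"
proof (cases "m = 0")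
  case True
  then show ?thesis using assms by (intro exI[of _ 0]) (auto simp: idx_def)
next
  case False
  \<comment> \<open>The value of the floor immediately to the left of \<open>t\<close>, correct also
    when \<open>real m * t\<close> is an integer.\<close>
  let ?c = "\<lceil>real m * t\<rceil> - 1"
  let ?a = "max 0 (of_int ?c / real m)"
  have m: "0 < real m" using False by simp
  have "of_int ?c < real m * t" by linarith
  then have "?a < t" using assms m by (simp add: divide_less_eq mult.commute)
  moreover have "idx m u = nat ?c" if u: "?a < u" "u < t" for u
  proof -
    have 1: "of_int ?c \<le> real m * u" using u(1) m by (simp add: divide_less_eq mult.commute)
    have "real m * u < real m * t" using u m by simp
    also have "\<dots> \<le> of_int ?c + 1" by linarith
    finally have "\<lfloor>real m * u\<rfloor> = ?c" using 1 by (intro floor_unique) auto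
    then show ?thesis by (simp add: idx_def)
  qed
  ultimately show ?thesis using assms by (intro exI[of _ ?a]) auto
qed

lemma step_in_cadlag_space: "(\<lambda>t\<in>{0..1}. c (idx m t)) \<in> cadlag_space"
  unfolding cadlag_space_def
proof (intro CollectI conjI ballI)
  show "(\<lambda>t\<in>{0..1}. c (idx m t)) \<in> extensional {0..1}" by simp
  fix t :: real
  show "((\<lambda>t\<in>{0..1}. c (idx m t)) \<longlongrightarrow> (\<lambda>t\<in>{0..1}. c (idx m t)) t) (at_right t)" if t: "t \<in> {0..<1}"
  proof (rule tendsto_eventually)
    obtain b where "t < b" "\<And>u. t < u \<Longrightarrow> u < b \<Longrightarrow> idx m u = idx m t \<and> u \<in> {0..1}"
      using idx_right_const[of t m] t by auto
    then show "\<forall>\<^sub>F u in at_right t. (\<lambda>t\<in>{0..1}. c (idx m t)) u = (\<lambda>t\<in>{0..1}. c (idx m t)) t"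
      unfolding eventually_at_right_field using t by (intro exI[of _ b]) auto
  qed
  show "\<exists>l. ((\<lambda>t\<in>{0..1}. c (idx m t)) \<longlongrightarrow> l) (at_left t)" if t: "t \<in> {0<..1}"
  proof -
    obtain a k where "a < t" "\<And>u. a < u \<Longrightarrow> u < t \<Longrightarrow> idx m u = k \<and> u \<in> {0..1}"
      using idx_left_const[of t m] t by auto
    then have "\<forall>\<^sub>F u in at_left t. (\<lambda>t\<in>{0..1}. c (idx m t)) u = c k"
      unfolding eventually_at_left_field by (intro exI[of _ a]) auto
    then show ?thesis by (intro exI tendsto_eventually)
  qed
qed

lemma continuous_in_cadlag_space:
  assumes "continuous_on {0..1} c"
  shows "restrict c {0..1} \<in> cadlag_space"
proof -
  let ?c = "restrict c {0..1}"
  have cont: "continuous_on {0..1} ?c" using assms by (rule continuous_on_eq) simp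
  have right: "(?c \<longlongrightarrow> ?c t) (at_right t)" if t: "t \<in> {0..<1}" for t
  proof -
    have "(?c \<longlongrightarrow> ?c t) (at t within {0..1})" using cont t unfolding continuous_on_def by auto
    then have "(?c \<longlongrightarrow> ?c t) (at t within {t..1})" by (rule tendsto_within_subset) (use t in auto)
    then show ?thesis using t by (simp add: at_within_Icc_at_right)
  qed
  have left: "(?c \<longlongrightarrow> ?c t) (at_left t)" if t: "t \<in> {0<..1}" for t
  proof -
    have "(?c \<longlongrightarrow> ?c t) (at t within {0..1})" using cont t unfolding continuous_on_def by auto
    then have "(?c \<longlongrightarrow> ?c t) (at t within {0..t})" by (rule tendsto_within_subset) (use t in auto)
    then show ?thesis using t by (simp add: at_within_Icc_at_left)
  qed
  show ?thesis unfolding cadlag_space_def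
    by (intro CollectI conjI ballI exI, simp, erule right, erule left)
qed

lemma skorohod_dist_le:
  assumes "x \<in> cadlag_space" "y \<in> cadlag_space" "0 < e" "\<And>t. t \<in> {0..1} \<Longrightarrow> \<bar>x t - y t\<bar> \<le> e"
  shows "skorohod_dist x y \<le> e"
proof -
  have "skorohod_close e x y"
    using assms(3,4) unfolding skorohod_close_def by (auto intro!: bexI[OF _ time_changes_id])
  moreover have "bdd_below {e. skorohod_close e x y}"
    by (rule bdd_belowI[of _ 0]) (auto simp: skorohod_close_def)
  ultimately show ?thesis using assms(1,2) by (auto simp: skorohod_dist_def intro: cInf_lower)
qed

lemma topspace_skorohod [simp]: "topspace skorohod_topology = cadlag_space"
  by (simp add: skorohod_topology_def)

lemma skorohod_openD:
  assumes "openin skorohod_topology U" "x \<in> U"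
  obtains r where "0 < r" "\<And>y. y \<in> cadlag_space \<Longrightarrow> skorohod_dist x y < r \<Longrightarrow> y \<in> U"
proof -
  obtain r where r: "0 < r" "Skorohod.mball x r \<subseteq> U"
    using assms unfolding skorohod_topology_def Skorohod.openin_mtopology by blast
  have "x \<in> cadlag_space" using assms openin_subset by fastforce
  then show ?thesis using r by (intro that[of r]) (auto simp: Skorohod.in_mball)
qed

text \<open>The uniform distance dominates the Skorohod distance, so functionals continuous for the
  latter can be tested on uniformly close paths.\<close>

lemma skorohod_continuous_sup_norm:
  assumes h: "continuous_map skorohod_topology euclideanreal h" and x: "x \<in> cadlag_space" and e: "0 < e"
  obtains \<delta> where "0 < \<delta>"
    "\<And>y. y \<in> cadlag_space \<Longrightarrow> (\<And>t. t \<in> {0..1} \<Longrightarrow> \<bar>x t - y t\<bar> \<le> \<delta>) \<Longrightarrow> \<bar>h x - h y\<bar> < e"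
proof -
  have "openin skorohod_topology {y \<in> topspace skorohod_topology. h y \<in> ball (h x) e}"
    using h by (rule openin_continuous_map_preimage) simp
  from skorohod_openD[OF this, of x] x e obtain r where r: "0 < r"
    "\<And>y. y \<in> cadlag_space \<Longrightarrow> skorohod_dist x y < r \<Longrightarrow> \<bar>h x - h y\<bar> < e"
    by (auto simp: dist_real_def)
  show ?thesis
  proof (rule that[of "r / 2"])
    show "\<bar>h x - h y\<bar> < e" if y: "y \<in> cadlag_space" "\<And>t. t \<in> {0..1} \<Longrightarrow> \<bar>x t - y t\<bar> \<le> r / 2" for y
    proof (rule r(2)[OF y(1)])
      have "skorohod_dist x y \<le> r / 2" using r(1) y by (intro skorohod_dist_le x) auto
      then show "skorohod_dist x y < r" using r(1) by simp
    qed
  qed (use r in simp)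
qed

section \<open>Step functions on a grid\<close>

definition grid_step :: "nat \<Rightarrow> (rat \<Rightarrow> real) \<Rightarrow> real \<Rightarrow> real" where
  "grid_step m y = (\<lambda>t\<in>{0..1}. y (grid m (idx m t)))"

lemma grid_step_in_cadlag_space: "grid_step m y \<in> cadlag_space"
  unfolding grid_step_def by (rule step_in_cadlag_space)

text \<open>A grid step function takes only the values at \<open>m + 1\<close> grid points, so
  closeness in those coordinates is uniform closeness of the paths. This makes the functional
  eligible for the finite-dimensional limit.\<close>

lemma continuous_grid_step:
  assumes h: "continuous_map skorohod_topology euclideanreal h"
  shows "continuous_on UNIV (\<lambda>y. h (grid_step m y))"
proof (rule continuous_at_imp_continuous_on, rule ballI)
  fix y0 :: "rat \<Rightarrow> real"
  show "isCont (\<lambda>y. h (grid_step m y)) y0"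
    unfolding isCont_def
  proof (rule tendstoI)
    fix e :: real assume e: "0 < e"
    obtain \<delta> where \<delta>: "0 < \<delta>" "\<And>y. y \<in> cadlag_space \<Longrightarrow> (\<And>t. t \<in> {0..1} \<Longrightarrow> \<bar>grid_step m y0 t - y t\<bar> \<le> \<delta>)
        \<Longrightarrow> \<bar>h (grid_step m y0) - h y\<bar> < e"
      using skorohod_continuous_sup_norm[OF h grid_step_in_cadlag_space e] by blast
    have "\<forall>\<^sub>F y in at y0. dist (y (grid m k)) (y0 (grid m k)) < \<delta>" for k
    proof -
      have "continuous_on UNIV (\<lambda>y :: rat \<Rightarrow> real. y (grid m k))" by (rule continuous_on_product_coordinates)
      then have "isCont (\<lambda>y :: rat \<Rightarrow> real. y (grid m k)) y0"
        unfolding continuous_on_eq_continuous_at[OF open_UNIV] by (rule bspec) simp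
      then show ?thesis using \<delta>(1) unfolding isCont_def by (rule tendstoD)
    qed
    then have "\<forall>\<^sub>F y in at y0. \<forall>k\<in>{..m}. dist (y (grid m k)) (y0 (grid m k)) < \<delta>"
      by (intro eventually_ball_finite) auto
    then show "\<forall>\<^sub>F y in at y0. dist (h (grid_step m y)) (h (grid_step m y0)) < e"
    proof eventually_elim
      case (elim y)
      have "\<bar>h (grid_step m y0) - h (grid_step m y)\<bar> < e"
      proof (rule \<delta>(2)[OF grid_step_in_cadlag_space])
        fix t :: real assume t: "t \<in> {0..1}"
        then have "idx m t \<le> m" by (intro idx_le) auto
        then show "\<bar>grid_step m y0 t - grid_step m y t\<bar> \<le> \<delta>"
          using elim t by (auto simp: grid_step_def dist_real_def abs_minus_commute less_imp_le)
      qed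
      then show ?case by (simp add: dist_real_def abs_minus_commute)
    qed
  qed
qed

lemma grid_step_depends:
  assumes "\<And>i. i \<in> grid m ` {..m} \<Longrightarrow> x i = y i"
  shows "grid_step m x = grid_step m y"
  unfolding grid_step_def using assms idx_le by (intro restrict_ext) auto

section \<open>Measurability into the Skorohod space\<close>

lemma space_borel_sets_of [simp]: "space (borel_sets_of T) = topspace T"
  unfolding borel_sets_of_def by (rule space_measure_of) (use openin_subset in auto)

lemma continuous_map_borel_measurable:
  assumes h: "continuous_map T euclideanreal h"
  shows "h \<in> borel_measurable (borel_sets_of T)"
proof (rule borel_measurableI)
  fix S :: "real set" assume "open S"
  then have "openin T {x \<in> topspace T. h x \<in> S}" using h by (intro openin_continuous_map_preimage) auto
  then have "{x \<in> topspace T. h x \<in> S} \<in> sets (borel_sets_of T)"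
    unfolding borel_sets_of_def using openin_subset by (subst sets_measure_of) auto
  then show "h -` S \<inter> space (borel_sets_of T) \<in> sets (borel_sets_of T)"
    by (simp add: Int_def vimage_def conj_commute)
qed

lemma open_grid_step_preimage:
  assumes "openin skorohod_topology U"
  shows "open {y. grid_step m y \<in> U}"
  unfolding open_subopen[of "{y. grid_step m y \<in> U}"]
proof
  fix y0 assume "y0 \<in> {y. grid_step m y \<in> U}"
  then obtain r where r: "0 < r" "\<And>y. y \<in> cadlag_space \<Longrightarrow> skorohod_dist (grid_step m y0) y < r \<Longrightarrow> y \<in> U"
    using skorohod_openD[OF assms] by blast
  let ?A = "\<Inter>k\<in>{..m}. {y :: rat \<Rightarrow> real. dist (y (grid m k)) (y0 (grid m k)) < r / 2}"
  have "open ?A"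
    by (intro open_INT ballI open_Collect_less continuous_intros continuous_on_product_coordinates) auto
  moreover have "y0 \<in> ?A" using r by simp
  moreover have "?A \<subseteq> {y. grid_step m y \<in> U}"
  proof
    fix y assume y: "y \<in> ?A"
    have "skorohod_dist (grid_step m y0) (grid_step m y) \<le> r / 2"
    proof (rule skorohod_dist_le[OF grid_step_in_cadlag_space grid_step_in_cadlag_space])
      fix t :: real assume t: "t \<in> {0..1}"
      then have "idx m t \<le> m" by (intro idx_le) auto
      then show "\<bar>grid_step m y0 t - grid_step m y t\<bar> \<le> r / 2"
        using y t by (auto simp: grid_step_def dist_real_def abs_minus_commute less_imp_le)
    qed (use r in simp)
    then show "y \<in> {y. grid_step m y \<in> U}" using r grid_step_in_cadlag_space by simp
  qed
  ultimately show "\<exists>T. open T \<and> y0 \<in> T \<and> T \<subseteq> {y. grid_step m y \<in> U}" by blast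
qed

text \<open>Since the grid approximations converge, membership of the limit in an open set is expressed by
  the closed sets of points at distance at least \<open>1 / j\<close> from the complement.\<close>

lemma measurable_grid_step_limit:
  assumes y [measurable]: "y \<in> borel_measurable N"
    and W: "\<And>\<omega>. \<omega> \<in> space N \<Longrightarrow> W \<omega> \<in> cadlag_space"
    and lim: "\<And>\<omega> e. \<omega> \<in> space N \<Longrightarrow> 0 < e \<Longrightarrow>
      \<exists>m0. \<forall>m\<ge>m0. \<forall>t\<in>{0..1}. \<bar>grid_step m (y \<omega>) t - W \<omega> t\<bar> \<le> e"
  shows "W \<in> measurable N (borel_sets_of skorohod_topology)"
  unfolding borel_sets_of_def
proof (rule measurable_measure_of)
  show "{U. openin skorohod_topology U} \<subseteq> Pow (topspace skorohod_topology)"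
    using openin_subset[of skorohod_topology] by blast
  show "W \<in> space N \<rightarrow> topspace skorohod_topology" using W by auto
  fix U assume "U \<in> {U. openin skorohod_topology U}"
  then have U: "openin skorohod_topology U" by simp
  have UD: "U \<subseteq> cadlag_space" using openin_subset[OF U] by simp
  define O' where "O' j = (\<Union>u\<in>cadlag_space - U. Skorohod.mball u (1 / real (Suc j)))" for j
  have Oopen: "openin skorohod_topology (O' j)" for j
    unfolding O'_def skorohod_topology_def by (intro openin_Union) auto
  have meas: "{\<omega> \<in> space N. grid_step m (y \<omega>) \<notin> O' j} \<in> sets N" for m j
  proof -
    have "{y. grid_step m y \<in> O' j} \<in> sets borel" using open_grid_step_preimage[OF Oopen] by simp
    then have "y -` {y. grid_step m y \<in> O' j} \<inter> space N \<in> sets N" by (rule measurable_sets[OF y])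
    then have "space N - (y -` {y. grid_step m y \<in> O' j} \<inter> space N) \<in> sets N" by (rule sets.compl_sets)
    also have "space N - (y -` {y. grid_step m y \<in> O' j} \<inter> space N) = {\<omega> \<in> space N. grid_step m (y \<omega>) \<notin> O' j}" by auto
    finally show ?thesis .
  qed
  have dist_lim: "\<exists>m0. \<forall>m\<ge>m0. skorohod_dist (grid_step m (y \<omega>)) (W \<omega>) \<le> e" if "\<omega> \<in> space N" "0 < e" for \<omega> e
    using lim[OF that] that W by (blast intro: skorohod_dist_le grid_step_in_cadlag_space)
  have iff: "W \<omega> \<in> U \<longleftrightarrow> (\<exists>j m0. \<forall>m\<ge>m0. grid_step m (y \<omega>) \<notin> O' j)" if \<omega>: "\<omega> \<in> space N" for \<omega>
  proof
    assume "W \<omega> \<in> U"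
    then obtain r where r: "0 < r" "\<And>x. x \<in> cadlag_space \<Longrightarrow> skorohod_dist (W \<omega>) x < r \<Longrightarrow> x \<in> U"
      using skorohod_openD[OF U] by blast
    obtain j where j: "1 / real (Suc j) < r / 2" using nat_approx_posE[of "r / 2"] r(1) by auto
    obtain m0 where m0: "\<And>m. m \<ge> m0 \<Longrightarrow> skorohod_dist (grid_step m (y \<omega>)) (W \<omega>) \<le> r / 2"
      using dist_lim[OF \<omega>, of "r / 2"] r(1) by auto
    have "grid_step m (y \<omega>) \<notin> O' j" if "m \<ge> m0" for m
    proof
      assume "grid_step m (y \<omega>) \<in> O' j"
      then obtain u where u: "u \<in> cadlag_space" "u \<notin> U" "skorohod_dist u (grid_step m (y \<omega>)) < 1 / real (Suc j)"
        by (auto simp: O'_def Skorohod.in_mball)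
      have "skorohod_dist (W \<omega>) u \<le> skorohod_dist (W \<omega>) (grid_step m (y \<omega>)) + skorohod_dist (grid_step m (y \<omega>)) u"
        by (rule Skorohod.triangle[OF W[OF \<omega>] grid_step_in_cadlag_space u(1)])
      also have "\<dots> < r"
        using m0[OF that] u(3) j Skorohod.commute[of "W \<omega>" "grid_step m (y \<omega>)"]
          Skorohod.commute[of u "grid_step m (y \<omega>)"] by linarith
      finally show False using r(2)[OF u(1)] u(2) by simp
    qed
    then show "\<exists>j m0. \<forall>m\<ge>m0. grid_step m (y \<omega>) \<notin> O' j" by blast
  next
    assume "\<exists>j m0. \<forall>m\<ge>m0. grid_step m (y \<omega>) \<notin> O' j"
    then obtain j m0 where jm: "\<And>m. m \<ge> m0 \<Longrightarrow> grid_step m (y \<omega>) \<notin> O' j" by blast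
    obtain m1 where m1: "\<And>m. m \<ge> m1 \<Longrightarrow> skorohod_dist (grid_step m (y \<omega>)) (W \<omega>) \<le> 1 / (2 * real (Suc j))"
      using dist_lim[OF \<omega>, of "1 / (2 * real (Suc j))"] by auto
    let ?m = "max m0 m1"
    have "1 / (2 * real (Suc j)) < 1 / real (Suc j)" by (intro divide_strict_left_mono) auto
    then have "skorohod_dist (W \<omega>) (grid_step ?m (y \<omega>)) < 1 / real (Suc j)"
      using m1[of ?m] Skorohod.commute[of "W \<omega>" "grid_step ?m (y \<omega>)"] by simp
    then have "W \<omega> \<notin> U \<Longrightarrow> grid_step ?m (y \<omega>) \<in> O' j"
      using W[OF \<omega>] grid_step_in_cadlag_space by (auto simp: O'_def Skorohod.in_mball)
    then show "W \<omega> \<in> U" using jm[of ?m] by auto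
  qed
  have "W -` U \<inter> space N = (\<Union>j. \<Union>m0. \<Inter>m\<in>{m0..}. {\<omega> \<in> space N. grid_step m (y \<omega>) \<notin> O' j})"
    using iff by fastforce
  also have "\<dots> \<in> sets N" using meas by (intro sets.countable_UN sets.countable_INT') auto
  finally show "W -` U \<inter> space N \<in> sets N" .
qed

section \<open>Lipschitz minorants: the Pasch-Hausdorff envelope\<close>

definition lip_envelope :: "((real \<Rightarrow> real) \<Rightarrow> real) \<Rightarrow> nat \<Rightarrow> (real \<Rightarrow> real) \<Rightarrow> real" where
  "lip_envelope h k x = (INF y\<in>cadlag_space. h y + real k * skorohod_dist x y)"

context
  fixes h :: "(real \<Rightarrow> real) \<Rightarrow> real" and B :: real
  assumes B: "\<And>x. x \<in> cadlag_space \<Longrightarrow> \<bar>h x\<bar> \<le> B"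
begin

lemma cadlag_space_nonempty: "cadlag_space \<noteq> {}"
  using step_in_cadlag_space by blast

lemma lip_envelope_bdd: "bdd_below ((\<lambda>y. h y + real k * skorohod_dist x y) ` cadlag_space)"
proof (rule bdd_belowI2)
  fix y assume "y \<in> cadlag_space"
  then show "- B \<le> h y + real k * skorohod_dist x y"
    using B[of y] Skorohod.nonneg[of x y] by (smt (verit) mult_nonneg_nonneg of_nat_0_le_iff)
qed

lemma lip_envelope_le: "x \<in> cadlag_space \<Longrightarrow> lip_envelope h k x \<le> h x"
  unfolding lip_envelope_def
  by (rule cINF_lower2[OF lip_envelope_bdd, of x]) auto

lemma lip_envelope_ge: "- B \<le> lip_envelope h k x"
  unfolding lip_envelope_def
proof (rule cINF_greatest[OF cadlag_space_nonempty])
  fix y assume "y \<in> cadlag_space"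
  then show "- B \<le> h y + real k * skorohod_dist x y"
    using B[of y] Skorohod.nonneg[of x y] by (smt (verit) mult_nonneg_nonneg of_nat_0_le_iff)
qed

lemma lip_envelope_abs: "x \<in> cadlag_space \<Longrightarrow> \<bar>lip_envelope h k x\<bar> \<le> B"
  using lip_envelope_ge[of k x] lip_envelope_le[of x k] B[of x] by linarith

lemma lip_envelope_lipschitz_le:
  assumes x: "x \<in> cadlag_space" and x': "x' \<in> cadlag_space"
  shows "lip_envelope h k x - real k * skorohod_dist x x' \<le> lip_envelope h k x'"
  unfolding lip_envelope_def[of h k x']
proof (rule cINF_greatest[OF cadlag_space_nonempty])
  fix y assume y: "y \<in> cadlag_space"
  have "lip_envelope h k x \<le> h y + real k * skorohod_dist x y"
    unfolding lip_envelope_def using y by (rule cINF_lower[OF lip_envelope_bdd])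
  also have "real k * skorohod_dist x y \<le> real k * (skorohod_dist x x' + skorohod_dist x' y)"
    by (intro mult_left_mono Skorohod.triangle x x' y) simp
  finally show "lip_envelope h k x - real k * skorohod_dist x x' \<le> h y + real k * skorohod_dist x' y"
    by (simp add: distrib_left)
qed

lemma lip_envelope_lipschitz:
  assumes "x \<in> cadlag_space" "x' \<in> cadlag_space"
  shows "\<bar>lip_envelope h k x - lip_envelope h k x'\<bar> \<le> real k * skorohod_dist x x'"
  using lip_envelope_lipschitz_le[OF assms, of k] lip_envelope_lipschitz_le[OF assms(2,1), of k]
    Skorohod.commute[of x x'] by simp

text \<open>Near \<open>x\<close> continuity keeps \<open>h\<close> close to \<open>h x\<close>; far
  from \<open>x\<close> the penalty is at least \<open>k * r\<close>, which exceeds the oscillation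
  \<open>2 * B\<close> for large \<open>k\<close>.\<close>

lemma lip_envelope_tendsto:
  assumes h: "continuous_map skorohod_topology euclideanreal h" and x: "x \<in> cadlag_space"
  shows "(\<lambda>k. lip_envelope h k x) \<longlonglongrightarrow> h x"
proof (rule LIMSEQ_I)
  fix e :: real assume e: "0 < e"
  have "openin skorohod_topology {y \<in> topspace skorohod_topology. h y \<in> ball (h x) (e / 2)}"
    using h by (rule openin_continuous_map_preimage) simp
  from skorohod_openD[OF this, of x] x e obtain r where r: "0 < r"
    "\<And>y. y \<in> cadlag_space \<Longrightarrow> skorohod_dist x y < r \<Longrightarrow> \<bar>h x - h y\<bar> < e / 2"
    by (auto simp: dist_real_def)
  obtain k0 :: nat where k0: "2 * B / r < k0" using reals_Archimedean2 by blast
  have "norm (lip_envelope h k x - h x) < e" if k: "k \<ge> k0" for k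
  proof -
    have "h x - e / 2 \<le> lip_envelope h k x"
      unfolding lip_envelope_def
    proof (rule cINF_greatest[OF cadlag_space_nonempty])
      fix y assume y: "y \<in> cadlag_space"
      show "h x - e / 2 \<le> h y + real k * skorohod_dist x y"
      proof (cases "skorohod_dist x y < r")
        case True
        have "0 \<le> real k * skorohod_dist x y" by simp
        then show ?thesis using r(2)[OF y True] by linarith
      next
        case False
        have "2 * B / r \<le> real k" using k0 k by simp
        then have "2 * B \<le> real k * r" using r(1) by (simp add: pos_divide_le_eq)
        also have "\<dots> \<le> real k * skorohod_dist x y" using False by (intro mult_left_mono) auto
        finally show ?thesis using B[OF x] B[OF y] e by linarith
      qed
    qed
    then show ?thesis using lip_envelope_le[OF x, of k] e by (simp add: abs_if)
  qed
  then show "\<exists>no. \<forall>n\<ge>no. norm (lip_envelope h n x - h x) < e" by blast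
qed

end

lemma lipschitz_continuous_map:
  assumes lip: "\<And>x y. x \<in> cadlag_space \<Longrightarrow> y \<in> cadlag_space \<Longrightarrow> \<bar>\<phi> x - \<phi> y\<bar> \<le> K * skorohod_dist x y" and K: "0 \<le> K"
  shows "continuous_map skorohod_topology euclideanreal \<phi>"
  unfolding continuous_map_def
proof (intro conjI allI impI)
  fix S assume S: "openin euclideanreal S"
  have "\<exists>r>0. Skorohod.mball x r \<subseteq> {x \<in> cadlag_space. \<phi> x \<in> S}" if x: "x \<in> cadlag_space" "\<phi> x \<in> S" for x
  proof -
    \<comment> \<open>The radius will be \<open>e / (K + 1)\<close>, which also makes sense for
      \<open>K = 0\<close>.\<close>
    obtain e where e: "0 < e" "ball (\<phi> x) e \<subseteq> S" using S x by (auto simp: open_contains_ball)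
    have "\<phi> y \<in> S" if y: "y \<in> cadlag_space" "skorohod_dist x y < e / (K + 1)" for y
    proof -
      have "\<bar>\<phi> x - \<phi> y\<bar> \<le> K * skorohod_dist x y" by (rule lip[OF x(1) y(1)])
      also have "\<dots> \<le> (K + 1) * skorohod_dist x y" by (intro mult_right_mono) auto
      also have "\<dots> < e" using y(2) K by (simp add: less_divide_eq mult.commute)
      finally show ?thesis using e(2) by (auto simp: dist_real_def)
    qed
    then show ?thesis using e(1) K by (intro exI[of _ "e / (K + 1)"]) (auto simp: Skorohod.in_mball)
  qed
  then show "openin skorohod_topology {x \<in> topspace skorohod_topology. \<phi> x \<in> S}"
    unfolding topspace_skorohod unfolding skorohod_topology_def Skorohod.openin_mtopology by auto
qed auto

section \<open>Convergence in distribution\<close>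

context matrix_arrays
begin

lemma \<sigma>_zero:
  assumes "u \<in> {0..1}"
  shows "\<sigma> 0 u = 0"
proof -
  have "(\<lambda>n. G n (idx n 0) (idx n u)) \<longlonglongrightarrow> g 0 u" by (rule g_lim) (use assms in auto)
  then have "g 0 u = 0" by (simp add: G_def LIMSEQ_const_iff)
  then show ?thesis using assms f_0 by (simp add: \<sigma>_def)
qed

text \<open>Cauchy-Schwarz for the kernel, applied to an increment and a value: the variance of the
  increment is at most \<open>f t - f t'\<close>, that of the value at most \<open>f 1\<close>. Thus
  continuity of \<open>f\<close> alone gives continuity of the covariance.\<close>

lemma \<sigma>_increment:
  assumes t: "0 \<le> t'" "t' \<le> t" "t \<le> 1" and u: "u \<in> {0..1}"
  shows "\<bar>\<sigma> t u - \<sigma> t' u\<bar> \<le> sqrt ((f t - f t') * (f 1 + 1))"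
proof -
  define C where "C = f 1 + 1"
  define L where "L = \<sigma> t u - \<sigma> t' u"
  define V where "V = \<sigma> t' t' - 2 * \<sigma> t' t + \<sigma> t t"
  have C: "0 < C" using f_mono[of 0 1] f_0 by (simp add: C_def)
  have "\<sigma> u u \<le> f u" using increment_variance(2)[of 0 u] \<sigma>_zero[OF u] \<sigma>_zero[of 0] f_0 u by simp
  also have "f u \<le> C" using f_mono[of u 1] u by (simp add: C_def)
  finally have uC: "\<sigma> u u \<le> C" .
  have ne: "0 \<le> V + 2 * \<beta> * L + \<beta>\<^sup>2 * \<sigma> u u" for \<beta>
  proof -
    \<comment> \<open>The coefficients \<open>-1\<close>, \<open>1\<close>, \<open>\<beta>\<close>
      at the times \<open>t'\<close>, \<open>t\<close>, \<open>u\<close>; numerical labels allow the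
      times to coincide.\<close>
    define c where "c i = (if i = (0::nat) then -1 else if i = 1 then 1 else \<beta>)" for i
    define \<tau> where "\<tau> i = (if i = (0::nat) then t' else if i = 1 then t else u)" for i
    have "0 \<le> (\<Sum>q\<in>{0,1,2}. \<Sum>r\<in>{0,1,2}. c q * c r * \<sigma> (\<tau> q) (\<tau> r))"
      by (rule quadratic_form_nonneg) (use t u in \<open>auto simp: \<tau>_def\<close>)
    also have "\<dots> = V + 2 * \<beta> * L + \<beta>\<^sup>2 * \<sigma> u u"
      using \<sigma>_commute[of t' t] \<sigma>_commute[of t' u] \<sigma>_commute[of t u] t u
      by (simp add: c_def \<tau>_def V_def L_def power2_eq_square algebra_simps)
    finally show ?thesis .
  qed
  \<comment> \<open>The choice \<open>\<beta> = - (L / C)\<close> minimises the quadratic polynomial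
    with \<open>C\<close> in place of \<open>\<sigma> u u\<close>; the 1 in \<open>C\<close> allows
    the division.\<close>
  have "(L / C)\<^sup>2 * \<sigma> u u \<le> (L / C)\<^sup>2 * C" using uC by (rule mult_left_mono) simp
  then have "0 \<le> V - 2 * (L / C) * L + (L / C)\<^sup>2 * C" using ne[of "- (L / C)"] by simp
  also have "\<dots> = V - L\<^sup>2 / C" using C by (simp add: power2_eq_square field_simps)
  finally have "L\<^sup>2 \<le> V * C" using C by (simp add: field_simps)
  also have "\<dots> \<le> (f t - f t') * C"
    using increment_variance(2)[of t' t] t C unfolding V_def by (intro mult_right_mono) auto
  finally show ?thesis unfolding L_def C_def by (rule real_le_rsqrt[OF order_trans[rotated], simplified]) auto
qed

lemma \<sigma>_tendsto:
  assumes t: "t \<in> {0..1}" and u: "u \<in> {0..1}"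
    and T: "\<And>m. T m \<in> {0..1}" "\<And>m. T m \<le> t" "T \<longlonglongrightarrow> t" and U: "\<And>m. U m \<in> {0..1}" "\<And>m. U m \<le> u" "U \<longlonglongrightarrow> u"
  shows "(\<lambda>m. \<sigma> (T m) (U m)) \<longlonglongrightarrow> \<sigma> t u"
proof -
  let ?e = "\<lambda>m. sqrt ((f t - f (T m)) * (f 1 + 1)) + sqrt ((f u - f (U m)) * (f 1 + 1))"
  have fT: "(\<lambda>m. f (T m)) \<longlonglongrightarrow> f t" and fU: "(\<lambda>m. f (U m)) \<longlonglongrightarrow> f u"
    using T U t u by (auto intro!: continuous_on_tendsto_compose[OF f_cont])
  have "?e \<longlonglongrightarrow> sqrt ((f t - f t) * (f 1 + 1)) + sqrt ((f u - f u) * (f 1 + 1))"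
    by (intro tendsto_intros fT fU)
  then have e: "?e \<longlonglongrightarrow> 0" by simp
  have "norm (\<sigma> (T m) (U m) - \<sigma> t u) \<le> ?e m" for m
  proof -
    have 1: "\<bar>\<sigma> t (U m) - \<sigma> (T m) (U m)\<bar> \<le> sqrt ((f t - f (T m)) * (f 1 + 1))"
      using T(1)[of m] T(2)[of m] U(1)[of m] t by (intro \<sigma>_increment) auto
    have "\<bar>\<sigma> u t - \<sigma> (U m) t\<bar> \<le> sqrt ((f u - f (U m)) * (f 1 + 1))"
      using U(1)[of m] U(2)[of m] t u by (intro \<sigma>_increment) auto
    then have 2: "\<bar>\<sigma> t u - \<sigma> t (U m)\<bar> \<le> sqrt ((f u - f (U m)) * (f 1 + 1))"
      using \<sigma>_commute[OF t u] \<sigma>_commute[OF t U(1)[of m]] by simp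
    show ?thesis using 1 2 unfolding real_norm_def by linarith
  qed
  then have "(\<lambda>m. \<sigma> (T m) (U m) - \<sigma> t u) \<longlonglongrightarrow> 0"
    by (intro Lim_null_comparison[OF _ e]) auto
  then show ?thesis by (rule LIM_zero_cancel)
qed

end

section \<open>The law of the continuous process\<close>

context gaussian_limit
begin

text \<open>Distinct real times may round to the same rational, so \<open>q\<close> need not be
  injective and the coefficients are first collected over its fibres.\<close>

lemma Z_char_map:
  assumes T: "finite T"
  shows "(\<integral>\<omega>. iexp (\<Sum>t\<in>T. c t * Z \<omega> (q t)) \<partial>white_noise)
    = exp (- (\<Sum>t\<in>T. \<Sum>u\<in>T. c t * c u * \<sigma> (rat_time (q t)) (rat_time (q u))) / 2)"
proof -
  define d where "d r = (\<Sum>t | t \<in> T \<and> q t = r. c t)" for r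
  have g: "(\<Sum>r\<in>q ` T. d r * G r) = (\<Sum>t\<in>T. c t * G (q t))" for G
  proof -
    have "(\<Sum>t\<in>T. c t * G (q t)) = (\<Sum>r\<in>q ` T. \<Sum>t | t \<in> T \<and> q t = r. c t * G (q t))"
      by (rule sum.image_gen[OF T])
    also have "\<dots> = (\<Sum>r\<in>q ` T. d r * G r)"
      unfolding d_def sum_distrib_right by (intro sum.cong refl) auto
    finally show ?thesis by simp
  qed
  have "(\<Sum>i\<in>q ` T. \<Sum>j\<in>q ` T. d i * d j * \<sigma> (rat_time i) (rat_time j))
      = (\<Sum>i\<in>q ` T. d i * (\<Sum>j\<in>q ` T. d j * \<sigma> (rat_time i) (rat_time j)))"
    by (simp add: sum_distrib_left mult.assoc)
  also have "\<dots> = (\<Sum>t\<in>T. \<Sum>u\<in>T. c t * c u * \<sigma> (rat_time (q t)) (rat_time (q u)))"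
    unfolding g by (simp add: sum_distrib_left mult.assoc)
  finally show ?thesis using Z_char[of "q ` T" d] T unfolding g by simp
qed

text \<open>All times are rounded down to a finer and finer grid: dominated convergence handles the
  expectation, and \<open>\<sigma>_tendsto\<close>, made for approach from below, handles the
  covariance.\<close>

lemma Zpath_char:
  assumes T: "finite T" "T \<subseteq> {0..1}"
  shows "(\<integral>\<omega>. iexp (\<Sum>t\<in>T. c t * Zpath t \<omega>) \<partial>white_noise)
    = exp (- (\<Sum>t\<in>T. \<Sum>u\<in>T. c t * c u * \<sigma> t u) / 2)"
proof -
  let ?L = "\<lambda>m. \<integral>\<omega>. iexp (\<Sum>t\<in>T. c t * Z \<omega> (below (Suc m) t)) \<partial>white_noise"
  have m1: "(\<lambda>\<omega>. iexp (\<Sum>t\<in>T. c t * Zpath t \<omega>)) \<in> borel_measurable white_noise"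
  proof -
    have "(\<lambda>\<omega>. \<Sum>t\<in>T. c t * Zpath t \<omega>) \<in> borel_measurable white_noise"
      using T by (intro borel_measurable_sum borel_measurable_times Zpath_measurable) auto
    then show ?thesis by measurable
  qed
  have A: "?L \<longlonglongrightarrow> (\<integral>\<omega>. iexp (\<Sum>t\<in>T. c t * Zpath t \<omega>) \<partial>white_noise)"
  proof (rule integral_dominated_convergence[where w = "\<lambda>_. 1"])
    show "AE \<omega> in white_noise. (\<lambda>m. iexp (\<Sum>t\<in>T. c t * Z \<omega> (below (Suc m) t))) \<longlonglongrightarrow> iexp (\<Sum>t\<in>T. c t * Zpath t \<omega>)"
      using AE_good
    proof eventually_elim
      case (elim \<omega>)
      show ?case using T(2) by (intro tendsto_intros Zpath_extends(3)[OF elim]) auto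
    qed
    show "(\<lambda>\<omega>. iexp (\<Sum>t\<in>T. c t * Z \<omega> (below (Suc m) t))) \<in> borel_measurable white_noise" for m
      by measurable
    show "AE \<omega> in white_noise. norm (iexp (\<Sum>t\<in>T. c t * Z \<omega> (below (Suc m) t))) \<le> 1" for m
      by (intro AE_I2) (simp only: norm_exp_i_times order_refl)
  qed (rule m1 noise.integrable_const)+
  have L: "?L = (\<lambda>m. complex_of_real (exp (- (\<Sum>t\<in>T. \<Sum>u\<in>T. c t * c u * \<sigma> (of_rat (below (Suc m) t)) (of_rat (below (Suc m) u))) / 2)))"
  proof
    fix m
    have "rat_time (below (Suc m) t) = of_rat (below (Suc m) t)" if "t \<in> T" for t
      using that T(2) by (intro rat_time_id below_bounds) auto
    then show "?L m = complex_of_real (exp (- (\<Sum>t\<in>T. \<Sum>u\<in>T. c t * c u * \<sigma> (of_rat (below (Suc m) t)) (of_rat (below (Suc m) u))) / 2))"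
      unfolding Z_char_map[OF T(1)] by simp
  qed
  have C: "(\<lambda>m. complex_of_real (exp (- (\<Sum>t\<in>T. \<Sum>u\<in>T. c t * c u * \<sigma> (of_rat (below (Suc m) t)) (of_rat (below (Suc m) u))) / 2)))
      \<longlonglongrightarrow> complex_of_real (exp (- (\<Sum>t\<in>T. \<Sum>u\<in>T. c t * c u * \<sigma> t u) / 2))"
  proof (intro tendsto_of_real tendsto_exp tendsto_divide tendsto_minus tendsto_sum tendsto_mult tendsto_const)
    fix t u assume "t \<in> T" "u \<in> T"
    then have tu: "t \<in> {0..1}" "u \<in> {0..1}" using T by auto
    show "(\<lambda>m. \<sigma> (of_rat (below (Suc m) t)) (of_rat (below (Suc m) u))) \<longlonglongrightarrow> \<sigma> t u"
      by (rule \<sigma>_tendsto[OF tu below_bounds(1)[OF _ tu(1)] below_bounds(2)[OF _ tu(1)] below_tendsto[OF tu(1)]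
            below_bounds(1)[OF _ tu(2)] below_bounds(2)[OF _ tu(2)] below_tendsto[OF tu(2)]]) simp_all
  qed simp
  show ?thesis by (rule LIMSEQ_unique[OF A[unfolded L] C])
qed

lemma Zpath_comb_moments:
  fixes c :: "real \<Rightarrow> real"
  assumes T: "finite T" "T \<subseteq> {0..1}"
  defines "v \<equiv> (\<Sum>t\<in>T. \<Sum>u\<in>T. c t * c u * \<sigma> t u)"
  defines "S \<equiv> (\<lambda>\<omega>. \<Sum>t\<in>T. c t * Zpath t \<omega>)"
  shows "S \<in> borel_measurable white_noise" "0 \<le> v"
    "\<And>x. (\<integral>\<omega>. iexp (x * S \<omega>) \<partial>white_noise) = exp (- (v * x\<^sup>2) / 2)"
    "(\<integral>\<omega>. S \<omega> \<partial>white_noise) = 0" "(\<integral>\<omega>. (S \<omega>)\<^sup>2 \<partial>white_noise) = v"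
    "integrable white_noise (\<lambda>\<omega>. (S \<omega>)\<^sup>2)"
proof -
  show S: "S \<in> borel_measurable white_noise"
    unfolding S_def using T by (intro borel_measurable_sum borel_measurable_times Zpath_measurable) auto
  show v: "0 \<le> v" unfolding v_def using T by (intro quadratic_form_nonneg) auto
  show ch: "(\<integral>\<omega>. iexp (x * S \<omega>) \<partial>white_noise) = exp (- (v * x\<^sup>2) / 2)" for x
    using Zpath_char[OF T, of "\<lambda>t. x * c t"]
    by (simp add: S_def v_def sum_distrib_left power2_eq_square mult_ac)
  show "(\<integral>\<omega>. S \<omega> \<partial>white_noise) = 0" "(\<integral>\<omega>. (S \<omega>)\<^sup>2 \<partial>white_noise) = v" "integrable white_noise (\<lambda>\<omega>. (S \<omega>)\<^sup>2)"
    by (rule noise.gaussian_moments_from_char[OF S v ch])+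
qed

lemma gaussian_process_Zpath: "gaussian_process white_noise {0..1} Zpath"
  unfolding gaussian_process_def
proof (intro conjI allI impI)
  show "prob_space white_noise" by (rule prob_space_white_noise)
  fix T :: "real set" and c assume T: "finite T" "T \<subseteq> {0..1}"
  note M = Zpath_comb_moments[OF T, where c = c]
  show "gaussian_variable white_noise (\<lambda>\<omega>. \<Sum>t\<in>T. c t * Zpath t \<omega>)"
  proof (cases "(\<Sum>t\<in>T. \<Sum>u\<in>T. c t * c u * \<sigma> t u) = 0")
    case True
    have "AE \<omega> in white_noise. (\<Sum>t\<in>T. c t * Zpath t \<omega>) = 0"
      by (rule noise.AE_zero_from_char[OF M(1)]) (use M(3) True in simp)
    then show ?thesis unfolding gaussian_variable_def by (intro conjI disjI2 M(1) exI)
  next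
    case False
    then have v: "0 < (\<Sum>t\<in>T. \<Sum>u\<in>T. c t * c u * \<sigma> t u)" using M(2) by simp
    show ?thesis unfolding gaussian_variable_def
      using noise.distributed_normal_from_char[OF M(1) v M(3)] M(1) v real_sqrt_gt_zero by blast
  qed
qed

lemma Zpath_mean:
  assumes "t \<in> {0..1}"
  shows "(\<integral>\<omega>. Zpath t \<omega> \<partial>white_noise) = 0" "(\<integral>\<omega>. (Zpath t \<omega>)\<^sup>2 \<partial>white_noise) = \<sigma> t t"
    "integrable white_noise (\<lambda>\<omega>. (Zpath t \<omega>)\<^sup>2)"
  using Zpath_comb_moments(4-6)[of "{t}" "\<lambda>_. 1"] assms by auto

text \<open>Polarisation: the mixed moment follows from the variances of the two variables and of
  their sum. On the diagonal the set \<open>{t, u}\<close> collapses, hence the case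
  distinction.\<close>

lemma Zpath_covariance:
  assumes t: "t \<in> {0..1}" and u: "u \<in> {0..1}"
  shows "covariance white_noise (Zpath t) (Zpath u) = \<sigma> t u"
proof (cases "t = u")
  case True
  then show ?thesis using Zpath_mean[OF u] by (simp add: covariance_def power2_eq_square)
next
  case False
  have S: "(\<integral>\<omega>. (Zpath t \<omega> + Zpath u \<omega>)\<^sup>2 \<partial>white_noise) = \<sigma> t t + 2 * \<sigma> t u + \<sigma> u u"
    "integrable white_noise (\<lambda>\<omega>. (Zpath t \<omega> + Zpath u \<omega>)\<^sup>2)"
    using Zpath_comb_moments(5,6)[of "{t, u}" "\<lambda>_. 1"] False t u \<sigma>_commute[OF t u] by auto
  have "(\<integral>\<omega>. Zpath t \<omega> * Zpath u \<omega> \<partial>white_noise)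
      = (\<integral>\<omega>. ((Zpath t \<omega> + Zpath u \<omega>)\<^sup>2 - (Zpath t \<omega>)\<^sup>2 - (Zpath u \<omega>)\<^sup>2) / 2 \<partial>white_noise)"
    by (intro Bochner_Integration.integral_cong refl) (simp add: power2_sum)
  also have "\<dots> = ((\<sigma> t t + 2 * \<sigma> t u + \<sigma> u u) - \<sigma> t t - \<sigma> u u) / 2"
    using S Zpath_mean[OF t] Zpath_mean[OF u] by simp
  finally show ?thesis using Zpath_mean(1)[OF t] Zpath_mean(1)[OF u] by (simp add: covariance_def)
qed

section \<open>Random elements of the Skorohod space\<close>

definition W :: "(real \<Rightarrow> real) \<Rightarrow> real \<Rightarrow> real" where
  "W \<omega> = (\<lambda>t\<in>{0..1}. Zpath t \<omega>)"

definition Y :: "nat \<Rightarrow> (nat \<Rightarrow> nat) \<Rightarrow> real \<Rightarrow> real" where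
  "Y n p = (\<lambda>t\<in>{0..1}. partial_sum (b n) p (idx n t))"

text \<open>\<open>measurable_grid_step_limit\<close> asks for convergence at every sample point, so
  the values are set to zero where \<open>Zpath\<close> is.\<close>

definition Zg :: "(real \<Rightarrow> real) \<Rightarrow> rat \<Rightarrow> real" where
  "Zg \<omega> = (if good \<omega> then Z \<omega> else (\<lambda>_. 0))"

lemma W_in_cadlag_space: "W \<omega> \<in> cadlag_space"
  unfolding W_def by (rule continuous_in_cadlag_space[OF Zpath_continuous])

lemma Y_in_cadlag_space: "Y n p \<in> cadlag_space"
  unfolding Y_def by (rule step_in_cadlag_space)

lemma Zg_measurable [measurable]: "Zg \<in> borel_measurable white_noise"
  unfolding Zg_def by measurable

lemma grid_step_Zg_tendsto:
  assumes e: "0 < e"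
  shows "\<exists>m0. \<forall>m\<ge>m0. \<forall>t\<in>{0..1}. \<bar>grid_step m (Zg \<omega>) t - W \<omega> t\<bar> \<le> e"
proof (cases "good \<omega>")
  case False
  then show ?thesis using e by (auto simp: grid_step_def Zg_def W_def Zpath_def)
next
  case True
  have "uniformly_continuous_on {0..1} (\<lambda>t. Zpath t \<omega>)"
    by (rule compact_uniformly_continuous[OF Zpath_continuous]) simp
  then obtain d where d: "0 < d" "\<And>x y. x \<in> {0..1} \<Longrightarrow> y \<in> {0..1} \<Longrightarrow> dist y x < d \<Longrightarrow> dist (Zpath y \<omega>) (Zpath x \<omega>) < e"
    using e unfolding uniformly_continuous_on_def by meson
  obtain m0 :: nat where m0: "1 / d < m0" using reals_Archimedean2 by blast
  have m0pos: "0 < m0" using m0 d(1) by (cases m0) (auto simp: divide_less_0_iff not_less)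
  have "\<bar>grid_step m (Zg \<omega>) t - W \<omega> t\<bar> \<le> e" if m: "m \<ge> m0" and t: "t \<in> {0..1}" for m t
  proof -
    have mp: "0 < m" using m m0pos by simp
    note bel = below_bounds[OF mp t]
    have "1 / d < m" using m0 m by simp
    then have "1 / real m < d" using d(1) mp by (simp add: field_simps)
    then have "dist (of_rat (below m t)) t < d" using bel(2,3) by (simp add: dist_real_def)
    then have "dist (Zpath (of_rat (below m t)) \<omega>) (Zpath t \<omega>) < e" by (rule d(2)[OF t bel(1)])
    then show ?thesis
      using Zpath_extends(2)[OF True bel(1)] True t
      by (simp add: grid_step_def Zg_def W_def dist_real_def below_def)
  qed
  then show ?thesis by blast
qed

lemma W_measurable: "W \<in> measurable white_noise (borel_sets_of skorohod_topology)"
  by (rule measurable_grid_step_limit[OF Zg_measurable W_in_cadlag_space grid_step_Zg_tendsto])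

lemma continuous_grid_step_Zg_tendsto:
  assumes h: "continuous_map skorohod_topology euclideanreal h"
  shows "(\<lambda>m. h (grid_step m (Zg \<omega>))) \<longlonglongrightarrow> h (W \<omega>)"
proof (rule LIMSEQ_I)
  fix e :: real assume "0 < e"
  then obtain \<delta> where \<delta>: "0 < \<delta>"
    "\<And>y. y \<in> cadlag_space \<Longrightarrow> (\<And>t. t \<in> {0..1} \<Longrightarrow> \<bar>W \<omega> t - y t\<bar> \<le> \<delta>) \<Longrightarrow> \<bar>h (W \<omega>) - h y\<bar> < e"
    using skorohod_continuous_sup_norm[OF h W_in_cadlag_space] by blast
  obtain m0 where "\<forall>m\<ge>m0. \<forall>t\<in>{0..1}. \<bar>grid_step m (Zg \<omega>) t - W \<omega> t\<bar> \<le> \<delta>"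
    using grid_step_Zg_tendsto[OF \<delta>(1)] by blast
  then have "norm (h (grid_step m (Zg \<omega>)) - h (W \<omega>)) < e" if "m \<ge> m0" for m
    using that \<delta>(2)[OF grid_step_in_cadlag_space, of m "Zg \<omega>"] by (simp add: abs_minus_commute)
  then show "\<exists>no. \<forall>m\<ge>no. norm (h (grid_step m (Zg \<omega>)) - h (W \<omega>)) < e" by blast
qed

lemma grid_step_osc:
  assumes m: "0 < m" and t: "t \<in> {0..1}"
  shows "min 1 ((Y n p t - grid_step m (X n p) t) ^ 4) \<le> osc_bound n m p"
proof (cases "t = 1")
  \<comment> \<open>No cell starts at time 1; there the grid version is exact, because both sides
    are the full sum.\<close>
  case True
  have "rat_time (grid m m) = 1" using m by (subst rat_time_grid) auto
  then have "Y n p t = grid_step m (X n p) t" using True by (simp add: Y_def grid_step_def X_def)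
  then show ?thesis using osc_bound_summand_nonneg by (simp add: osc_bound_def sum_nonneg)
next
  case False
  let ?k = "idx m t"
  have mr: "0 < real m" and nn: "0 \<le> real m * t" using m t by auto
  have k1: "real ?k \<le> real m * t" using nn by (simp add: idx_def of_nat_nat)
  have k2: "real m * t \<le> real (Suc ?k)" using nn by (simp add: idx_def of_nat_nat) linarith
  have "real m * t < real m" using t False mr by simp
  then have k: "?k < m" using k1 by linarith
  have "real ?k / m \<le> t" "t \<le> real (Suc ?k) / m"
    using k1 k2 mr by (simp_all add: divide_le_eq le_divide_eq mult.commute)
  then show ?thesis using osc_bound_ge[OF k] t by (simp add: Y_def grid_step_def)
qed

text \<open>Three comparisons share the tolerance \<open>r\<close>: \<open>Y\<close> with its grid
  version (\<open>r / 8 + r / 4\<close>), the finite-dimensional limit of the grid version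
  (\<open>r / 4\<close>), and the grid version of the limit with \<open>W\<close>
  (\<open>r / 4\<close>).\<close>

lemma lipschitz_limit:
  assumes lip: "\<And>x y. x \<in> cadlag_space \<Longrightarrow> y \<in> cadlag_space \<Longrightarrow> \<bar>\<phi> x - \<phi> y\<bar> \<le> K * skorohod_dist x y" and K: "0 \<le> K"
    and B: "\<And>x. x \<in> cadlag_space \<Longrightarrow> \<bar>\<phi> x\<bar> \<le> B"
  shows "(\<lambda>n. perm_mean {1..n} (\<lambda>p. \<phi> (Y n p))) \<longlonglongrightarrow> (\<integral>\<omega>. \<phi> (W \<omega>) \<partial>white_noise)"
proof (rule LIMSEQ_I)
  fix r :: real assume r: "0 < r"
  have cont: "continuous_map skorohod_topology euclideanreal \<phi>"
    by (rule lipschitz_continuous_map[OF lip K])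
  have B0: "0 \<le> B" using B[OF W_in_cadlag_space] by (rule order_trans[rotated]) simp
  \<comment> \<open>The uniform error allowed on paths with small oscillation, costing at most
    \<open>K * \<eta>\<close>. It is at most 1, so that a truncated fourth power below
    \<open>\<eta> ^ 4\<close> is not truncated at all.\<close>
  define \<eta> where "\<eta> = min 1 (r / (8 * (K + 1)))"
  have \<eta>: "0 < \<eta>" "\<eta> \<le> 1" using r K by (auto simp: \<eta>_def)
  have "K * \<eta> \<le> (K + 1) * (r / (8 * (K + 1)))" using K \<eta> by (intro mult_mono) (auto simp: \<eta>_def)
  also have "\<dots> = r / 8" using K by (simp add: field_simps)
  finally have K\<eta>: "K * \<eta> \<le> r / 8" .
  \<comment> \<open>Markov's inequality in pointwise form: where \<open>osc_bound\<close> is at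
    least \<open>\<eta> ^ 4\<close>, the trivial bound \<open>2 * B\<close> is at most
    \<open>D * osc_bound\<close>.\<close>
  define D where "D = 2 * B / \<eta> ^ 4"
  have D: "0 \<le> D" using B0 \<eta> by (simp add: D_def)
  define \<delta> where "\<delta> = r / (8 * (D + 1))"
  have \<delta>: "0 < \<delta>" using r D by (simp add: \<delta>_def)
  have "D * \<delta> \<le> (D + 1) * \<delta>" using \<delta> by (intro mult_right_mono) auto
  also have "\<dots> = r / 8" using D by (simp add: \<delta>_def field_simps)
  finally have D\<delta>: "D * \<delta> \<le> r / 8" .
  have "(\<lambda>m. \<integral>\<omega>. \<phi> (grid_step m (Zg \<omega>)) \<partial>white_noise) \<longlonglongrightarrow> (\<integral>\<omega>. \<phi> (W \<omega>) \<partial>white_noise)"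
  proof (rule integral_dominated_convergence[where w = "\<lambda>_. B"])
    show "(\<lambda>\<omega>. \<phi> (W \<omega>)) \<in> borel_measurable white_noise"
      by (rule measurable_compose[OF W_measurable continuous_map_borel_measurable[OF cont]])
    show "(\<lambda>\<omega>. \<phi> (grid_step m (Zg \<omega>))) \<in> borel_measurable white_noise" for m
      by (rule measurable_compose[OF Zg_measurable borel_measurable_continuous_onI[OF continuous_grid_step[OF cont]]])
  qed (use B grid_step_in_cadlag_space continuous_grid_step_Zg_tendsto[OF cont] in auto)
  moreover have Zg: "(\<integral>\<omega>. \<phi> (grid_step m (Zg \<omega>)) \<partial>white_noise) = (\<integral>\<omega>. \<phi> (grid_step m (Z \<omega>)) \<partial>white_noise)" for m
  proof (rule integral_cong_AE)
    show "AE \<omega> in white_noise. \<phi> (grid_step m (Zg \<omega>)) = \<phi> (grid_step m (Z \<omega>))"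
      using AE_good by eventually_elim (simp add: Zg_def)
    show "(\<lambda>\<omega>. \<phi> (grid_step m (Zg \<omega>))) \<in> borel_measurable white_noise"
      by (rule measurable_compose[OF Zg_measurable borel_measurable_continuous_onI[OF continuous_grid_step[OF cont]]])
    show "(\<lambda>\<omega>. \<phi> (grid_step m (Z \<omega>))) \<in> borel_measurable white_noise"
      by (rule measurable_compose[OF Z_measurable' borel_measurable_continuous_onI[OF continuous_grid_step[OF cont]]])
  qed
  ultimately have 1: "\<forall>\<^sub>F m in sequentially. dist (\<integral>\<omega>. \<phi> (grid_step m (Z \<omega>)) \<partial>white_noise) (\<integral>\<omega>. \<phi> (W \<omega>) \<partial>white_noise) < r / 4"
    using r by (intro tendstoD) auto
  have 2: "\<forall>\<^sub>F m in sequentially. eps m < \<delta>" using eps_lim \<delta> by (rule order_tendstoD)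
  have "\<forall>\<^sub>F m in sequentially. 0 < m \<and> eps m < \<delta> \<and>
      dist (\<integral>\<omega>. \<phi> (grid_step m (Z \<omega>)) \<partial>white_noise) (\<integral>\<omega>. \<phi> (W \<omega>) \<partial>white_noise) < r / 4"
    using 1 2 eventually_gt_at_top[of 0] by eventually_elim simp
  then obtain m where m: "0 < m" "eps m < \<delta>"
    "\<bar>(\<integral>\<omega>. \<phi> (grid_step m (Z \<omega>)) \<partial>white_noise) - (\<integral>\<omega>. \<phi> (W \<omega>) \<partial>white_noise)\<bar> < r / 4"
    unfolding dist_real_def using eventually_happens'[OF sequentially_bot] by blast
  have pt: "\<bar>\<phi> (Y n p) - \<phi> (grid_step m (X n p))\<bar> \<le> K * \<eta> + D * osc_bound n m p" for n p
  proof -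
    have o0: "0 \<le> osc_bound n m p" using osc_bound_summand_nonneg by (simp add: osc_bound_def sum_nonneg)
    show ?thesis
    proof (cases "osc_bound n m p < \<eta> ^ 4")
      case True
      have "skorohod_dist (Y n p) (grid_step m (X n p)) \<le> \<eta>"
      proof (rule skorohod_dist_le[OF Y_in_cadlag_space grid_step_in_cadlag_space \<eta>(1)])
        fix t :: real assume t: "t \<in> {0..1}"
        have "min 1 ((Y n p t - grid_step m (X n p) t) ^ 4) < \<eta> ^ 4"
          using grid_step_osc[OF m(1) t, of n p] True by simp
        moreover have "\<eta> ^ 4 \<le> 1" using \<eta> by (simp add: power_le_one)
        ultimately have "(Y n p t - grid_step m (X n p) t) ^ 4 < \<eta> ^ 4" by (auto simp: min_def split: if_splits)
        then have "\<bar>Y n p t - grid_step m (X n p) t\<bar> ^ 4 < \<eta> ^ 4" by (simp add: power_even_abs)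
        then show "\<bar>Y n p t - grid_step m (X n p) t\<bar> \<le> \<eta>"
          by (intro less_imp_le, elim power_less_imp_less_base) (use \<eta>(1) in simp)
      qed
      then have "K * skorohod_dist (Y n p) (grid_step m (X n p)) \<le> K * \<eta>" using K by (rule mult_left_mono)
      moreover have "0 \<le> D * osc_bound n m p" using D o0 by simp
      ultimately show ?thesis using lip[OF Y_in_cadlag_space grid_step_in_cadlag_space, of n p m "X n p"] by linarith
    next
      case False
      have "2 * B = D * \<eta> ^ 4" using \<eta> by (simp add: D_def)
      also have "\<dots> \<le> D * osc_bound n m p" using False D by (intro mult_left_mono) auto
      finally have "2 * B \<le> D * osc_bound n m p" .
      moreover have "0 \<le> K * \<eta>" using K \<eta> by simp
      ultimately show ?thesis using B[OF Y_in_cadlag_space, of n p] B[OF grid_step_in_cadlag_space, of m "X n p"] by linarith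
    qed
  qed
  have lim: "(\<lambda>n. perm_mean {1..n} (\<lambda>p. \<phi> (grid_step m (X n p)))) \<longlonglongrightarrow> (\<integral>\<omega>. \<phi> (grid_step m (Z \<omega>)) \<partial>white_noise)"
  proof (rule finite_dimensional_limit[of "grid m ` {..m}" "\<lambda>y. \<phi> (grid_step m y)" B])
    show "\<phi> (grid_step m x) = \<phi> (grid_step m y)" if "\<And>i. i \<in> grid m ` {..m} \<Longrightarrow> x i = y i" for x y
      using grid_step_depends[OF that] by simp
  qed (use B grid_step_in_cadlag_space continuous_grid_step[OF cont] in auto)
  have "\<forall>\<^sub>F n in sequentially. dist (perm_mean {1..n} (\<lambda>p. \<phi> (grid_step m (X n p)))) (\<integral>\<omega>. \<phi> (grid_step m (Z \<omega>)) \<partial>white_noise) < r / 4"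
    using r by (intro tendstoD[OF lim]) auto
  moreover have "\<forall>\<^sub>F n in sequentially. perm_mean {1..n} (osc_bound n m) \<le> eps m + \<delta>"
    by (rule osc_bound_mean_eventually[OF m(1) \<delta>])
  ultimately have "\<forall>\<^sub>F n in sequentially. norm (perm_mean {1..n} (\<lambda>p. \<phi> (Y n p)) - (\<integral>\<omega>. \<phi> (W \<omega>) \<partial>white_noise)) < r"
  proof eventually_elim
    case (elim n)
    have "\<bar>perm_mean {1..n} (\<lambda>p. \<phi> (Y n p)) - perm_mean {1..n} (\<lambda>p. \<phi> (grid_step m (X n p)))\<bar>
        = \<bar>perm_mean {1..n} (\<lambda>p. \<phi> (Y n p) - \<phi> (grid_step m (X n p)))\<bar>"
      by (simp only: perm_mean_diff)
    also have "\<dots> \<le> perm_mean {1..n} (\<lambda>p. K * \<eta> + D * osc_bound n m p)"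
      by (rule abs_perm_mean_le) (rule pt)
    also have "\<dots> = K * \<eta> + D * perm_mean {1..n} (osc_bound n m)"
      by (simp only: perm_mean_add perm_mean_mult perm_mean_const[OF finite_atLeastAtMost])
    also have "\<dots> \<le> r / 8 + D * (2 * \<delta>)"
      using K\<eta> elim(2) m(2) D by (intro add_mono mult_left_mono) auto
    also have "\<dots> \<le> r / 8 + r / 4" using D\<delta> by simp
    finally show ?case using elim(1) m(3) unfolding dist_real_def real_norm_def by linarith
  qed
  then show "\<exists>no. \<forall>n\<ge>no. norm (perm_mean {1..n} (\<lambda>p. \<phi> (Y n p)) - (\<integral>\<omega>. \<phi> (W \<omega>) \<partial>white_noise)) < r"
    unfolding eventually_sequentially .
qed

text \<open>An envelope lies below \<open>h\<close>, so its limit bounds the means of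
  \<open>h\<close> from below; by dominated convergence, the expectation of a late envelope loses
  less than \<open>e\<close>.\<close>

lemma continuous_lower_limit:
  assumes h: "continuous_map skorohod_topology euclideanreal h"
    and B: "\<And>x. x \<in> cadlag_space \<Longrightarrow> \<bar>h x\<bar> \<le> B" and e: "0 < e"
  shows "\<forall>\<^sub>F n in sequentially. (\<integral>\<omega>. h (W \<omega>) \<partial>white_noise) - e < perm_mean {1..n} (\<lambda>p. h (Y n p))"
proof -
  note lipk = lip_envelope_lipschitz[OF B]
  have "(\<lambda>k. \<integral>\<omega>. lip_envelope h k (W \<omega>) \<partial>white_noise) \<longlonglongrightarrow> (\<integral>\<omega>. h (W \<omega>) \<partial>white_noise)"
  proof (rule integral_dominated_convergence[where w = "\<lambda>_. B"])
    show "(\<lambda>\<omega>. h (W \<omega>)) \<in> borel_measurable white_noise"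
      by (rule measurable_compose[OF W_measurable continuous_map_borel_measurable[OF h]])
    show "(\<lambda>\<omega>. lip_envelope h k (W \<omega>)) \<in> borel_measurable white_noise" for k
    proof -
      have "continuous_map skorohod_topology euclideanreal (lip_envelope h k)"
        by (rule lipschitz_continuous_map[where K = "real k"]) (use lipk in auto)
      then show ?thesis by (intro measurable_compose[OF W_measurable continuous_map_borel_measurable])
    qed
    show "AE \<omega> in white_noise. (\<lambda>k. lip_envelope h k (W \<omega>)) \<longlonglongrightarrow> h (W \<omega>)"
      using lip_envelope_tendsto[OF B h W_in_cadlag_space] by simp
    show "AE \<omega> in white_noise. norm (lip_envelope h k (W \<omega>)) \<le> B" for k
      using lip_envelope_abs[OF B W_in_cadlag_space] by simp
  qed simp
  then have "\<forall>\<^sub>F k in sequentially. (\<integral>\<omega>. h (W \<omega>) \<partial>white_noise) - e < (\<integral>\<omega>. lip_envelope h k (W \<omega>) \<partial>white_noise)"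
    using e by (intro order_tendstoD(1)) auto
  then obtain k where k: "(\<integral>\<omega>. h (W \<omega>) \<partial>white_noise) - e < (\<integral>\<omega>. lip_envelope h k (W \<omega>) \<partial>white_noise)"
    using eventually_happens'[OF sequentially_bot] by blast
  have "(\<lambda>n. perm_mean {1..n} (\<lambda>p. lip_envelope h k (Y n p))) \<longlonglongrightarrow> (\<integral>\<omega>. lip_envelope h k (W \<omega>) \<partial>white_noise)"
    by (rule lipschitz_limit[where K = "real k" and B = B]) (use lipk lip_envelope_abs[OF B] in auto)
  then have "\<forall>\<^sub>F n in sequentially. (\<integral>\<omega>. h (W \<omega>) \<partial>white_noise) - e < perm_mean {1..n} (\<lambda>p. lip_envelope h k (Y n p))"
    using k by (rule order_tendstoD)
  then show ?thesis
  proof eventually_elim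
    case (elim n)
    have "perm_mean {1..n} (\<lambda>p. lip_envelope h k (Y n p)) \<le> perm_mean {1..n} (\<lambda>p. h (Y n p))"
      by (intro perm_mean_mono lip_envelope_le[OF B] Y_in_cadlag_space)
    then show ?case using elim by simp
  qed
qed

lemma continuous_limit:
  assumes h: "continuous_map skorohod_topology euclideanreal h" and b: "bounded (h ` cadlag_space)"
  shows "(\<lambda>n. perm_mean {1..n} (\<lambda>p. h (Y n p))) \<longlonglongrightarrow> (\<integral>\<omega>. h (W \<omega>) \<partial>white_noise)"
proof -
  obtain B where B: "\<And>x. x \<in> cadlag_space \<Longrightarrow> \<bar>h x\<bar> \<le> B"
    using b by (auto simp: bounded_iff)
  have h': "continuous_map skorohod_topology euclideanreal (\<lambda>x. - h x)"
    using h by (rule continuous_map_minus)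
  have B': "\<bar>- h x\<bar> \<le> B" if "x \<in> cadlag_space" for x using B[OF that] by simp
  show ?thesis
  proof (rule order_tendstoI)
    fix a assume "a < (\<integral>\<omega>. h (W \<omega>) \<partial>white_noise)"
    then show "\<forall>\<^sub>F n in sequentially. a < perm_mean {1..n} (\<lambda>p. h (Y n p))"
      using continuous_lower_limit[OF h B, of "(\<integral>\<omega>. h (W \<omega>) \<partial>white_noise) - a"] by simp
  next
    fix a assume "(\<integral>\<omega>. h (W \<omega>) \<partial>white_noise) < a"
    then show "\<forall>\<^sub>F n in sequentially. perm_mean {1..n} (\<lambda>p. h (Y n p)) < a"
      using continuous_lower_limit[OF h' B', of "a - (\<integral>\<omega>. h (W \<omega>) \<partial>white_noise)"]
      by (simp add: perm_mean_minus)
  qed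
qed

end

section \<open>Specialisation to the scaled matrices and the given permutations\<close>

theorem theorem3p3:
  fixes a :: "nat \<Rightarrow> nat \<Rightarrow> nat \<Rightarrow> real"
    and s :: "nat \<Rightarrow> real"
    and P :: "nat \<Rightarrow> 'w measure"
    and \<pi> :: "nat \<Rightarrow> 'w \<Rightarrow> nat \<Rightarrow> nat"
    and f :: "real \<Rightarrow> real"
    and g :: "real \<Rightarrow> real \<Rightarrow> real"
  assumes row_sums: "\<And>n i. n \<ge> 2 \<Longrightarrow> i \<in> {1..n} \<Longrightarrow> (\<Sum>j = 1..n. a n i j) = 0"
    and s_pos: "\<And>n. n \<ge> 2 \<Longrightarrow> s n > 0"
    and perm: "\<And>n. n \<ge> 2 \<Longrightarrow> uniform_random_permutation (P n) n (\<pi> n)"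
    and f_lim: "\<And>t. t \<in> {0..1} \<Longrightarrow> (\<lambda>n. f_fun n (a n) (s n) t) \<longlonglongrightarrow> f t"
    and g_lim: "\<And>t u. t \<in> {0..1} \<Longrightarrow> u \<in> {0..1} \<Longrightarrow>
                  (\<lambda>n. g_fun n (a n) (s n) t u) \<longlonglongrightarrow> g t u"
    and f_cont: "continuous_on {0..1} f"
    and lyapunov: "(\<lambda>n. lyapunov_ratio n (a n) (s n) * (ln (real n))\<^sup>2) \<longlonglongrightarrow> 0"
  shows "\<exists>(Q :: (real \<Rightarrow> real) measure) (Z :: real \<Rightarrow> (real \<Rightarrow> real) \<Rightarrow> real).
           prob_space Q \<and>
           gaussian_process Q {0..1} Z \<and>
           (\<forall>\<omega>\<in>space Q. continuous_on {0..1} (\<lambda>t. Z t \<omega>)) \<and>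
           (\<forall>t\<in>{0..1}. (\<integral>\<omega>. Z t \<omega> \<partial>Q) = 0) \<and>
           (\<forall>t\<in>{0..1}. \<forall>u\<in>{0..1}. covariance Q (Z t) (Z u) = f (min t u) - g t u) \<and>
           converges_in_distribution skorohod_topology
             P (\<lambda>n \<omega>. \<lambda>t\<in>{0..1}. comb_process n (a n) (s n) (\<pi> n \<omega>) t)
             Q (\<lambda>\<omega>. \<lambda>t\<in>{0..1}. Z t \<omega>)"
proof -
  define b where "b n i l = a n i l / s n" for n i l
  have f_eq: "f_fun n (a n) (s n) t = (\<Sum>i=1..idx n t. \<Sum>l=1..n. (b n i l)\<^sup>2) / n" for n t
    by (simp add: f_fun_def idx_def b_def power_divide sum_divide_distrib[symmetric])
  have g_eq: "g_fun n (a n) (s n) t u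
      = (\<Sum>l=1..n. (\<Sum>i=1..idx n t. b n i l) * (\<Sum>i=1..idx n u. b n i l)) / (real n)\<^sup>2" for n t u
  proof -
    have "(\<Sum>i=1..idx n t. \<Sum>j=1..idx n u. \<Sum>l=1..n. a n i l * a n j l)
        = (\<Sum>l=1..n. (\<Sum>i=1..idx n t. a n i l) * (\<Sum>j=1..idx n u. a n j l))"
    proof -
      have "(\<Sum>i=1..idx n t. \<Sum>j=1..idx n u. \<Sum>l=1..n. a n i l * a n j l)
          = (\<Sum>i=1..idx n t. \<Sum>l=1..n. \<Sum>j=1..idx n u. a n i l * a n j l)"
        by (rule sum.cong[OF refl], rule sum.swap)
      also have "\<dots> = (\<Sum>l=1..n. \<Sum>i=1..idx n t. \<Sum>j=1..idx n u. a n i l * a n j l)" by (rule sum.swap)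
      finally show ?thesis by (simp only: sum_product)
    qed
    then show ?thesis
      by (simp add: g_fun_def idx_def b_def sum_divide_distrib[symmetric] power_mult_distrib power2_eq_square)
  qed
  have l_eq: "lyapunov_ratio n (a n) (s n) = (\<Sum>i=1..n. \<Sum>l=1..n. \<bar>b n i l\<bar> ^ 3) / n" if "n \<ge> 2" for n
    using s_pos[OF that] by (simp add: lyapunov_ratio_def b_def power_divide sum_divide_distrib[symmetric])
  let ?\<Lambda> = "\<lambda>n. (\<Sum>i=1..n. \<Sum>l=1..n. \<bar>b n i l\<bar> ^ 3) / real n"
  have lam: "?\<Lambda> \<longlonglongrightarrow> 0"
  proof (rule Lim_null_comparison[OF _ lyapunov])
    show "\<forall>\<^sub>F n in sequentially. norm (?\<Lambda> n) \<le> lyapunov_ratio n (a n) (s n) * (ln (real n))\<^sup>2"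
    proof (rule eventually_sequentiallyI[of 3])
      fix n :: nat assume n: "3 \<le> n"
      \<comment> \<open>As \<open>exp 1\<close> is at most 3, the squared logarithm is at least 1
        from \<open>n = 3\<close> on, and the ratio is dominated by its product with it.\<close>
      have "exp 1 \<le> real n" using exp_le n by linarith
      then have "1 \<le> ln (real n)" using n by (simp add: ln_ge_iff)
      then have "1 \<le> (ln (real n))\<^sup>2" by (simp add: one_le_power)
      moreover have "0 \<le> ?\<Lambda> n" by (simp add: sum_nonneg)
      ultimately have "?\<Lambda> n * 1 \<le> ?\<Lambda> n * (ln (real n))\<^sup>2" by (intro mult_left_mono)
      then show "norm (?\<Lambda> n) \<le> lyapunov_ratio n (a n) (s n) * (ln (real n))\<^sup>2"
        using l_eq[of n] n \<open>0 \<le> ?\<Lambda> n\<close> by simp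
    qed
  qed
  interpret matrix_arrays b f g "\<lambda>n k. (\<Sum>i=1..k. \<Sum>l=1..n. (b n i l)\<^sup>2) / real n"
    "\<lambda>n j k. (\<Sum>l=1..n. (\<Sum>i=1..j. b n i l) * (\<Sum>i=1..k. b n i l)) / (real n)\<^sup>2"
  proof unfold_locales
    show "(\<Sum>l=1..n. b n i l) = 0" if "2 \<le> n" "i \<in> {1..n}" for n i
      using row_sums[OF that] by (simp add: b_def sum_divide_distrib[symmetric])
    show "(\<lambda>n. (\<Sum>i=1..idx n t. \<Sum>l=1..n. (b n i l)\<^sup>2) / real n) \<longlonglongrightarrow> f t" if "t \<in> {0..1}" for t
      using f_lim[OF that] by (simp only: f_eq)
    show "(\<lambda>n. (\<Sum>l=1..n. (\<Sum>i=1..idx n t. b n i l) * (\<Sum>i=1..idx n u. b n i l)) / (real n)\<^sup>2) \<longlonglongrightarrow> g t u"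
      if "t \<in> {0..1}" "u \<in> {0..1}" for t u
      using g_lim[OF that] by (simp only: g_eq)
  qed (use f_cont lam in auto)
  obtain Z where Z: "\<And>i. (\<lambda>\<omega>. Z \<omega> i) \<in> borel_measurable white_noise"
    "\<And>I c. finite I \<Longrightarrow> (\<integral>\<omega>. iexp (\<Sum>i\<in>I. c i * Z \<omega> i) \<partial>white_noise)
        = exp (- (\<Sum>i\<in>I. \<Sum>j\<in>I. c i * c j * \<sigma> (rat_time i) (rat_time j)) / 2)"
    by (rule gaussian_family_exists[OF psd_kernel_\<sigma>[of rat_time, OF rat_time_in]], rule that)
  interpret gaussian_limit b f g "\<lambda>n k. (\<Sum>i=1..k. \<Sum>l=1..n. (b n i l)\<^sup>2) / real n"
    "\<lambda>n j k. (\<Sum>l=1..n. (\<Sum>i=1..j. b n i l) * (\<Sum>i=1..k. b n i l)) / (real n)\<^sup>2" Z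
    by unfold_locales (rule Z, erule Z)
  let ?Y = "\<lambda>n \<omega>. \<lambda>t\<in>{0..1}. comb_process n (a n) (s n) (\<pi> n \<omega>) t"
  have Y_eq: "?Y n \<omega> = Y n (\<pi> n \<omega>)" for n \<omega>
    unfolding Y_def by (intro restrict_ext) (simp add: comb_process_def partial_sum_def idx_def b_def sum_divide_distrib)
  have conv: "converges_in_distribution skorohod_topology P ?Y white_noise (\<lambda>\<omega>. \<lambda>t\<in>{0..1}. Zpath t \<omega>)"
    unfolding converges_in_distribution_def Y_eq W_def[symmetric]
  proof (intro conjI allI impI)
    have "prob_space (P n) \<and> (\<lambda>\<omega>. Y n (\<pi> n \<omega>)) \<in> measurable (P n) (borel_sets_of skorohod_topology)" if n: "n \<ge> 2" for n
    proof
      have \<pi>: "\<pi> n \<in> measurable (P n) (count_space {p. p permutes {1..n}})"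
        using perm[OF n] by (simp add: uniform_random_permutation_def)
      show "prob_space (P n)" using perm[OF n] by (simp add: uniform_random_permutation_def)
      show "(\<lambda>\<omega>. Y n (\<pi> n \<omega>)) \<in> measurable (P n) (borel_sets_of skorohod_topology)"
        by (rule measurable_compose[OF \<pi>]) (simp add: Y_in_cadlag_space)
    qed
    then show "\<forall>\<^sub>F n in sequentially. prob_space (P n) \<and> (\<lambda>\<omega>. Y n (\<pi> n \<omega>)) \<in> measurable (P n) (borel_sets_of skorohod_topology)"
      by (rule eventually_sequentiallyI)
    show "prob_space white_noise" by (rule prob_space_white_noise)
    show "W \<in> measurable white_noise (borel_sets_of skorohod_topology)" by (rule W_measurable)
    fix h :: "(real \<Rightarrow> real) \<Rightarrow> real"
    assume h: "continuous_map skorohod_topology euclideanreal h" "bounded (h ` topspace skorohod_topology)"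
    have "(\<integral>\<omega>. h (Y n (\<pi> n \<omega>)) \<partial>P n) = perm_mean {1..n} (\<lambda>p. h (Y n p))" if n: "n \<ge> 2" for n
    proof -
      let ?S = "{p. p permutes {1..n}}"
      have \<pi>: "\<pi> n \<in> measurable (P n) (count_space ?S)"
        and d: "distr (P n) (count_space ?S) (\<pi> n) = uniform_count_measure ?S"
        using perm[OF n] by (simp_all add: uniform_random_permutation_def)
      have fin: "finite ?S" by (rule finite_permutations) simp
      have "(\<integral>\<omega>. h (Y n (\<pi> n \<omega>)) \<partial>P n) = (\<integral>p. h (Y n p) \<partial>distr (P n) (count_space ?S) (\<pi> n))"
        by (rule integral_distr[OF \<pi>, symmetric]) simp
      also have "\<dots> = (\<Sum>p\<in>?S. h (Y n p)) / card ?S"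
        unfolding d using fin by (rule integral_uniform_count_measure)
      also have "\<dots> = perm_mean {1..n} (\<lambda>p. h (Y n p))"
        by (simp add: perm_mean_def card_permutations divide_inverse mult.commute)
      finally show ?thesis .
    qed
    then have "\<forall>\<^sub>F n in sequentially. perm_mean {1..n} (\<lambda>p. h (Y n p)) = (\<integral>\<omega>. h (Y n (\<pi> n \<omega>)) \<partial>P n)"
      by (intro eventually_sequentiallyI[of 2]) simp
    moreover have "(\<lambda>n. perm_mean {1..n} (\<lambda>p. h (Y n p))) \<longlonglongrightarrow> (\<integral>\<omega>. h (W \<omega>) \<partial>white_noise)"
      using h by (intro continuous_limit) simp_all
    ultimately show "(\<lambda>n. \<integral>\<omega>. h (Y n (\<pi> n \<omega>)) \<partial>P n) \<longlonglongrightarrow> (\<integral>\<omega>. h (W \<omega>) \<partial>white_noise)"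
      by (rule Lim_transform_eventually[rotated])
  qed
  show ?thesis
    using prob_space_white_noise gaussian_process_Zpath Zpath_continuous Zpath_mean(1) Zpath_covariance conv
    by (intro exI[of _ white_noise] exI[of _ Zpath]) (simp add: \<sigma>_def)
qed

end
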